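(* Let $u$ be a homogeneous degree $d\neq 2$ function, continuous in $\mathbb{R}^n\setminus\{0\}$, that is a (viscosity) solution to the elliptic equation $F(D^2u)=0$ in $\mathbb{R}^n$ with $F\in C^1$, where $\mu I\le (F_{ij}(M))\le \mu^{-1}I$ for some constant $\mu>0$ and all symmetric matrices $M$. Then $u$ is harmonic in a possible new coordinate system in $\mathbb{R}^n$, namely $$\sum_{i,j=1}^n F_{ij}(0)\,D_{ij}u(x)=0.$$ Consequently, $u\equiv 0$ if $-(n-2)<d<0$ or $d$ is not an integer; otherwise $u$ is a homogeneous harmonic polynomial with integer degree $d$.
   Context: $F$ is a real-valued function on the space of real symmetric $n\times n$ matrices, and $F_{ij}(M)=F_{M_{ij}}(M)$ denotes its partial derivative with respect to the matrix entry $M_{ij}$, so $(F_{ij}(M))$ is a symmetric $n\times n$ matrix. $I$ is the identity matrix, and matrix inequalities are in the sense of quadratic forms. $D^2u$ is the Hessian of $u$, with entries $D_{ij}u$. Homogeneous of degree $d$ (with $d$ real) means $u(tx)=t^d u(x)$ for all $t>0$ and $x\neq 0$. Solutions are understood in the viscosity sense: $u$ is a viscosity subsolution (respectively supersolution) of $F(D^2u)=0$ if, whenever a smooth function $\varphi$ satisfies $\varphi(x_0)=u(x_0)$ and $\varphi\ge u$ (respectively $\varphi\le u$) in a neighborhood of a point $x_0$, one has $F(D^2\varphi(x_0))\ge 0$ (respectively $\le 0$). It is a viscosity solution if it is both. "Harmonic" is understood in the new coordinate system, that is, in linear coordinates in which the positive definite matrix $(F_{ij}(0))$ becomes $I$,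 so that the displayed equation becomes Laplace's equation.
   Formalization: For integers d<0, d≤-(n-2), "harmonic polynomial of degree d" fails (u=x_1/|x|^n); off 0, u is instead the Kelvin transform of one of degree 2-n-d. For n=1 the polynomial claim omits d=0 (u=sgn x), and d=1 if the equation is not imposed at 0 (u=|x|). *)

theory Defs
  imports "HOL-Analysis.Analysis"
begin

definition sym_matrices :: "(real^'n^'n) set" where
  "sym_matrices = {M. transpose M = M}"

definition loewner_le :: "real^'n^'n \<Rightarrow> real^'n^'n \<Rightarrow> bool" where
  "loewner_le A B \<longleftrightarrow> (\<forall>x. x \<bullet> (A *v x) \<le> x \<bullet> (B *v x))"

text \<open>A function on the space of symmetric matrices is a function on all square matrices of which
  only the values at symmetric matrices are ever used.  The derivative \<open>D M\<close> is determined only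
  on symmetric directions, so asking for some choice that is continuous in \<open>M\<close> is no restriction.\<close>

definition C1_on_sym :: "(real^'n^'n \<Rightarrow> real) \<Rightarrow> bool" where
  "C1_on_sym F \<longleftrightarrow>
     (\<exists>D :: real^'n^'n \<Rightarrow> (real^'n^'n) \<Rightarrow>\<^sub>L real.
        continuous_on sym_matrices D \<and>
        (\<forall>M\<in>sym_matrices. (F has_derivative blinfun_apply (D M)) (at M within sym_matrices)))"

definition sym_part :: "real^'n^'n \<Rightarrow> real^'n^'n" where
  "sym_part M = (1/2) *\<^sub>R (M + transpose M)"

definition matrix_unit :: "'n \<Rightarrow> 'n \<Rightarrow> real^'n^'n" where
  "matrix_unit i j = (\<chi> k l. if k = i \<and> l = j then 1 else 0)"

text \<open>The matrix \<open>(F\<^sub>i\<^sub>j(M))\<close>: the partial derivative in the \<open>(i,j)\<close> entry of the symmetric extension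
  of \<open>F\<close>, with the \<open>n\<^sup>2\<close> entries as independent variables.  This is the normalisation for which
  \<open>(F\<^sub>i\<^sub>j(M))\<close> is symmetric and the differential of \<open>F\<close> at \<open>M\<close> is
  \<open>H \<mapsto> \<Sum>i j. F\<^sub>i\<^sub>j(M) H\<^sub>i\<^sub>j\<close> on symmetric \<open>H\<close>.\<close>

definition F_partial :: "(real^'n^'n \<Rightarrow> real) \<Rightarrow> real^'n^'n \<Rightarrow> real^'n^'n" where
  "F_partial F M = (\<chi> i j. deriv (\<lambda>t. F (sym_part (M + t *\<^sub>R matrix_unit i j))) 0)"

definition pderiv_at :: "'n \<Rightarrow> (real^'n \<Rightarrow> real) \<Rightarrow> real^'n \<Rightarrow> real" where
  "pderiv_at i f x = deriv (\<lambda>t. f (x + t *\<^sub>R axis i 1)) 0"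

definition hessian :: "(real^'n \<Rightarrow> real) \<Rightarrow> real^'n \<Rightarrow> real^'n^'n" where
  "hessian f x = (\<chi> i j. pderiv_at i (pderiv_at j f) x)"

text \<open>\<open>C\<^sup>k\<close> on an open set \<open>S\<close>.\<close>

fun Ck_on :: "nat \<Rightarrow> (real^'n) set \<Rightarrow> (real^'n \<Rightarrow> real) \<Rightarrow> bool" where
  "Ck_on 0 S f \<longleftrightarrow> continuous_on S f"
| "Ck_on (Suc k) S f \<longleftrightarrow> f differentiable_on S \<and> (\<forall>i. Ck_on k S (pderiv_at i f))"

definition smooth :: "(real^'n \<Rightarrow> real) \<Rightarrow> bool" where
  "smooth f \<longleftrightarrow> (\<forall>k. Ck_on k UNIV f)"

definition viscosity_subsolution ::
    "(real^'n) set \<Rightarrow> (real^'n^'n \<Rightarrow> real) \<Rightarrow> (real^'n \<Rightarrow> real) \<Rightarrow> bool" where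
  "viscosity_subsolution \<Omega> F u \<longleftrightarrow>
     (\<forall>x0\<in>\<Omega>. \<forall>\<phi>. smooth \<phi> \<longrightarrow> \<phi> x0 = u x0 \<longrightarrow> (\<forall>\<^sub>F x in nhds x0. \<phi> x \<ge> u x) \<longrightarrow>
        F (hessian \<phi> x0) \<ge> 0)"

definition viscosity_supersolution ::
    "(real^'n) set \<Rightarrow> (real^'n^'n \<Rightarrow> real) \<Rightarrow> (real^'n \<Rightarrow> real) \<Rightarrow> bool" where
  "viscosity_supersolution \<Omega> F u \<longleftrightarrow>
     (\<forall>x0\<in>\<Omega>. \<forall>\<phi>. smooth \<phi> \<longrightarrow> \<phi> x0 = u x0 \<longrightarrow> (\<forall>\<^sub>F x in nhds x0. \<phi> x \<le> u x) \<longrightarrow>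
        F (hessian \<phi> x0) \<le> 0)"

definition viscosity_solution ::
    "(real^'n) set \<Rightarrow> (real^'n^'n \<Rightarrow> real) \<Rightarrow> (real^'n \<Rightarrow> real) \<Rightarrow> bool" where
  "viscosity_solution \<Omega> F u \<longleftrightarrow> viscosity_subsolution \<Omega> F u \<and> viscosity_supersolution \<Omega> F u"

definition homogeneous :: "real \<Rightarrow> (real^'n \<Rightarrow> real) \<Rightarrow> bool" where
  "homogeneous d u \<longleftrightarrow> (\<forall>t x. t > 0 \<longrightarrow> x \<noteq> 0 \<longrightarrow> u (t *\<^sub>R x) = t powr d * u x)"

definition harmonic_on :: "(real^'n) set \<Rightarrow> (real^'n \<Rightarrow> real) \<Rightarrow> bool" where
  "harmonic_on S v \<longleftrightarrow> Ck_on 2 S v \<and> (\<forall>x\<in>S. (\<Sum>i\<in>UNIV. hessian v x $ i $ i) = 0)"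

text \<open>The zero polynomial counts as homogeneous of every degree.\<close>

definition homogeneous_harmonic_polynomial :: "nat \<Rightarrow> (real^'n \<Rightarrow> real) \<Rightarrow> bool" where
  "homogeneous_harmonic_polynomial k p \<longleftrightarrow>
     real_polynomial_function p \<and> (\<forall>t x. p (t *\<^sub>R x) = t ^ k * p x) \<and> harmonic_on UNIV p"

text \<open>If \<open>h\<close> is a homogeneous harmonic polynomial of degree \<open>k\<close>, its Kelvin transform is
  the homogeneous harmonic function of degree \<open>2 - n - k\<close> on the punctured space with the same
  restriction to the unit sphere (a spherical harmonic) as \<open>h\<close>.\<close>

definition kelvin_transform :: "(real^'n \<Rightarrow> real) \<Rightarrow> real^'n \<Rightarrow> real" where
  "kelvin_transform h y = norm y powr (2 - real CARD('n)) * h ((1 / (norm y)\<^sup>2) *\<^sub>R y)"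

end

theory Submission
  imports Defs
begin

text \<open>
  Why the theorem is true.  The dilation \<open>z \<mapsto> t z\<close> turns a paraboloid that touches \<open>u\<close> from above
  into another one, because \<open>u\<close> is homogeneous, and it multiplies the Hessian by \<open>t\<close> to the power \<open>d - 2\<close>.
  As \<open>d \<noteq> 2\<close>, this factor runs through all positive numbers.  So if \<open>B\<close> is the Hessian of a
  paraboloid touching from above, then \<open>F (s B) \<ge> 0\<close> for every \<open>s > 0\<close>, and from below \<open>F (s B) \<le> 0\<close>.
  Letting \<open>s\<close> tend to 0 gives \<open>F 0 = 0\<close>, and after division by \<open>s\<close> the linearisation at the zero matrix
  satisfies the same inequality.  Ellipticity provides coordinates in which the linearisation is
  the Laplacian (\<open>positive_definite_normal_form\<close>), so \<open>u\<close> becomes a function \<open>v\<close> that is harmonic in the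
  viscosity sense on the punctured space (\<open>viscosity_subsolution_imp_subharmonic\<close>).

  What remains is to determine the homogeneous viscosity harmonic functions \<open>v\<close> on the punctured space
  of dimension \<open>n\<close>.  For \<open>n \<ge> 2\<close> and degree \<open>d \<ge> 0\<close> (\<open>homogeneous_viscosity_harmonic_nonneg_degree\<close>) the
  argument needs only polynomials and a maximum principle.
  \<^item> On the unit sphere every polynomial agrees with a harmonic polynomial
    (\<open>polynomial_harmonic_extension\<close>), so by the Stone--Weierstrass theorem harmonic polynomials
    approximate \<open>v\<close> uniformly on the sphere.
  \<^item> Functions of nonnegative degree are bounded near the origin, and for \<open>n \<ge> 2\<close> the barrier \<open>- ln (norm x)\<close>
    makes the puncture invisible (\<open>punctured_ball_comparison\<close>).  So the approximation is uniform in the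
    whole punctured ball.
  \<^item> Bernstein's device bounds the derivatives of a harmonic polynomial in a smaller ball by its supremum on
    the sphere (\<open>harmonic_polynomial_gradient_bound\<close>).  So the Taylor expansions at the origin of the
    approximating polynomials converge with a uniform remainder, and \<open>v\<close> itself has an expansion
    \<open>t powr d * v e = (\<Sum>j<m. H\<^sub>j e * t ^ j) + O(t ^ m)\<close> along each unit vector \<open>e\<close>.  Comparing powers of
    \<open>t\<close> for an \<open>m > d\<close> leaves \<open>v = H\<^sub>d\<close> if \<open>d\<close> is an integer and \<open>v = 0\<close> otherwise.

  If \<open>2 - n < d < 0\<close>, the power \<open>norm x powr d\<close> is strictly superharmonic, and touching the extrema of \<open>v\<close> on
  the sphere with multiples of it gives \<open>v = 0\<close>.  If \<open>d \<le> 2 - n\<close>, multiplication by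
  \<open>norm x powr (2 - n - 2 * d)\<close>, which amounts to the Kelvin transform on functions of degree \<open>d\<close>, leads back to
  a nonnegative degree (\<open>viscosity_subharmonic_kelvin\<close>).  In dimension one everything is explicit.

  The value at the origin, where continuity is not assumed, is forced by the equation there: a jump
  or a kink is touched by paraboloids that are arbitrarily steep in the wrong direction
  (\<open>viscosity_subsolution_no_concave_touch\<close>).
\<close>

section \<open>Partial derivatives and functions of class C^k\<close>

definition laplacian :: "(real^'n \<Rightarrow> real) \<Rightarrow> real^'n \<Rightarrow> real" where
  "laplacian f x = (\<Sum>i\<in>UNIV. pderiv_at i (pderiv_at i f) x)"

lemma trace_hessian: "(\<Sum>i\<in>UNIV. hessian f x $ i $ i) = laplacian f x"
  by (simp add: laplacian_def hessian_def)

lemma pderiv_at_eq: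
  assumes "(f has_derivative f') (at x)"
  shows "pderiv_at i f x = f' (axis i 1)"
proof -
  have lin: "linear f'" using assms has_derivative_linear by blast
  have 1: "((\<lambda>t. x + t *\<^sub>R axis i 1) has_derivative (\<lambda>t. t *\<^sub>R axis i 1)) (at (0::real))"
    by (auto intro!: derivative_eq_intros)
  have "((\<lambda>t. f (x + t *\<^sub>R axis i 1)) has_derivative (\<lambda>t. f' (t *\<^sub>R axis i 1))) (at 0)"
    using has_derivative_compose[OF 1, of f f'] assms by simp
  then have "((\<lambda>t. f (x + t *\<^sub>R axis i 1)) has_real_derivative f' (axis i 1)) (at 0)"
    by (simp add: has_field_derivative_def linear_cmul[OF lin] mult.commute[of _ "f' (axis i 1)"])
  then show ?thesis unfolding pderiv_at_def by (rule DERIV_imp_deriv)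
qed

text \<open>The definition of \<open>Ck_on\<close> asks for a derivative but continues with the partial derivatives; this is the link between the two.\<close>
lemma has_derivative_pderiv_at:
  fixes f :: "real^'n \<Rightarrow> real"
  assumes "f differentiable (at x)"
  shows "(f has_derivative (\<lambda>h. \<Sum>i\<in>UNIV. h $ i * pderiv_at i f x)) (at x)"
proof -
  obtain f' where f': "(f has_derivative f') (at x)"
    using assms differentiable_def by blast
  have lin: "linear f'" using f' has_derivative_linear by blast
  have "f' h = (\<Sum>i\<in>UNIV. h $ i * pderiv_at i f x)" for h
  proof -
    have "f' h = f' (\<Sum>i\<in>UNIV. h $ i *\<^sub>R axis i 1)"
      by (metis basis_expansion scalar_mult_eq_scaleR)
    then show ?thesis
      by (simp add: linear_sum[OF lin] linear_cmul[OF lin] pderiv_at_eq[OF f'])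
  qed
  then show ?thesis using f' by (metis (no_types, lifting) ext)
qed

lemma has_real_derivative_along_line:
  fixes f :: "real^'n \<Rightarrow> real"
  assumes "f differentiable (at (a + t *\<^sub>R w))"
  shows "((\<lambda>t. f (a + t *\<^sub>R w)) has_real_derivative (\<Sum>i\<in>UNIV. w $ i * pderiv_at i f (a + t *\<^sub>R w))) (at t)"
proof -
  have line: "((\<lambda>t. a + t *\<^sub>R w) has_derivative (\<lambda>s. s *\<^sub>R w)) (at t)"
    by (auto intro!: derivative_eq_intros)
  from has_derivative_compose[OF line has_derivative_pderiv_at[OF assms]]
  have "((\<lambda>t. f (a + t *\<^sub>R w)) has_derivative (\<lambda>s. s * (\<Sum>i\<in>UNIV. w $ i * pderiv_at i f (a + t *\<^sub>R w)))) (at t)"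
    by (simp add: sum_distrib_left mult.assoc)
  then show ?thesis by (simp add: has_field_derivative_def mult_commute_abs)
qed

lemma pderiv_at_cong:
  assumes "\<forall>\<^sub>F y in nhds x. f y = g y"
  shows "pderiv_at i f x = pderiv_at i g x"
proof -
  have "((\<lambda>t. x + t *\<^sub>R axis i 1) \<longlongrightarrow> x + 0 *\<^sub>R axis i 1) (nhds (0::real))"
    by (intro tendsto_intros filterlim_ident)
  then have "\<forall>\<^sub>F t in nhds 0. f (x + t *\<^sub>R axis i 1) = g (x + t *\<^sub>R axis i 1)"
    using eventually_compose_filterlim[OF assms] by simp
  then show ?thesis unfolding pderiv_at_def by (intro deriv_cong_ev) auto
qed

lemma pderiv_at_cong_open:
  assumes "open S" "x \<in> S" "\<And>y. y \<in> S \<Longrightarrow> f y = g y"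
  shows "pderiv_at i f x = pderiv_at i g x"
  by (rule pderiv_at_cong) (use assms eventually_nhds in blast)

lemma pderiv_at_const [simp]: "pderiv_at i (\<lambda>x. c) = (\<lambda>x. 0)"
  by (simp add: pderiv_at_def fun_eq_iff)

lemma pderiv_at_linear:
  assumes "bounded_linear f" shows "pderiv_at i f x = f (axis i 1)"
  using pderiv_at_eq bounded_linear_imp_has_derivative[OF assms] by blast

lemma pderiv_at_nth: "pderiv_at i (\<lambda>x. x $ j) x = (if i = j then 1 else 0)"
  by (subst pderiv_at_linear) (auto simp: bounded_linear_vec_nth axis_def)

lemma pderiv_at_add:
  assumes "f differentiable (at x)" "g differentiable (at x)"
  shows "pderiv_at i (\<lambda>y. f y + g y) x = pderiv_at i f x + pderiv_at i g x"
proof -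
  obtain f' g' where d: "(f has_derivative f') (at x)" "(g has_derivative g') (at x)"
    using assms by (auto simp: differentiable_def)
  show ?thesis using pderiv_at_eq[OF has_derivative_add[OF d]] pderiv_at_eq[OF d(1)] pderiv_at_eq[OF d(2)]
    by simp
qed

lemma pderiv_at_mult:
  assumes "f differentiable (at x)" "g differentiable (at x)"
  shows "pderiv_at i (\<lambda>y. f y * g y) x = f x * pderiv_at i g x + pderiv_at i f x * g x"
proof -
  obtain f' g' where d: "(f has_derivative f') (at x)" "(g has_derivative g') (at x)"
    using assms by (auto simp: differentiable_def)
  show ?thesis using pderiv_at_eq[OF has_derivative_mult[OF d]] pderiv_at_eq[OF d(1)] pderiv_at_eq[OF d(2)]
    by simp
qed

lemma pderiv_at_cmult:
  assumes "f differentiable (at x)"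
  shows "pderiv_at i (\<lambda>y. c * f y) x = c * pderiv_at i f x"
  using pderiv_at_mult[of "\<lambda>_. c" x f i] assms by simp

lemma pderiv_at_minus:
  "f differentiable (at x) \<Longrightarrow> pderiv_at i (\<lambda>y. - f y) x = - pderiv_at i f x"
  using pderiv_at_cmult[of f x i "-1"] by simp

lemma pderiv_at_diff:
  assumes "f differentiable (at x)" "g differentiable (at x)"
  shows "pderiv_at i (\<lambda>y. f y - g y) x = pderiv_at i f x - pderiv_at i g x"
  using pderiv_at_add[of f x "\<lambda>y. - g y" i] pderiv_at_minus[of g x i] assms differentiable_minus by fastforce

lemma pderiv_at_sum:
  assumes "finite I" "\<And>k. k \<in> I \<Longrightarrow> f k differentiable (at x)"
  shows "pderiv_at i (\<lambda>y. \<Sum>k\<in>I. f k y) x = (\<Sum>k\<in>I. pderiv_at i (f k) x)"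
  using assms
proof (induction I rule: finite_induct)
  case (insert k I)
  then show ?case by (simp add: pderiv_at_add differentiable_sum)
qed simp

lemma pderiv_at_compose_real:
  assumes "f differentiable (at x)" "(g has_real_derivative D) (at (f x))"
  shows "pderiv_at i (\<lambda>y. g (f y)) x = D * pderiv_at i f x"
proof -
  obtain f' where f': "(f has_derivative f') (at x)"
    using assms differentiable_def by blast
  have "((\<lambda>y. g (f y)) has_derivative (\<lambda>h. D * f' h)) (at x)"
    using has_derivative_compose[OF f', of g "(*) D"] assms(2) by (simp add: has_field_derivative_def)
  from pderiv_at_eq[OF this] show ?thesis using pderiv_at_eq[OF f'] by simp
qed

lemma pderiv_at_compose_matrix:
  fixes f :: "real^'n \<Rightarrow> real" and P :: "real^'n^'n"
  assumes "f differentiable (at (P *v x))"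
  shows "pderiv_at i (\<lambda>y. f (P *v y)) x = (\<Sum>k\<in>UNIV. P $ k $ i * pderiv_at k f (P *v x))"
proof -
  have P: "((\<lambda>y. P *v y) has_derivative (\<lambda>y. P *v y)) (at x)"
    by (simp add: bounded_linear_imp_has_derivative matrix_vector_mul_bounded_linear)
  have "((\<lambda>y. f (P *v y)) has_derivative (\<lambda>h. \<Sum>k\<in>UNIV. (P *v h) $ k * pderiv_at k f (P *v x))) (at x)"
    using has_derivative_compose[OF P] has_derivative_pderiv_at[OF assms] by blast
  then show ?thesis
    by (subst pderiv_at_eq, assumption) (simp add: matrix_vector_mult_basis column_def)
qed

lemma differentiable_on_cong:
  assumes "\<And>x. x \<in> S \<Longrightarrow> f x = g x"
  shows "f differentiable_on S \<longleftrightarrow> g differentiable_on S"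
proof -
  have "h differentiable_on S" if "f' differentiable_on S" "\<And>x. x \<in> S \<Longrightarrow> f' x = h x" for f' h
    unfolding differentiable_on_def
  proof
    fix x assume x: "x \<in> S"
    have "f' differentiable (at x within S)" using x that by (simp add: differentiable_on_def)
    then show "h differentiable (at x within S)"
      by (rule differentiable_transform_within[OF _ zero_less_one x]) (use that in auto)
  qed
  from this[of f g] this[of g f] show ?thesis using assms by auto
qed

text \<open>Partial derivatives at a point depend only on values near the point, so this needs \<open>S\<close> open.\<close>
lemma Ck_on_cong:
  assumes "open S" "\<And>x. x \<in> S \<Longrightarrow> f x = g x"
  shows "Ck_on k S f \<longleftrightarrow> Ck_on k S g"
  using assms(2)
proof (induction k arbitrary: f g)
  case 0
  then show ?case using continuous_on_cong by (metis Ck_on.simps(1))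
next
  case (Suc k)
  have "f differentiable_on S \<longleftrightarrow> g differentiable_on S"
    using differentiable_on_cong Suc.prems by blast
  moreover have "Ck_on k S (pderiv_at i f) \<longleftrightarrow> Ck_on k S (pderiv_at i g)" for i
    by (rule Suc.IH) (rule pderiv_at_cong_open[OF assms(1)], use Suc.prems in auto)
  ultimately show ?case by simp
qed

lemma Ck_on_Suc_imp: "Ck_on (Suc k) S f \<Longrightarrow> Ck_on k S f"
proof (induction k arbitrary: f)
  case 0
  then show ?case by (simp add: differentiable_imp_continuous_on)
qed auto

lemma Ck_on_subset: "Ck_on k S f \<Longrightarrow> T \<subseteq> S \<Longrightarrow> Ck_on k T f"
  by (induction k arbitrary: f) (auto intro: continuous_on_subset differentiable_on_subset)

lemma Ck_on_const [simp]: "Ck_on k S (\<lambda>x. c)"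
  by (induction k arbitrary: c) auto

lemma Ck_on_linear: "bounded_linear f \<Longrightarrow> Ck_on k S f"
proof (cases k)
  case (Suc l)
  assume f: "bounded_linear f"
  then have "pderiv_at i f = (\<lambda>x. f (axis i 1))" for i
    using pderiv_at_linear by blast
  then show ?thesis using Suc f
    by (simp add: bounded_linear_imp_differentiable_on)
qed (simp add: linear_continuous_on)

lemma Ck_on_SucI:
  assumes "open S" "f differentiable_on S" 
    and "\<And>i x. x \<in> S \<Longrightarrow> pderiv_at i f x = f' i x" "\<And>i. Ck_on k S (f' i)"
  shows "Ck_on (Suc k) S f"
proof -
  have "Ck_on k S (pderiv_at i f)" for i
    using Ck_on_cong[OF assms(1), of "pderiv_at i f" "f' i" k] assms(3,4) by blast
  then show ?thesis using assms(2) by simp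
qed

lemma Ck_on_add:
  assumes "open S"
  shows "Ck_on k S f \<Longrightarrow> Ck_on k S g \<Longrightarrow> Ck_on k S (\<lambda>x. f x + g x)"
proof (induction k arbitrary: f g)
  case (Suc k)
  then have "f differentiable (at x)" "g differentiable (at x)" if "x \<in> S" for x
    using differentiable_on_eq_differentiable_at[OF assms] that by auto
  with Suc show ?case
    by (intro Ck_on_SucI[where f' = "\<lambda>i x. pderiv_at i f x + pderiv_at i g x"] assms)
       (auto intro!: differentiable_on_add pderiv_at_add)
qed (simp add: continuous_on_add)

lemma Ck_on_mult:
  assumes "open S"
  shows "Ck_on k S f \<Longrightarrow> Ck_on k S g \<Longrightarrow> Ck_on k S (\<lambda>x. f x * g x)"
proof (induction k arbitrary: f g)
  case (Suc k)
  then have "f differentiable (at x)" "g differentiable (at x)" if "x \<in> S" for x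
    using differentiable_on_eq_differentiable_at[OF assms] that by auto
  moreover have "Ck_on k S f" "Ck_on k S g" using Suc.prems Ck_on_Suc_imp by auto
  ultimately show ?case using Suc
    by (intro Ck_on_SucI[where f' = "\<lambda>i x. f x * pderiv_at i g x + pderiv_at i f x * g x"] assms)
       (auto intro!: differentiable_on_mult pderiv_at_mult Ck_on_add[OF assms])
qed (simp add: continuous_on_mult)

lemma Ck_on_minus: "open S \<Longrightarrow> Ck_on k S f \<Longrightarrow> Ck_on k S (\<lambda>x. - f x)"
  using Ck_on_mult[of S k "\<lambda>_. -1" f] by simp

lemma Ck_on_diff: "open S \<Longrightarrow> Ck_on k S f \<Longrightarrow> Ck_on k S g \<Longrightarrow> Ck_on k S (\<lambda>x. f x - g x)"
  using Ck_on_add[of S k f "\<lambda>x. - g x"] Ck_on_minus by fastforce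

lemma Ck_on_sum:
  assumes "open S" "finite I" "\<And>j. j \<in> I \<Longrightarrow> Ck_on k S (f j)"
  shows "Ck_on k S (\<lambda>x. \<Sum>j\<in>I. f j x)"
  using assms(2,3) by (induction I rule: finite_induct) (auto intro: Ck_on_add[OF assms(1)])

lemma Ck_on_powr:
  fixes q :: "real^'n \<Rightarrow> real"
  assumes "open S" and pos: "\<And>x. x \<in> S \<Longrightarrow> q x > 0"
  shows "Ck_on k S q \<Longrightarrow> Ck_on k S (\<lambda>x. q x powr a)"
proof (induction k arbitrary: a)
  case 0
  then show ?case using pos by (auto intro!: continuous_intros dest: pos)
next
  case (Suc k)
  then have d: "q differentiable (at x)" if "x \<in> S" for x
    using differentiable_on_eq_differentiable_at[OF assms(1)] that by auto
  have D: "((\<lambda>t. t powr a) has_real_derivative a * q x powr (a - 1)) (at (q x))" if "x \<in> S" for x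
    using pos[OF that] by (auto intro!: derivative_eq_intros)
  have "(\<lambda>x. q x powr a) differentiable_on S"
    unfolding differentiable_on_eq_differentiable_at[OF assms(1)]
  proof
    fix x assume "x \<in> S"
    then show "(\<lambda>x. q x powr a) differentiable (at x)"
      using differentiable_chain_at[OF d, of x "\<lambda>t. t powr a"] D[of x, THEN has_field_derivative_imp_has_derivative, THEN differentiableI]
      by (simp add: o_def)
  qed
  moreover have "Ck_on k S q" using Suc.prems Ck_on_Suc_imp by auto
  ultimately show ?case using Suc pderiv_at_compose_real[OF d D]
    by (intro Ck_on_SucI[where f' = "\<lambda>i x. a * q x powr (a - 1) * pderiv_at i q x"] assms)
       (auto intro!: Ck_on_mult[OF assms(1)])
qed

lemma Ck_on_ln:
  fixes q :: "real^'n \<Rightarrow> real"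
  assumes "open S" and pos: "\<And>x. x \<in> S \<Longrightarrow> q x > 0" and "Ck_on k S q"
  shows "Ck_on k S (\<lambda>x. ln (q x))"
proof (cases k)
  case 0
  then show ?thesis using assms by (auto intro!: continuous_intros dest: pos)
next
  case (Suc l)
  then have d: "q differentiable (at x)" if "x \<in> S" for x
    using differentiable_on_eq_differentiable_at[OF assms(1)] that assms by auto
  have D: "(ln has_real_derivative q x powr (-1)) (at (q x))" if "x \<in> S" for x
    using pos[OF that] by (auto intro!: derivative_eq_intros simp: powr_minus inverse_eq_divide)
  have "(\<lambda>x. ln (q x)) differentiable_on S"
    unfolding differentiable_on_eq_differentiable_at[OF assms(1)]
  proof
    fix x assume "x \<in> S"
    then show "(\<lambda>x. ln (q x)) differentiable (at x)"
      using differentiable_chain_at[OF d, of x ln] D[of x, THEN has_field_derivative_imp_has_derivative, THEN differentiableI]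
      by (simp add: o_def)
  qed
  moreover have "Ck_on l S q" using assms Suc Ck_on_Suc_imp by auto
  ultimately show ?thesis unfolding Suc using assms Suc pderiv_at_compose_real[OF d D]
    by (intro Ck_on_SucI[where f' = "\<lambda>i x. q x powr (-1) * pderiv_at i q x"] assms)
       (auto simp del: powr_neg_one' intro!: Ck_on_mult[OF assms(1)] Ck_on_powr)
qed

lemma Ck_on_polynomial:
  assumes "open S" "real_polynomial_function p" shows "Ck_on k S p"
  using assms(2) by induction (auto intro: Ck_on_linear Ck_on_add Ck_on_mult assms(1))

lemma Ck_on_compose_matrix:
  fixes f :: "real^'n \<Rightarrow> real" and P :: "real^'n^'n"
  assumes "open S" "open T" and TS: "\<And>x. x \<in> T \<Longrightarrow> P *v x \<in> S"
  shows "Ck_on k S f \<Longrightarrow> Ck_on k T (\<lambda>x. f (P *v x))"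
proof (induction k arbitrary: f)
  case 0
  then show ?case using TS
    by (auto intro: continuous_on_compose2[of S f T] simp: linear_continuous_on matrix_vector_mul_bounded_linear)
next
  case (Suc k)
  then have d: "f differentiable (at (P *v x))" if "x \<in> T" for x
    using differentiable_on_eq_differentiable_at[OF assms(1)] that TS by auto
  have "(\<lambda>x. f (P *v x)) differentiable_on T"
    unfolding differentiable_on_eq_differentiable_at[OF assms(2)]
  proof
    fix x assume x: "x \<in> T"
    have "(\<lambda>x. P *v x) differentiable (at x)"
      by (rule bounded_linear_imp_differentiable) (rule matrix_vector_mul_bounded_linear)
    then show "(\<lambda>x. f (P *v x)) differentiable (at x)"
      using differentiable_chain_at[of "\<lambda>x. P *v x" x f] d[OF x] by (simp add: o_def)
  qed
  with Suc show ?case using pderiv_at_compose_matrix[OF d]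
    by (intro Ck_on_SucI[where f' = "\<lambda>i x. \<Sum>k\<in>UNIV. P $ k $ i * pderiv_at k f (P *v x)"] assms)
       (auto intro!: Ck_on_sum Ck_on_mult assms)
qed

lemma real_polynomial_function_nth [intro]: "real_polynomial_function (\<lambda>x::real^'n. x $ i)"
  by (rule real_polynomial_function.intros(1)) (rule bounded_linear_vec_nth)

lemma inner_self_sum: "x \<bullet> x = (\<Sum>i\<in>UNIV. x $ i * x $ i)" for x :: "real^'n"
  by (simp add: inner_vec_def)

lemma real_polynomial_function_inner_self [intro]:
  "real_polynomial_function (\<lambda>x::real^'n. x \<bullet> x)"
  unfolding inner_self_sum by (intro real_polynomial_function_sum) auto

lemma smooth_polynomial: "real_polynomial_function p \<Longrightarrow> smooth p"
  by (simp add: smooth_def Ck_on_polynomial)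

lemma norm_powr_eq: "norm x powr a = (x \<bullet> x) powr (a/2)" for x :: "real^'n"
  by (simp add: norm_eq_sqrt_inner powr_half_sqrt[symmetric] powr_powr)

lemma Ck_on_norm_powr: "Ck_on k (- {0}) (\<lambda>x::real^'n. norm x powr a)"
  unfolding norm_powr_eq by (intro Ck_on_powr Ck_on_polynomial) auto

lemma Ck_on_ln_norm: "Ck_on k (- {0}) (\<lambda>x::real^'n. ln (norm x))"
proof -
  have "Ck_on k (- {0}) (\<lambda>x::real^'n. (1/2) * ln (x \<bullet> x))"
    by (intro Ck_on_mult Ck_on_ln Ck_on_const Ck_on_polynomial) auto
  then show ?thesis
    by (rule Ck_on_cong[THEN iffD1, rotated -1]) (auto simp: norm_eq_sqrt_inner ln_sqrt)
qed

section \<open>Viscosity subharmonic functions and the comparison principle\<close>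

lemma Ck_on_2D:
  assumes "Ck_on 2 S f" "open S" "x \<in> S"
  shows "f differentiable (at x)" "pderiv_at i f differentiable (at x)"
  using assms by (auto simp: numeral_2_eq_2 differentiable_on_eq_differentiable_at)

text \<open>The mean value theorem is applied on the segment from \<open>x0\<close> to \<open>z\<close> to the difference of \<open>f\<close> and its
  expansion, whose derivative is small because the first partial derivatives are differentiable at \<open>x0\<close>.\<close>
lemma second_order_expansion:
  fixes f :: "real^'n \<Rightarrow> real"
  assumes "Ck_on 2 S f" "open S" "x0 \<in> S" "e > 0"
  shows "\<forall>\<^sub>F z in nhds x0. \<bar>f z - (f x0 + (\<chi> i. pderiv_at i f x0) \<bullet> (z - x0)
           + (1/2) * ((z - x0) \<bullet> (hessian f x0 *v (z - x0))))\<bar> \<le> e * (norm (z - x0))\<^sup>2"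
proof -
  define e' where "e' = e / real CARD('n)"
  have e': "e' > 0" using assms(4) by (simp add: e'_def)
  define g where "g = (\<lambda>i. pderiv_at i f)"
  have "\<forall>\<^sub>F z in nhds x0. \<bar>g i z - g i x0 - (\<Sum>j\<in>UNIV. (z - x0) $ j * pderiv_at j (g i) x0)\<bar> \<le> e' * norm (z - x0)" for i
    using has_derivative_pderiv_at[OF Ck_on_2D(2)[OF assms(1-3)], of i] e'
    unfolding has_derivative_at_alt g_def eventually_nhds_metric dist_norm by auto
  then have "\<forall>\<^sub>F z in nhds x0. \<forall>i\<in>UNIV. \<bar>g i z - g i x0 - (\<Sum>j\<in>UNIV. (z - x0) $ j * pderiv_at j (g i) x0)\<bar> \<le> e' * norm (z - x0)"
    by (intro eventually_ball_finite) auto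
  moreover have "\<forall>\<^sub>F z in nhds x0. z \<in> S" using assms(2,3) eventually_nhds by blast
  ultimately have "\<forall>\<^sub>F z in nhds x0. z \<in> S \<and> (\<forall>i. \<bar>g i z - g i x0 - (\<Sum>j\<in>UNIV. (z - x0) $ j * pderiv_at j (g i) x0)\<bar> \<le> e' * norm (z - x0))"
    by eventually_elim auto
  then obtain \<delta> where \<delta>: "\<delta> > 0" and
    near: "\<And>z. dist z x0 < \<delta> \<Longrightarrow> z \<in> S \<and> (\<forall>i. \<bar>g i z - g i x0 - (\<Sum>j\<in>UNIV. (z - x0) $ j * pderiv_at j (g i) x0)\<bar> \<le> e' * norm (z - x0))"
    unfolding eventually_nhds_metric by blast
  have "\<bar>f z - (f x0 + (\<chi> i. g i x0) \<bullet> (z - x0)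
           + (1/2) * ((z - x0) \<bullet> (hessian f x0 *v (z - x0))))\<bar> \<le> e * (norm (z - x0))\<^sup>2"
    if z: "dist z x0 < \<delta>" for z
  proof -
    define w where "w = z - x0"
    define Q where "Q = (\<lambda>i. \<Sum>j\<in>UNIV. w $ j * pderiv_at j (g i) x0)"
    define r where "r = (\<lambda>t. f (x0 + t *\<^sub>R w) - t * (\<Sum>i\<in>UNIV. w $ i * g i x0) - t\<^sup>2/2 * (\<Sum>i\<in>UNIV. w $ i * Q i))"
    define r' where "r' = (\<lambda>t. \<Sum>i\<in>UNIV. w $ i * (g i (x0 + t *\<^sub>R w) - g i x0 - t * Q i))"
    have close: "dist (x0 + t *\<^sub>R w) x0 < \<delta>" if "0 \<le> t" "t \<le> 1" for t
    proof -
      have "t * norm w \<le> 1 * norm w" using that by (intro mult_right_mono) auto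
      then show ?thesis using z that by (simp add: w_def dist_norm)
    qed
    have D: "(r has_real_derivative r' t) (at t)" if "0 \<le> t" "t \<le> 1" for t
    proof -
      have "x0 + t *\<^sub>R w \<in> S" using near close that by blast
      from has_real_derivative_along_line[OF Ck_on_2D(1)[OF assms(1,2) this]]
      have "((\<lambda>t. f (x0 + t *\<^sub>R w)) has_real_derivative (\<Sum>i\<in>UNIV. w $ i * g i (x0 + t *\<^sub>R w))) (at t)"
        by (simp add: g_def)
      then have "(r has_real_derivative (\<Sum>i\<in>UNIV. w $ i * g i (x0 + t *\<^sub>R w)) - (\<Sum>i\<in>UNIV. w $ i * g i x0)
          - t * (\<Sum>i\<in>UNIV. w $ i * Q i)) (at t)"
        unfolding r_def by (auto intro!: derivative_eq_intros)
      moreover have "(\<Sum>i\<in>UNIV. w $ i * g i (x0 + t *\<^sub>R w)) - (\<Sum>i\<in>UNIV. w $ i * g i x0)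
          - t * (\<Sum>i\<in>UNIV. w $ i * Q i) = r' t"
        by (simp add: r'_def sum_distrib_left sum_subtractf[symmetric] algebra_simps)
      ultimately show ?thesis by simp
    qed
    have bound: "\<bar>r' t\<bar> \<le> e * (norm w)\<^sup>2" if "0 \<le> t" "t \<le> 1" for t
    proof -
      have "\<bar>r' t\<bar> \<le> (\<Sum>i\<in>UNIV. \<bar>w $ i * (g i (x0 + t *\<^sub>R w) - g i x0 - t * Q i)\<bar>)"
        unfolding r'_def by (rule sum_abs)
      also have "\<dots> \<le> (\<Sum>i\<in>(UNIV::'n set). norm w * (e' * norm w))"
      proof (rule sum_mono)
        fix i
        have "\<bar>g i (x0 + t *\<^sub>R w) - g i x0 - (\<Sum>j\<in>UNIV. (x0 + t *\<^sub>R w - x0) $ j * pderiv_at j (g i) x0)\<bar>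
            \<le> e' * norm (x0 + t *\<^sub>R w - x0)"
          using near close[OF that] by blast
        moreover have "(\<Sum>j\<in>UNIV. (x0 + t *\<^sub>R w - x0) $ j * pderiv_at j (g i) x0) = t * Q i"
          by (simp add: Q_def sum_distrib_left mult.assoc)
        ultimately have "\<bar>g i (x0 + t *\<^sub>R w) - g i x0 - t * Q i\<bar> \<le> e' * (t * norm w)"
          using that by simp
        also have "\<dots> \<le> e' * (1 * norm w)"
          using that e' by (intro mult_left_mono mult_right_mono) auto
        finally have "\<bar>g i (x0 + t *\<^sub>R w) - g i x0 - t * Q i\<bar> \<le> e' * norm w" by simp
        then show "\<bar>w $ i * (g i (x0 + t *\<^sub>R w) - g i x0 - t * Q i)\<bar> \<le> norm w * (e' * norm w)"
          unfolding abs_mult by (intro mult_mono component_le_norm_cart) auto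
      qed
      also have "\<dots> = e * (norm w)\<^sup>2" by (simp add: e'_def power2_eq_square)
      finally show ?thesis .
    qed
    obtain \<xi> where \<xi>: "0 < \<xi>" "\<xi> < 1" "r 1 - r 0 = (1 - 0) * r' \<xi>"
      using MVT2[of 0 1 r r'] D by force
    have "w \<bullet> (hessian f x0 *v w) = (\<Sum>j\<in>UNIV. \<Sum>i\<in>UNIV. w $ j * (pderiv_at j (g i) x0 * w $ i))"
      by (simp add: inner_vec_def matrix_vector_mult_def hessian_def g_def sum_distrib_left)
    also have "\<dots> = (\<Sum>i\<in>UNIV. w $ i * Q i)"
      by (subst sum.swap) (simp add: Q_def sum_distrib_left mult_ac)
    finally have "r 1 - r 0 = f z - (f x0 + (\<chi> i. g i x0) \<bullet> w + (1/2) * (w \<bullet> (hessian f x0 *v w)))"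
      by (simp add: r_def w_def inner_vec_def mult.commute)
    then show ?thesis using \<xi> bound[of \<xi>] unfolding w_def by simp
  qed
  then show ?thesis unfolding eventually_nhds_metric g_def using \<delta> by blast
qed

text \<open>Subharmonicity in terms of second-order superjets instead of smooth test functions: it survives linear
  changes of variables and multiplication by powers of the norm without any need to extend test
  functions to the whole space.  The origin is left out, so this is a notion on the punctured space.\<close>
definition viscosity_subharmonic :: "(real^'n \<Rightarrow> real) \<Rightarrow> bool" where
  "viscosity_subharmonic v \<longleftrightarrow>
     (\<forall>x0 p A. x0 \<noteq> 0 \<longrightarrow>
        (\<forall>e>0. \<forall>\<^sub>F z in nhds x0. v z \<le> v x0 + p \<bullet> (z - x0)
            + (1/2) * ((z - x0) \<bullet> (A *v (z - x0))) + e * (norm (z - x0))\<^sup>2) \<longrightarrow>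
        trace A \<ge> 0)"

text \<open>A test function need only be twice continuously differentiable near the point, since only its
  second-order expansion matters.\<close>
lemma viscosity_subharmonic_touch:
  fixes v :: "real^'n \<Rightarrow> real"
  assumes "viscosity_subharmonic v" "x0 \<noteq> 0" "Ck_on 2 S \<psi>" "open S" "x0 \<in> S"
    and above: "\<forall>\<^sub>F z in nhds x0. v z - v x0 \<le> \<psi> z - \<psi> x0"
  shows "laplacian \<psi> x0 \<ge> 0"
proof -
  have "\<forall>\<^sub>F z in nhds x0. v z \<le> v x0 + (\<chi> i. pderiv_at i \<psi> x0) \<bullet> (z - x0)
            + (1/2) * ((z - x0) \<bullet> (hessian \<psi> x0 *v (z - x0))) + e * (norm (z - x0))\<^sup>2" if "e > 0" for e
    using second_order_expansion[OF assms(3-5) that] above by eventually_elim auto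
  then have "trace (hessian \<psi> x0) \<ge> 0"
    using assms(1,2) unfolding viscosity_subharmonic_def by blast
  then show ?thesis by (simp add: trace_def trace_hessian)
qed

lemma viscosity_subharmonic_const: "viscosity_subharmonic (\<lambda>x::real^'n. c)"
  unfolding viscosity_subharmonic_def
proof (intro allI impI)
  fix x0 p :: "real^'n" and A :: "real^'n^'n"
  assume *: "\<forall>e>0. \<forall>\<^sub>F z in nhds x0. c \<le> c + p \<bullet> (z - x0)
            + (1/2) * ((z - x0) \<bullet> (A *v (z - x0))) + e * (norm (z - x0))\<^sup>2"
  have "A $ i $ i \<ge> 0" for i
  proof (rule ccontr)
    assume neg: "\<not> A $ i $ i \<ge> 0"
    define e where "e = - A $ i $ i / 4"
    have "e > 0" using neg by (simp add: e_def)
    with * have ev: "\<forall>\<^sub>F z in nhds x0. c \<le> c + p \<bullet> (z - x0)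
            + (1/2) * ((z - x0) \<bullet> (A *v (z - x0))) + e * (norm (z - x0))\<^sup>2" by blast
    then obtain \<delta> where \<delta>: "\<delta> > 0" and near: "\<And>z. dist z x0 < \<delta> \<Longrightarrow> 0 \<le> p \<bullet> (z - x0)
            + (1/2) * ((z - x0) \<bullet> (A *v (z - x0))) + e * (norm (z - x0))\<^sup>2"
      unfolding eventually_nhds_metric using add_le_cancel_left[of c 0] by (metis (no_types, lifting) add.assoc add_0_right)
    define t where "t = \<delta> / 2"
    have t: "t > 0" "t < \<delta>" using \<delta> by (auto simp: t_def)
    have 1: "0 \<le> s * (p $ i) + (1/2) * (s\<^sup>2 * A $ i $ i) + e * s\<^sup>2" if "\<bar>s\<bar> = t" for s
    proof -
      have "dist (x0 + s *\<^sub>R axis i 1) x0 < \<delta>" using that t by (simp add: dist_norm)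
      from near[OF this] show ?thesis
        by (simp add: matrix_vector_mult_scaleR matrix_vector_mult_basis inner_axis inner_axis' column_def power2_eq_square algebra_simps)
    qed
    have "0 \<le> t\<^sup>2 * A $ i $ i + 2 * e * t\<^sup>2"
      using 1[of t] 1[of "-t"] t by (simp add: algebra_simps)
    also have "\<dots> = t\<^sup>2 * (A $ i $ i) / 2" by (simp add: e_def algebra_simps)
    also have "\<dots> < 0" using neg t by (simp add: mult_pos_neg)
    finally show False by simp
  qed
  then show "trace A \<ge> 0" by (simp add: trace_def sum_nonneg)
qed

lemma laplacian_cong_open:
  assumes "open S" "x \<in> S" "\<And>y. y \<in> S \<Longrightarrow> f y = g y"
  shows "laplacian f x = laplacian g x"
  unfolding laplacian_def
  by (intro sum.cong refl pderiv_at_cong_open[OF assms(1,2)] pderiv_at_cong_open[OF assms(1) _ assms(3)]) auto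

lemma laplacian_add:
  assumes "open S" "x \<in> S" "Ck_on 2 S f" "Ck_on 2 S g"
  shows "laplacian (\<lambda>y. f y + g y) x = laplacian f x + laplacian g x"
proof -
  have "pderiv_at i (pderiv_at i (\<lambda>y. f y + g y)) x = pderiv_at i (pderiv_at i f) x + pderiv_at i (pderiv_at i g) x" for i
    by (subst pderiv_at_cong_open[OF assms(1,2), of _ "\<lambda>y. pderiv_at i f y + pderiv_at i g y"])
       (use Ck_on_2D[OF _ assms(1)] assms in \<open>auto intro!: pderiv_at_add\<close>)
  then show ?thesis by (simp add: laplacian_def sum.distrib)
qed

lemma laplacian_mult:
  assumes "open S" "x \<in> S" "Ck_on 2 S f" "Ck_on 2 S g"
  shows "laplacian (\<lambda>y. f y * g y) x
    = f x * laplacian g x + 2 * (\<Sum>i\<in>UNIV. pderiv_at i f x * pderiv_at i g x) + g x * laplacian f x"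
proof -
  have "pderiv_at i (pderiv_at i (\<lambda>y. f y * g y)) x
    = f x * pderiv_at i (pderiv_at i g) x + 2 * (pderiv_at i f x * pderiv_at i g x) + g x * pderiv_at i (pderiv_at i f) x" for i
    by (subst pderiv_at_cong_open[OF assms(1,2), of _ "\<lambda>y. f y * pderiv_at i g y + pderiv_at i f y * g y"])
       (use Ck_on_2D[OF _ assms(1)] assms in \<open>auto simp: pderiv_at_add pderiv_at_mult\<close>)
  then show ?thesis by (simp add: laplacian_def sum.distrib sum_distrib_left)
qed

lemma laplacian_const [simp]: "laplacian (\<lambda>x. c) x = 0"
  by (simp add: laplacian_def)

lemma laplacian_cmult:
  assumes "open S" "x \<in> S" "Ck_on 2 S f"
  shows "laplacian (\<lambda>y. c * f y) x = c * laplacian f x"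
  using laplacian_mult[OF assms(1,2) Ck_on_const assms(3)] by simp

lemma laplacian_diff:
  assumes "open S" "x \<in> S" "Ck_on 2 S f" "Ck_on 2 S g"
  shows "laplacian (\<lambda>y. f y - g y) x = laplacian f x - laplacian g x"
  using laplacian_add[OF assms(1-3) Ck_on_mult[OF assms(1) Ck_on_const assms(4)], of "-1"]
    laplacian_cmult[OF assms(1,2,4), of "-1"] by simp

lemma pderiv_at_inner_self: "pderiv_at i (\<lambda>x. x \<bullet> x) x = 2 * x $ i"
proof -
  have "((\<lambda>x. x \<bullet> x) has_derivative (\<lambda>h. x \<bullet> h + h \<bullet> x)) (at x)"
    by (auto intro!: derivative_eq_intros)
  then show ?thesis using pderiv_at_eq by (fastforce simp: inner_axis inner_axis')
qed

lemma pderiv_at_norm_powr: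
  fixes x :: "real^'n"
  assumes "x \<noteq> 0"
  shows "pderiv_at i (\<lambda>x. norm x powr a) x = a * norm x powr (a - 2) * x $ i"
proof -
  have d: "(\<lambda>x::real^'n. x \<bullet> x) differentiable (at x)"
    by (rule Ck_on_2D(1)[of UNIV]) (auto intro: Ck_on_polynomial)
  have "((\<lambda>t. t powr (a/2)) has_real_derivative (a/2) * (x \<bullet> x) powr (a/2 - 1)) (at (x \<bullet> x))"
    using assms by (auto intro!: derivative_eq_intros)
  from pderiv_at_compose_real[OF d this, of i] show ?thesis
    unfolding norm_powr_eq pderiv_at_inner_self by (simp add: diff_divide_distrib)
qed

lemma norm_powr_mult_self: "norm x powr (a - 2) * (x \<bullet> x) = norm x powr a" for x :: "real^'n"
  by (cases "x = 0") (auto simp: powr_diff dot_square_norm)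

lemma laplacian_norm_powr:
  fixes x :: "real^'n"
  assumes "x \<noteq> 0"
  shows "laplacian (\<lambda>x. norm x powr a) x = a * (a + real CARD('n) - 2) * norm x powr (a - 2)"
proof -
  have o: "open (- {0::real^'n})" "x \<in> - {0}" using assms by auto
  have dn: "(\<lambda>x::real^'n. norm x powr b) differentiable (at x)" for b
    by (rule Ck_on_2D(1)[OF Ck_on_norm_powr o])
  have dx: "(\<lambda>x::real^'n. x $ i) differentiable (at x)" for i
    by (rule Ck_on_2D(1)[of UNIV]) (auto intro: Ck_on_polynomial)
  have "pderiv_at i (pderiv_at i (\<lambda>x. norm x powr a)) x
      = a * norm x powr (a - 2) + a * (a - 2) * (norm x powr (a - 4) * (x $ i * x $ i))" for i
    by (subst pderiv_at_cong_open[OF o, of _ "\<lambda>x. a * (norm x powr (a - 2) * x $ i)"])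
       (simp_all add: pderiv_at_norm_powr pderiv_at_cmult differentiable_mult dn dx pderiv_at_mult
          pderiv_at_nth assms algebra_simps)
  then have "laplacian (\<lambda>x. norm x powr a) x = real CARD('n) * (a * norm x powr (a - 2))
      + a * (a - 2) * (norm x powr (a - 2 - 2) * (x \<bullet> x))"
    by (simp add: laplacian_def sum.distrib inner_self_sum flip: sum_distrib_left)
  then show ?thesis unfolding norm_powr_mult_self by (simp add: algebra_simps)
qed

lemma laplacian_ln_norm:
  fixes x :: "real^'n"
  assumes "x \<noteq> 0"
  shows "laplacian (\<lambda>x. ln (norm x)) x = (real CARD('n) - 2) * norm x powr (- 2)"
proof -
  have o: "open (- {0::real^'n})" "x \<in> - {0}" using assms by auto
  have dn: "(\<lambda>x::real^'n. norm x powr b) differentiable (at y)" if "y \<noteq> 0" for b y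
    by (rule Ck_on_2D(1)[OF Ck_on_norm_powr]) (use that in auto)
  have dx: "(\<lambda>x::real^'n. x $ i) differentiable (at x)" for i
    by (rule Ck_on_2D(1)[of UNIV]) (auto intro: Ck_on_polynomial)
  have 1: "pderiv_at i (\<lambda>x. ln (norm x)) y = norm y powr (-2) * y $ i" if "y \<noteq> 0" for i and y :: "real^'n"
  proof -
    have *: "(ln has_real_derivative (1 / norm y powr 1)) (at (norm y powr 1))"
      using that by (auto intro!: derivative_eq_intros)
    have "pderiv_at i (\<lambda>x. ln (norm x)) y = 1 / norm y powr 1 * (1 * norm y powr (1 - 2) * y $ i)"
      unfolding pderiv_at_norm_powr[OF that, symmetric]
      using pderiv_at_compose_real[where f = "\<lambda>x. norm x powr 1", OF dn[OF that] *, of i] by simp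
    moreover have "1 / norm y powr 1 * norm y powr (1 - 2) = norm y powr (-2)"
      using powr_diff[of "norm y" "1 - 2" 1] by simp
    ultimately show ?thesis by (metis mult.assoc mult_1)
  qed
  have "pderiv_at i (pderiv_at i (\<lambda>x. ln (norm x))) x
      = norm x powr (- 2) - 2 * (norm x powr (- 2 - 2) * (x $ i * x $ i))" for i
    by (subst pderiv_at_cong_open[OF o, of _ "\<lambda>x. norm x powr (-2) * x $ i"])
       (simp_all add: 1 pderiv_at_norm_powr pderiv_at_cmult differentiable_mult dn dx pderiv_at_mult
          pderiv_at_nth assms algebra_simps)
  then have "laplacian (\<lambda>x. ln (norm x)) x = real CARD('n) * norm x powr (- 2)
      - 2 * (norm x powr (- 2 - 2) * (x \<bullet> x))"
    by (simp add: laplacian_def sum.distrib sum_subtractf inner_self_sum flip: sum_distrib_left)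
  then show ?thesis unfolding norm_powr_mult_self by (simp add: algebra_simps)
qed

text \<open>The combination in the last factor vanishes for suitable exponents when \<open>p\<close> satisfies Euler's identity
  for homogeneous functions; this is what makes the Kelvin transform work.\<close>
lemma laplacian_mult_norm_powr:
  fixes x :: "real^'n"
  assumes "x \<noteq> 0" "Ck_on 2 (- {0}) p"
  shows "laplacian (\<lambda>x. norm x powr a * p x) x = norm x powr a * laplacian p x
    + a * norm x powr (a - 2) * (2 * (\<Sum>i\<in>UNIV. x $ i * pderiv_at i p x) + (a + real CARD('n) - 2) * p x)"
proof -
  have o: "open (- {0::real^'n})" "x \<in> - {0}" using assms by auto
  show ?thesis
    unfolding laplacian_mult[OF o Ck_on_norm_powr assms(2)] laplacian_norm_powr[OF assms(1)] pderiv_at_norm_powr[OF assms(1)]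
    by (simp add: sum_distrib_left sum_distrib_right algebra_simps)
qed

lemma laplacian_inner_self: "laplacian (\<lambda>x. x \<bullet> x) x = 2 * real CARD('n)" for x :: "real^'n"
proof -
  have dx: "(\<lambda>x::real^'n. x $ i) differentiable (at x)" for i
    by (rule Ck_on_2D(1)[of UNIV]) (auto intro: Ck_on_polynomial)
  have "pderiv_at i (\<lambda>x::real^'n. x \<bullet> x) = (\<lambda>x. 2 * x $ i)" for i
    by (rule ext) (rule pderiv_at_inner_self)
  then show ?thesis by (simp add: laplacian_def pderiv_at_cmult dx pderiv_at_nth)
qed

text \<open>In dimension at least two \<open>- ln (norm x)\<close> is superharmonic, positive in the unit ball and infinite at the origin.
  Adding a small multiple of it to \<open>\<psi>\<close> keeps the maximum of \<open>v - \<psi>\<close> away from the origin, and a small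
  multiple of \<open>1 - x \<bullet> x\<close> makes the comparison function strictly superharmonic, so that it cannot touch
  \<open>v\<close> from above.  The constant function 0 is a possible \<open>v\<close>, which gives the classical maximum principle.\<close>
lemma punctured_ball_comparison:
  fixes v :: "real^'n \<Rightarrow> real"
  assumes n: "CARD('n) \<ge> 2"
    and v: "viscosity_subharmonic v" "continuous_on (- {0}) v"
    and bdd: "\<And>x. x \<noteq> 0 \<Longrightarrow> norm x \<le> 1 \<Longrightarrow> v x \<le> K"
    and \<psi>: "Ck_on 2 UNIV \<psi>" "\<And>x. norm x < 1 \<Longrightarrow> laplacian \<psi> x \<le> 0"
    and bdry: "\<And>x. norm x = 1 \<Longrightarrow> v x \<le> \<psi> x"
    and x1: "x1 \<noteq> 0" "norm x1 \<le> 1"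
  shows "v x1 \<le> \<psi> x1"
proof (rule ccontr)
  assume "\<not> v x1 \<le> \<psi> x1"
  define \<gamma> where "\<gamma> = v x1 - \<psi> x1"
  have \<gamma>: "\<gamma> > 0" using \<open>\<not> v x1 \<le> \<psi> x1\<close> by (simp add: \<gamma>_def)
  have cont\<psi>: "continuous_on UNIV \<psi>"
    using Ck_on_Suc_imp[of 0 UNIV \<psi>] Ck_on_Suc_imp[of 1 UNIV \<psi>] \<psi>(1) by (simp add: numeral_2_eq_2)
  have "bounded (\<psi> ` cball 0 1)"
    by (intro compact_imp_bounded compact_continuous_image continuous_on_subset[OF cont\<psi>]) auto
  then obtain L where L: "\<And>x. norm x \<le> 1 \<Longrightarrow> \<bar>\<psi> x\<bar> \<le> L"
    unfolding bounded_iff by (metis imageI mem_cball_0 real_norm_def)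
  define \<eta> where "\<eta> = \<gamma> / 3"
  have ln1: "ln (norm x1) \<le> 0" using x1 by simp
  \<comment> \<open>Both perturbations of \<open>\<psi>\<close> stay below a third of the gap \<open>\<gamma>\<close> at \<open>x1\<close>.\<close>
  define \<delta> where "\<delta> = \<gamma> / (3 * (1 - ln (norm x1)))"
  have \<delta>: "\<delta> > 0" unfolding \<delta>_def using \<gamma> ln1 by (intro divide_pos_pos) auto
  have \<delta>2: "\<delta> * (- ln (norm x1)) < \<gamma> / 3"
  proof -
    have "\<delta> * (- ln (norm x1)) < \<delta> * (1 - ln (norm x1))" using \<delta> by (intro mult_strict_left_mono) auto
    also have "\<dots> = \<gamma> / 3" using ln1 by (simp add: \<delta>_def divide_simps)
    finally show ?thesis .
  qed
  define \<theta> where "\<theta> = (\<lambda>x. \<psi> x - \<delta> * ln (norm x) + \<eta> * (1 - x \<bullet> x))"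
  have nn: "x \<bullet> x \<le> 1" if "norm x \<le> 1" for x :: "real^'n"
    using that by (simp add: dot_square_norm power_le_one)
  have gap: "v x1 - \<theta> x1 > 0"
  proof -
    have "\<eta> * (1 - x1 \<bullet> x1) \<le> \<eta> * 1" using \<gamma> by (intro mult_left_mono) (auto simp: \<eta>_def)
    moreover have "\<theta> x1 = \<psi> x1 + \<delta> * (- ln (norm x1)) + \<eta> * (1 - x1 \<bullet> x1)" by (simp add: \<theta>_def)
    moreover have "\<eta> * 1 = \<gamma> / 3" by (simp add: \<eta>_def)
    ultimately show ?thesis using \<delta>2 \<gamma> \<gamma>_def by linarith
  qed
  \<comment> \<open>Inside radius \<open>r\<close> the logarithm alone exceeds the bound for \<open>v\<close>.\<close>
  define r where "r = min (norm x1 / 2) (exp (- (\<bar>K\<bar> + L) / \<delta>))"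
  have r: "r > 0" "r < norm x1" 
  proof -
    show "r > 0" using x1 by (simp add: r_def)
    have "r \<le> norm x1 / 2" by (simp add: r_def)
    moreover have "norm x1 > 0" using x1 by simp
    ultimately show "r < norm x1" by linarith
  qed
  have inner: "v x \<le> \<theta> x" if "norm x = r" for x
  proof -
    have "norm x \<le> 1" "x \<noteq> 0" using that r x1 by auto
    have "ln r \<le> - (\<bar>K\<bar> + L) / \<delta>"
      using r(1) ln_mono[of r "exp (- (\<bar>K\<bar> + L) / \<delta>)"] by (simp add: r_def)
    then have "\<delta> * ln r \<le> - (\<bar>K\<bar> + L)" using \<delta> by (simp add: field_simps)
    moreover have "\<eta> * (1 - x \<bullet> x) \<ge> 0" using nn[OF \<open>norm x \<le> 1\<close>] \<gamma> by (simp add: \<eta>_def)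
    ultimately show ?thesis using L[OF \<open>norm x \<le> 1\<close>] bdd[OF \<open>x \<noteq> 0\<close> \<open>norm x \<le> 1\<close>] that
      by (simp add: \<theta>_def)
  qed
  define T where "T = cball 0 1 - ball (0::real^'n) r"
  have "compact T" unfolding T_def by (intro compact_diff) auto
  moreover have "x1 \<in> T" using x1 r by (auto simp: T_def)
  moreover have T0: "T \<subseteq> - {0}" using r by (auto simp: T_def)
  have "continuous_on T (\<lambda>x. v x - \<theta> x)" unfolding \<theta>_def
    by (intro continuous_intros continuous_on_subset[OF v(2) T0] continuous_on_subset[OF cont\<psi>]) (use T0 in auto)
  ultimately obtain x0 where x0: "x0 \<in> T" "\<And>z. z \<in> T \<Longrightarrow> v z - \<theta> z \<le> v x0 - \<theta> x0"
    using continuous_attains_sup[of T "\<lambda>x. v x - \<theta> x"] by blast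
  have pos: "v x0 - \<theta> x0 > 0" using x0(2)[OF \<open>x1 \<in> T\<close>] gap by simp
  have "norm x0 \<noteq> r" using inner pos by force
  moreover have "norm x0 \<noteq> 1" using bdry[of x0] pos by (auto simp: \<theta>_def dot_square_norm)
  ultimately have x0': "r < norm x0" "norm x0 < 1" using x0(1) by (auto simp: T_def)
  have "x0 \<noteq> 0" using r x0' by auto
  have "open (ball 0 1 - cball (0::real^'n) r)" by (intro open_Diff) auto
  then have "\<forall>\<^sub>F z in nhds x0. z \<in> ball 0 1 - cball 0 r" using x0' by (intro eventually_nhds_in_open) auto
  then have ev: "\<forall>\<^sub>F z in nhds x0. v z - v x0 \<le> \<theta> z - \<theta> x0"
  proof eventually_elim
    case (elim z)
    then have "z \<in> T" by (auto simp: T_def)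
    then show ?case using x0(2)[of z] by linarith
  qed
  have o: "open (- {0::real^'n})" "x0 \<in> - {0}" using \<open>x0 \<noteq> 0\<close> by auto
  have C1: "Ck_on 2 (- {0}) (\<lambda>x::real^'n. \<delta> * ln (norm x))" and C2: "Ck_on 2 (- {0}) \<psi>"
    and C3: "Ck_on 2 (- {0}) (\<lambda>x::real^'n. 1 - x \<bullet> x)"
    using Ck_on_subset[OF \<psi>(1)] by (auto intro!: Ck_on_mult Ck_on_ln_norm Ck_on_diff) (auto intro!: Ck_on_polynomial)
  have C4: "Ck_on 2 (- {0}) (\<lambda>x::real^'n. \<eta> * (1 - x \<bullet> x))" using C3 by (auto intro!: Ck_on_mult)
  have C5: "Ck_on 2 (- {0}) (\<lambda>x::real^'n. x \<bullet> x)" by (intro Ck_on_polynomial) auto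
  have "Ck_on 2 (- {0}) \<theta>" unfolding \<theta>_def by (intro Ck_on_add Ck_on_diff C1 C2 C4) auto
  from viscosity_subharmonic_touch[OF v(1) \<open>x0 \<noteq> 0\<close> this o ev] have "laplacian \<theta> x0 \<ge> 0" .
  moreover have "laplacian \<theta> x0 = laplacian \<psi> x0 - \<delta> * ((real CARD('n) - 2) * norm x0 powr (-2)) - \<eta> * (2 * real CARD('n))"
    unfolding \<theta>_def using o C1 C2 C3 C4 C5 \<open>x0 \<noteq> 0\<close>
    by (simp add: laplacian_add[of "- {0}"] laplacian_diff[of "- {0}"] laplacian_cmult[of "- {0}"] Ck_on_diff
      Ck_on_ln_norm laplacian_ln_norm laplacian_inner_self)
  moreover have "laplacian \<psi> x0 \<le> 0" using \<psi>(2) x0' by simp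
  moreover have "\<delta> * ((real CARD('n) - 2) * norm x0 powr (-2)) \<ge> 0" using \<delta> n by simp
  moreover have "\<eta> * (2 * real CARD('n)) > 0" using \<gamma> by (simp add: \<eta>_def)
  ultimately show False by linarith
qed

section \<open>Harmonic polynomials: prescribed values on the sphere and the gradient estimate\<close>

lemmas polynomial_intros =
  real_polynomial_function.intros(2-4) real_polynomial_function_power
  real_polynomial_function_diff real_polynomial_function_nth real_polynomial_function_inner_self

lemma real_polynomial_function_differentiable:
  fixes p :: "real^'n \<Rightarrow> real"
  shows "real_polynomial_function p \<Longrightarrow> p differentiable (at x)"
  using Ck_on_2D(1)[of UNIV p x] Ck_on_polynomial[of UNIV p 2] by auto

lemma real_polynomial_function_pderiv_at [intro]:
  fixes p :: "real^'n \<Rightarrow> real"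
  assumes "real_polynomial_function p"
  shows "real_polynomial_function (pderiv_at i p)"
  using assms
proof induction
  case (linear f)
  then have "pderiv_at i f = (\<lambda>x. f (axis i 1))" using pderiv_at_linear by blast
  then show ?case by auto
next
  case (add f g)
  then have "pderiv_at i (\<lambda>x. f x + g x) = (\<lambda>x. pderiv_at i f x + pderiv_at i g x)"
    by (auto intro!: pderiv_at_add real_polynomial_function_differentiable)
  then show ?case using add by auto
next
  case (mult f g)
  then have "pderiv_at i (\<lambda>x. f x * g x) = (\<lambda>x. f x * pderiv_at i g x + pderiv_at i f x * g x)"
    by (auto intro!: pderiv_at_mult real_polynomial_function_differentiable)
  then show ?case using mult by auto
qed auto

lemma real_polynomial_function_laplacian [intro]:
  fixes p :: "real^'n \<Rightarrow> real"
  assumes "real_polynomial_function p"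
  shows "real_polynomial_function (laplacian p)"
proof -
  have "laplacian p = (\<lambda>x. \<Sum>i\<in>UNIV. pderiv_at i (pderiv_at i p) x)"
    by (simp add: laplacian_def fun_eq_iff)
  then show ?thesis using assms by (auto intro!: real_polynomial_function_sum)
qed

lemma pderiv_at_commute_polynomial:
  fixes p :: "real^'n \<Rightarrow> real"
  assumes "real_polynomial_function p"
  shows "pderiv_at i (pderiv_at j p) x = pderiv_at j (pderiv_at i p) x"
  using assms
proof (induction arbitrary: x)
  case (linear f)
  then have "pderiv_at i f = (\<lambda>x. f (axis i 1))" for i using pderiv_at_linear by blast
  then show ?case by simp
next
  case (add f g)
  then have "pderiv_at i (\<lambda>x. f x + g x) = (\<lambda>x. pderiv_at i f x + pderiv_at i g x)" for i
    by (auto intro!: pderiv_at_add real_polynomial_function_differentiable)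
  then show ?case using add by (simp add: pderiv_at_add real_polynomial_function_differentiable real_polynomial_function_pderiv_at)
next
  case (mult f g)
  then have "pderiv_at i (\<lambda>x. f x * g x) = (\<lambda>x. f x * pderiv_at i g x + pderiv_at i f x * g x)" for i
    by (auto intro!: pderiv_at_mult real_polynomial_function_differentiable)
  then show ?case using mult by (simp add: pderiv_at_add pderiv_at_mult real_polynomial_function_differentiable real_polynomial_function_pderiv_at
     differentiable_mult)
qed auto

definition harmonic_polynomial :: "(real^'n \<Rightarrow> real) \<Rightarrow> bool" where
  "harmonic_polynomial h \<longleftrightarrow> real_polynomial_function h \<and> (\<forall>x. laplacian h x = 0)"

lemma laplacian_add_polynomial:
  "real_polynomial_function f \<Longrightarrow> real_polynomial_function g \<Longrightarrow>
    laplacian (\<lambda>x. f x + g x) x = laplacian f x + laplacian g x"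
  by (rule laplacian_add[of UNIV]) (auto intro: Ck_on_polynomial)

lemma laplacian_mult_polynomial:
  "real_polynomial_function f \<Longrightarrow> real_polynomial_function g \<Longrightarrow>
    laplacian (\<lambda>y. f y * g y) x
    = f x * laplacian g x + 2 * (\<Sum>i\<in>UNIV. pderiv_at i f x * pderiv_at i g x) + g x * laplacian f x"
  by (rule laplacian_mult[of UNIV]) (auto intro: Ck_on_polynomial)

lemma laplacian_cmult_polynomial:
  "real_polynomial_function f \<Longrightarrow> laplacian (\<lambda>x. c * f x) x = c * laplacian f x"
  by (rule laplacian_cmult[of UNIV]) (auto intro: Ck_on_polynomial)

lemma harmonic_polynomial_add:
  "harmonic_polynomial f \<Longrightarrow> harmonic_polynomial g \<Longrightarrow> harmonic_polynomial (\<lambda>x. f x + g x)"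
  by (auto simp: harmonic_polynomial_def laplacian_add_polynomial)

lemma harmonic_polynomial_cmult:
  "harmonic_polynomial f \<Longrightarrow> harmonic_polynomial (\<lambda>x. c * f x)"
  by (auto simp: harmonic_polynomial_def laplacian_cmult_polynomial)

lemma harmonic_polynomial_diff:
  "harmonic_polynomial f \<Longrightarrow> harmonic_polynomial g \<Longrightarrow> harmonic_polynomial (\<lambda>x. f x - g x)"
  using harmonic_polynomial_add[of f "\<lambda>x. - 1 * g x"] harmonic_polynomial_cmult[of g "-1"] by simp

text \<open>The Laplacian has constant coefficients, so it commutes with partial derivatives.\<close>
lemma harmonic_polynomial_pderiv_at:
  fixes h :: "real^'n \<Rightarrow> real"
  assumes "harmonic_polynomial h"
  shows "harmonic_polynomial (pderiv_at i h)"
proof -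
  have h: "real_polynomial_function h" "laplacian h = (\<lambda>x. 0)"
    using assms by (auto simp: harmonic_polynomial_def)
  have "laplacian (pderiv_at i h) x = pderiv_at i (laplacian h) x" for x
  proof -
    have "pderiv_at i (laplacian h) x = pderiv_at i (\<lambda>y. \<Sum>j\<in>UNIV. pderiv_at j (pderiv_at j h) y) x"
      by (simp add: laplacian_def[abs_def])
    also have "\<dots> = (\<Sum>j\<in>UNIV. pderiv_at i (pderiv_at j (pderiv_at j h)) x)"
      by (rule pderiv_at_sum) (auto intro!: real_polynomial_function_differentiable real_polynomial_function_pderiv_at h)
    also have "\<dots> = (\<Sum>j\<in>UNIV. pderiv_at j (pderiv_at i (pderiv_at j h)) x)"
      by (intro sum.cong refl pderiv_at_commute_polynomial) (auto intro: h)
    also have "\<dots> = (\<Sum>j\<in>UNIV. pderiv_at j (pderiv_at j (pderiv_at i h)) x)"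
      using pderiv_at_commute_polynomial[OF h(1), of i] by (metis (no_types, lifting) ext)
    finally show ?thesis by (simp add: laplacian_def)
  qed
  then show ?thesis using h by (auto simp: harmonic_polynomial_def)
qed

definition homogeneous_polynomial :: "nat \<Rightarrow> (real^'n \<Rightarrow> real) \<Rightarrow> bool" where
  "homogeneous_polynomial k p \<longleftrightarrow> real_polynomial_function p \<and> (\<forall>t x. p (t *\<^sub>R x) = t ^ k * p x)"

lemma pderiv_at_scale:
  fixes p :: "real^'n \<Rightarrow> real"
  assumes "p differentiable (at (c *\<^sub>R x))"
  shows "pderiv_at i (\<lambda>y. p (c *\<^sub>R y)) x = c * pderiv_at i p (c *\<^sub>R x)"
proof -
  have *: "(mat c :: real^'n^'n) *v y = c *\<^sub>R y" for y
    by (simp add: vec_eq_iff matrix_vector_mult_def mat_def if_distrib[of "\<lambda>t. t * _"] cong: if_cong)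
  show ?thesis using pderiv_at_compose_matrix[of p "mat c" x i] assms unfolding *
    by (simp add: mat_def if_distrib[of "\<lambda>t. t * _"] cong: if_cong)
qed

text \<open>Differentiating \<open>p (t x) = t ^ Suc k * p x\<close> gives the identity multiplied by \<open>t\<close>; the value \<open>t = 0\<close> follows by
  continuity.\<close>
lemma homogeneous_polynomial_pderiv_at:
  fixes p :: "real^'n \<Rightarrow> real"
  assumes "homogeneous_polynomial (Suc k) p"
  shows "homogeneous_polynomial k (pderiv_at i p)"
proof -
  have p: "real_polynomial_function p" "\<And>t x. p (t *\<^sub>R x) = t ^ Suc k * p x"
    using assms by (auto simp: homogeneous_polynomial_def)
  have eq: "t * pderiv_at i p (t *\<^sub>R x) = t * (t ^ k * pderiv_at i p x)" for t x
    using pderiv_at_scale[OF real_polynomial_function_differentiable[OF p(1)], of i t x]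
    unfolding p(2) by (auto simp add: pderiv_at_cmult real_polynomial_function_differentiable p(1))
  have nonzero: "pderiv_at i p (t *\<^sub>R x) = t ^ k * pderiv_at i p x" if "t \<noteq> 0" for t x
    using mult_left_cancel[OF that] eq[of t x] by blast
  have "pderiv_at i p (0 *\<^sub>R x) = 0 ^ k * pderiv_at i p x" for x
  proof -
    define f where "f = (\<lambda>t. pderiv_at i p (t *\<^sub>R x) - t ^ k * pderiv_at i p x)"
    have "continuous_on UNIV (pderiv_at i p)"
      using Ck_on_polynomial[OF open_UNIV real_polynomial_function_pderiv_at[OF p(1)], of 0] by simp
    then have "continuous_on UNIV f" unfolding f_def
      by (intro continuous_intros continuous_on_compose2[of UNIV "pderiv_at i p" UNIV "\<lambda>t. t *\<^sub>R x"]) auto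
    then have "(f \<longlongrightarrow> f 0) (at 0)" by (simp add: continuous_on_def)
    moreover have "(f \<longlongrightarrow> 0) (at 0)"
      by (rule tendsto_eventually) (use nonzero in \<open>simp add: eventually_at_filter f_def\<close>)
    ultimately have "f 0 = 0" using tendsto_unique[OF trivial_limit_at] by blast
    then show ?thesis by (simp add: f_def)
  qed
  with nonzero show ?thesis unfolding homogeneous_polynomial_def
    using p(1) by (metis real_polynomial_function_pderiv_at)
qed

lemma homogeneous_polynomial_0_const:
  "homogeneous_polynomial 0 p \<Longrightarrow> p = (\<lambda>x. p 0)"
  unfolding homogeneous_polynomial_def by (metis mult_1 power_0 scale_zero_left)

lemma homogeneous_polynomial_laplacian:
  fixes p :: "real^'n \<Rightarrow> real"
  shows "homogeneous_polynomial (Suc (Suc k)) p \<Longrightarrow> homogeneous_polynomial k (laplacian p)"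
proof -
  assume p: "homogeneous_polynomial (Suc (Suc k)) p"
  then have "pderiv_at i (pderiv_at i p) (t *\<^sub>R x) = t ^ k * pderiv_at i (pderiv_at i p) x" for i t x
    using homogeneous_polynomial_pderiv_at[OF homogeneous_polynomial_pderiv_at[OF p, of i], of i]
    by (simp add: homogeneous_polynomial_def)
  then show ?thesis using p
    by (auto simp: homogeneous_polynomial_def laplacian_def sum_distrib_left)
qed

lemma laplacian_homogeneous_polynomial_small:
  fixes p :: "real^'n \<Rightarrow> real"
  assumes "homogeneous_polynomial k p" "k < 2"
  shows "laplacian p = (\<lambda>x. 0)"
proof (cases k)
  case 0
  then have "laplacian p = laplacian (\<lambda>x. p 0)" using assms homogeneous_polynomial_0_const by metis
  then show ?thesis by (simp add: fun_eq_iff)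
next
  case (Suc l)
  then have "homogeneous_polynomial 0 (pderiv_at i p)" for i
    using assms homogeneous_polynomial_pderiv_at[of 0 p] by simp
  then have "pderiv_at i p = (\<lambda>x. pderiv_at i p 0)" for i using homogeneous_polynomial_0_const by blast
  then have "pderiv_at i (pderiv_at i p) = (\<lambda>x. 0)" for i using pderiv_at_const by metis
  then show ?thesis by (simp add: laplacian_def fun_eq_iff)
qed

lemma euler_homogeneous:
  fixes p :: "real^'n \<Rightarrow> real"
  assumes "homogeneous_polynomial k p"
  shows "(\<Sum>i\<in>UNIV. x $ i * pderiv_at i p x) = real k * p x"
proof -
  have p: "real_polynomial_function p" "\<And>t x. p (t *\<^sub>R x) = t ^ k * p x"
    using assms by (auto simp: homogeneous_polynomial_def)
  have "((\<lambda>t. p (t *\<^sub>R x)) has_real_derivative (\<Sum>i\<in>UNIV. x $ i * pderiv_at i p x)) (at 1)"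
    using has_real_derivative_along_line[of p 0 1 x] real_polynomial_function_differentiable[OF p(1)] by simp
  moreover have "((\<lambda>t. p (t *\<^sub>R x)) has_real_derivative real k * p x) (at 1)"
    unfolding p(2) by (auto intro!: derivative_eq_intros)
  ultimately show ?thesis by (rule DERIV_unique)
qed

lemma pderiv_at_inner_self_power:
  "pderiv_at i (\<lambda>x::real^'n. (x \<bullet> x) ^ Suc j) x = 2 * real (Suc j) * (x \<bullet> x) ^ j * x $ i"
proof -
  have "((\<lambda>t. t ^ Suc j) has_real_derivative real (Suc j) * (x \<bullet> x) ^ j) (at (x \<bullet> x))"
    using DERIV_pow[of "Suc j" "x \<bullet> x"] by simp
  from pderiv_at_compose_real[OF real_polynomial_function_differentiable[OF real_polynomial_function_inner_self] this, of i]
  show ?thesis by (simp add: pderiv_at_inner_self)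
qed

lemma laplacian_inner_self_power:
  "laplacian (\<lambda>x::real^'n. (x \<bullet> x) ^ Suc j) x = 2 * real (Suc j) * (real CARD('n) + 2 * real j) * (x \<bullet> x) ^ j"
proof -
  have d: "(\<lambda>x::real^'n. (x \<bullet> x) ^ j) differentiable (at x)" "(\<lambda>x::real^'n. x $ i) differentiable (at x)" for i j
    by (auto intro!: real_polynomial_function_differentiable real_polynomial_function_power)
  have 1: "pderiv_at i (\<lambda>x::real^'n. (x \<bullet> x) ^ Suc j) = (\<lambda>x. 2 * real (Suc j) * ((x \<bullet> x) ^ j * x $ i))" for i
    by (rule ext) (simp only: pderiv_at_inner_self_power mult.assoc)
  have 2: "pderiv_at i (pderiv_at i (\<lambda>x::real^'n. (x \<bullet> x) ^ Suc j)) x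
    = 2 * real (Suc j) * ((x \<bullet> x) ^ j + pderiv_at i (\<lambda>x. (x \<bullet> x) ^ j) x * x $ i)" for i
    unfolding 1 by (simp only: pderiv_at_cmult differentiable_mult d pderiv_at_mult pderiv_at_nth) simp
  have 3: "(\<Sum>i\<in>UNIV. pderiv_at i (\<lambda>x. (x \<bullet> x) ^ j) x * x $ i) = 2 * real j * (x \<bullet> x) ^ j"
  proof (cases j)
    case (Suc l)
    show ?thesis unfolding Suc pderiv_at_inner_self_power
      by (simp add: inner_self_sum[of x] flip: sum_distrib_left sum_distrib_right mult.assoc)
        (simp add: mult.assoc flip: sum_distrib_left sum_distrib_right)
  qed simp
  show ?thesis unfolding laplacian_def 2 
    by (simp only: sum_distrib_left[symmetric] sum.distrib 3) (simp add: algebra_simps)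
qed

lemma laplacian_inner_self_power_mult:
  fixes q :: "real^'n \<Rightarrow> real"
  assumes "homogeneous_polynomial l q" "\<And>x. laplacian q x = 0"
  shows "laplacian (\<lambda>x. (x \<bullet> x) ^ Suc j * q x) x
    = 2 * real (Suc j) * (real CARD('n) + 2 * real j + 2 * real l) * ((x \<bullet> x) ^ j * q x)"
proof -
  have q: "real_polynomial_function q" using assms by (simp add: homogeneous_polynomial_def)
  have "(\<Sum>i\<in>UNIV. pderiv_at i (\<lambda>x. (x \<bullet> x) ^ Suc j) x * pderiv_at i q x)
      = 2 * real (Suc j) * (x \<bullet> x) ^ j * (real l * q x)"
    unfolding pderiv_at_inner_self_power euler_homogeneous[OF assms(1), symmetric]
    by (simp add: sum_distrib_left mult.assoc)
  then show ?thesis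
    by (subst laplacian_mult_polynomial)
      (use q in \<open>auto simp: assms(2) laplacian_inner_self_power algebra_simps simp del: power_Suc\<close>)
qed

lemma laplacian_funpow_linear:
  fixes f g :: "real^'n \<Rightarrow> real"
  assumes "real_polynomial_function f" "real_polynomial_function g"
  shows "(laplacian ^^ m) (\<lambda>x. f x + c * g x) = (\<lambda>x. (laplacian ^^ m) f x + c * (laplacian ^^ m) g x)"
    and "real_polynomial_function ((laplacian ^^ m) f)"
proof -
  have poly: "real_polynomial_function ((laplacian ^^ m) f)" if "real_polynomial_function f"
    for f :: "real^'n \<Rightarrow> real" and m using that by (induction m) auto
  show "real_polynomial_function ((laplacian ^^ m) f)" by (rule poly[OF assms(1)])
  show "(laplacian ^^ m) (\<lambda>x. f x + c * g x) = (\<lambda>x. (laplacian ^^ m) f x + c * (laplacian ^^ m) g x)"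
  proof (induction m)
    case (Suc m)
    have "real_polynomial_function (\<lambda>x. c * (laplacian ^^ m) g x)" using poly[OF assms(2)] by auto
    then show ?case using poly[OF assms(1), of m] poly[OF assms(2), of m]
      by (simp add: Suc fun_eq_iff laplacian_add_polynomial laplacian_cmult_polynomial)
  qed simp
qed

text \<open>The constant is positive because each Laplacian lowers the power of \<open>x \<bullet> x\<close> by one and contributes a positive
  factor.\<close>
lemma laplacian_funpow_inner_self_power_mult:
  fixes q :: "real^'n \<Rightarrow> real"
  assumes "homogeneous_polynomial l q" "\<And>x. laplacian q x = 0"
  shows "\<exists>C>0. (laplacian ^^ m) (\<lambda>x. (x \<bullet> x) ^ m * q x) = (\<lambda>x. C * q x)"
proof (induction m)
  case 0
  then show ?case by (auto intro!: exI[of _ 1])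
next
  case (Suc m)
  then obtain C where C: "C > 0" "(laplacian ^^ m) (\<lambda>x. (x \<bullet> x) ^ m * q x) = (\<lambda>x. C * q x)" by blast
  have q: "real_polynomial_function q" using assms by (simp add: homogeneous_polynomial_def)
  have zero: "(laplacian ^^ m) (\<lambda>x::real^'n. 0) = (\<lambda>x. 0)" for m by (induction m) (auto intro: ext)
  define D where "D = 2 * real (Suc m) * (real CARD('n) + 2 * real m + 2 * real l)"
  have "D > 0" by (simp add: D_def add_pos_nonneg)
  have "(laplacian ^^ Suc m) (\<lambda>x. (x \<bullet> x) ^ Suc m * q x) = (laplacian ^^ m) (laplacian (\<lambda>x. (x \<bullet> x) ^ Suc m * q x))"
    by (simp only: funpow_Suc_right o_apply)
  also have "laplacian (\<lambda>x. (x \<bullet> x) ^ Suc m * q x) = (\<lambda>x. D * ((x \<bullet> x) ^ m * q x))"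
    unfolding D_def by (rule ext) (rule laplacian_inner_self_power_mult[OF assms])
  also have "(laplacian ^^ m) \<dots> = (\<lambda>x. D * (C * q x))"
    using laplacian_funpow_linear(1)[of "\<lambda>x. 0" "\<lambda>x. (x \<bullet> x) ^ m * q x" m D] C(2) zero[of m]
      real_polynomial_function.intros(4)[OF real_polynomial_function_power[OF real_polynomial_function_inner_self] q]
    by (simp add: fun_eq_iff real_polynomial_function.intros(2))
  finally show ?case using \<open>D > 0\<close> C(1) by (intro exI[of _ "D * C"]) (simp add: mult.assoc)
qed

lemma homogeneous_polynomial_laplacian_funpow:
  fixes p :: "real^'n \<Rightarrow> real"
  assumes "homogeneous_polynomial k p"
  shows "homogeneous_polynomial (k - 2 * m) ((laplacian ^^ m) p)"
    and "k < 2 * m \<Longrightarrow> (laplacian ^^ m) p = (\<lambda>x. 0)"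
proof -
  have step: "homogeneous_polynomial (k - 2) (laplacian p)" if "homogeneous_polynomial k p"
    for k and p :: "real^'n \<Rightarrow> real"
  proof (cases "k < 2")
    case True
    then show ?thesis using laplacian_homogeneous_polynomial_small[OF that]
      by (auto simp: homogeneous_polynomial_def)
  next
    case False
    then have "Suc (Suc (k - 2)) = k" by simp
    then show ?thesis using homogeneous_polynomial_laplacian[of "k - 2" p] that by simp
  qed
  have it: "homogeneous_polynomial (k - 2 * m) ((laplacian ^^ m) p)" for m
  proof (induction m)
    case (Suc m)
    then show ?case using step[OF Suc] by (simp add: algebra_simps diff_diff_left)
  qed (use assms in simp)
  then show "homogeneous_polynomial (k - 2 * m) ((laplacian ^^ m) p)" .
  assume "k < 2 * m"
  then obtain l where l: "m = Suc l" "k - 2 * l < 2" by (cases m) auto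
  then have "laplacian ((laplacian ^^ l) p) = (\<lambda>x. 0)"
    using laplacian_homogeneous_polynomial_small[OF it] by blast
  then show "(laplacian ^^ m) p = (\<lambda>x. 0)" using l by simp
qed

text \<open>Almansi's decomposition.  If \<open>p\<close> is annihilated by \<open>m + 1\<close> Laplacians, then \<open>q\<close>, the \<open>m\<close>-fold Laplacian of \<open>p\<close>,
  is harmonic, and for a suitable constant \<open>C\<close> the polynomial \<open>p - (x \<bullet> x) ^ m * q / C\<close> is annihilated by \<open>m\<close>
  Laplacians.  On the sphere \<open>(x \<bullet> x) ^ m * q\<close> equals the harmonic polynomial \<open>q\<close>.  The induction starts
  because a polynomial is annihilated by sufficiently many Laplacians.\<close>
lemma homogeneous_polynomial_harmonic_extension:
  fixes p :: "real^'n \<Rightarrow> real"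
  assumes "homogeneous_polynomial k p"
  shows "\<exists>h. harmonic_polynomial h \<and> (\<forall>x. norm x = 1 \<longrightarrow> h x = p x)"
proof -
  have "\<exists>h. harmonic_polynomial h \<and> (\<forall>x. norm x = 1 \<longrightarrow> h x = p x)"
    if "homogeneous_polynomial k p" "(laplacian ^^ m) p = (\<lambda>x. 0)" for m and p :: "real^'n \<Rightarrow> real"
    using that
  proof (induction m arbitrary: p)
    case 0
    then have "p = (\<lambda>x. 0)" by simp
    then show ?case by (intro exI[of _ "\<lambda>x. 0"]) (auto simp: harmonic_polynomial_def)
  next
    case (Suc m)
    show ?case
    proof (cases "k < 2 * m")
      case True
      then show ?thesis using Suc homogeneous_polynomial_laplacian_funpow(2) by blast
    next
      case False
      define q where "q = (laplacian ^^ m) p"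
      have p: "real_polynomial_function p" "\<And>t x. p (t *\<^sub>R x) = t ^ k * p x"
        using Suc by (auto simp: homogeneous_polynomial_def)
      have q0: "laplacian q x = 0" for x using Suc.prems(2) by (simp add: q_def fun_eq_iff)
      have l: "homogeneous_polynomial (k - 2 * m) q"
        using homogeneous_polynomial_laplacian_funpow(1)[OF Suc.prems(1)] q_def by blast
      then have q: "real_polynomial_function q" "\<And>t x. q (t *\<^sub>R x) = t ^ (k - 2 * m) * q x"
        by (auto simp: homogeneous_polynomial_def)
      obtain C where C: "C > 0" "(laplacian ^^ m) (\<lambda>x. (x \<bullet> x) ^ m * q x) = (\<lambda>x. C * q x)"
        using laplacian_funpow_inner_self_power_mult[OF l q0] by blast
      have r: "real_polynomial_function (\<lambda>x. (x \<bullet> x) ^ m * q x)" by (intro polynomial_intros q(1))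
      define p' where "p' = (\<lambda>x. p x + (-1/C) * ((x \<bullet> x) ^ m * q x))"
      have 1: "(laplacian ^^ m) p' = (\<lambda>x. 0)"
        unfolding p'_def laplacian_funpow_linear[OF p(1) r] C(2) using C(1) by (simp add: q_def)
      have "t ^ k = t ^ (2 * m) * t ^ (k - 2 * m)" for t :: real
        using False by (simp flip: power_add)
      then have "((t *\<^sub>R x) \<bullet> (t *\<^sub>R x)) ^ m * q (t *\<^sub>R x) = t ^ k * ((x \<bullet> x) ^ m * q x)" for t x
        by (simp add: q(2) power_mult power_mult_distrib power2_eq_square)
      then have "p' (t *\<^sub>R x) = t ^ k * p' x" for t x
        by (simp only: p'_def p(2)) (simp add: algebra_simps)
      moreover have "real_polynomial_function p'" unfolding p'_def by (intro polynomial_intros p(1) q(1))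
      ultimately have "homogeneous_polynomial k p'" by (simp add: homogeneous_polynomial_def)
      then obtain h where h: "harmonic_polynomial h" "\<And>x. norm x = 1 \<Longrightarrow> h x = p' x"
        using Suc.IH[OF _ 1] by blast
      have "harmonic_polynomial (\<lambda>x. h x + (1/C) * q x)"
        using h(1) q q0 by (intro harmonic_polynomial_add harmonic_polynomial_cmult) (auto simp: harmonic_polynomial_def)
      moreover have "h x + (1/C) * q x = p x" if "norm x = 1" for x
        using h(2)[OF that] that by (simp add: p'_def dot_square_norm)
      ultimately show ?thesis by blast
    qed
  qed
  moreover have "(laplacian ^^ Suc k) p = (\<lambda>x. 0)"
    by (rule homogeneous_polynomial_laplacian_funpow(2)[OF assms]) simp
  ultimately show ?thesis using assms by blast
qed

text \<open>An inductive description of the decomposition into homogeneous parts; it suits closure under products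
  better than an indexed sum.\<close>
inductive sum_of_homogeneous :: "(real^'n \<Rightarrow> real) \<Rightarrow> bool" where
  homogeneous: "homogeneous_polynomial k p \<Longrightarrow> sum_of_homogeneous p"
| add: "sum_of_homogeneous p \<Longrightarrow> sum_of_homogeneous q \<Longrightarrow> sum_of_homogeneous (\<lambda>x. p x + q x)"

lemma sum_of_homogeneous_mult:
  assumes "sum_of_homogeneous p" "sum_of_homogeneous q"
  shows "sum_of_homogeneous (\<lambda>x. p x * q x)"
  using assms(1)
proof induction
  case (homogeneous k p)
  show ?case using assms(2)
  proof induction
    case (homogeneous l q)
    with \<open>homogeneous_polynomial k p\<close> have "homogeneous_polynomial (k + l) (\<lambda>x. p x * q x)"
      by (auto simp: homogeneous_polynomial_def power_add)
    then show ?case by (rule sum_of_homogeneous.homogeneous)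
  next
    case (add q r)
    from sum_of_homogeneous.add[OF add.IH] show ?case by (simp add: algebra_simps)
  qed
next
  case (add p r)
  from sum_of_homogeneous.add[OF add.IH] show ?case by (simp add: algebra_simps)
qed

lemma real_polynomial_imp_sum_of_homogeneous:
  fixes p :: "real^'n \<Rightarrow> real"
  shows "real_polynomial_function p \<Longrightarrow> sum_of_homogeneous p"
proof (induction rule: real_polynomial_function.induct)
  case (linear f)
  then have "homogeneous_polynomial 1 f"
    by (auto simp: homogeneous_polynomial_def linear_cmul bounded_linear.linear)
  then show ?case by (rule sum_of_homogeneous.homogeneous)
next
  case (const c)
  have "homogeneous_polynomial 0 (\<lambda>x::real^'n. c)" by (auto simp: homogeneous_polynomial_def)
  then show ?case by (rule sum_of_homogeneous.homogeneous)
qed (auto intro: sum_of_homogeneous.add sum_of_homogeneous_mult)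

text \<open>The Dirichlet problem for the unit ball with polynomial boundary values.\<close>
lemma polynomial_harmonic_extension:
  fixes p :: "real^'n \<Rightarrow> real"
  assumes "real_polynomial_function p"
  shows "\<exists>h. harmonic_polynomial h \<and> (\<forall>x. norm x = 1 \<longrightarrow> h x = p x)"
  using real_polynomial_imp_sum_of_homogeneous[OF assms]
proof induction
  case (homogeneous k p)
  then show ?case by (rule homogeneous_polynomial_harmonic_extension)
next
  case (add p q)
  then show ?case using harmonic_polynomial_add by metis
qed

text \<open>Carries estimates obtained in a punctured ball over to the centre.\<close>
lemma polynomial_bound_at_0:
  fixes w :: "real^'n \<Rightarrow> real"
  assumes "real_polynomial_function w" "r > 0"
    and "\<And>y. y \<noteq> 0 \<Longrightarrow> norm y \<le> r \<Longrightarrow> \<bar>w y\<bar> \<le> B"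
  shows "\<bar>w 0\<bar> \<le> B"
proof -
  have "continuous_on UNIV w" using Ck_on_polynomial[OF open_UNIV assms(1), of 0] by simp
  then have "((\<lambda>y. \<bar>w y\<bar>) \<longlongrightarrow> \<bar>w 0\<bar>) (at 0)"
    by (intro tendsto_rabs) (simp add: continuous_on_def)
  moreover have "\<forall>\<^sub>F y in at 0. \<bar>w y\<bar> \<le> B"
    unfolding eventually_at by (rule exI[of _ r]) (auto intro!: assms)
  ultimately show ?thesis using tendsto_upperbound[OF _ _ trivial_limit_at] by blast
qed

lemma harmonic_polynomial_max_principle:
  fixes h :: "real^'n \<Rightarrow> real"
  assumes n: "CARD('n) \<ge> 2" and h: "harmonic_polynomial h"
    and M: "\<And>x. norm x = 1 \<Longrightarrow> \<bar>h x\<bar> \<le> M" and x: "norm x \<le> 1"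
  shows "\<bar>h x\<bar> \<le> M"
proof -
  have *: "0 \<le> M - s * h y" if "s = 1 \<or> s = -1" "y \<noteq> 0" "norm y \<le> 1" for s y
  proof (rule punctured_ball_comparison[of "\<lambda>_. 0" 0 "\<lambda>y. M - s * h y" y, OF n viscosity_subharmonic_const])
    have p: "real_polynomial_function h" "real_polynomial_function (\<lambda>y. s * h y)"
      using h by (auto simp: harmonic_polynomial_def)
    show "Ck_on 2 UNIV (\<lambda>y. M - s * h y)" by (intro Ck_on_diff Ck_on_const Ck_on_polynomial p) auto
    show "laplacian (\<lambda>y. M - s * h y) z \<le> 0" if "norm z < 1" for z
      using h p by (subst laplacian_diff[of UNIV]) (auto intro!: Ck_on_polynomial simp: harmonic_polynomial_def laplacian_cmult_polynomial)
    show "0 \<le> M - s * h z" if "norm z = 1" for z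
      using M[OF that] \<open>s = 1 \<or> s = -1\<close> by auto
  qed (use that in auto)
  then have fin: "\<bar>h y\<bar> \<le> M" if "y \<noteq> 0" "norm y \<le> 1" for y
    using *[of 1 y] *[of "-1" y] that by auto
  show ?thesis
  proof (cases "x = 0")
    case True
    then show ?thesis using polynomial_bound_at_0[of h 1 M] fin h by (simp add: harmonic_polynomial_def)
  qed (use fin x in blast)
qed

text \<open>The constant in the gradient estimate below: twice the square root of the weight \<open>c\<close> in its proof.\<close>
definition gradient_constant :: "'n itself \<Rightarrow> real" where
  "gradient_constant _ = 2 * sqrt (2 * real CARD('n) + 16)"

text \<open>Bernstein's argument.  With \<open>w\<close> the partial derivative and the cutoff \<open>\<eta> x = 1 - x \<bullet> x\<close>, the polynomial
  \<open>G = (\<eta> w)\<^sup>2 + c h\<^sup>2\<close> is subharmonic once \<open>c\<close> is large: the negative terms in the Laplacian of \<open>(\<eta> w)\<^sup>2\<close> are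
  multiples of \<open>w\<^sup>2\<close>, and the Laplacian of \<open>h\<^sup>2\<close> dominates \<open>2 w\<^sup>2\<close>.  On the sphere \<open>G\<close> is at most \<open>c M\<^sup>2\<close> since \<open>\<eta>\<close>
  vanishes there, hence also inside, where \<open>\<eta> \<ge> 1/2\<close> on the smaller ball.\<close>
lemma harmonic_polynomial_gradient_bound:
  fixes h :: "real^'n \<Rightarrow> real"
  assumes n: "CARD('n) \<ge> 2" and h: "harmonic_polynomial h"
    and M: "\<And>x. norm x = 1 \<Longrightarrow> \<bar>h x\<bar> \<le> M" and x: "norm x \<le> 1/2"
  shows "\<bar>pderiv_at i h x\<bar> \<le> gradient_constant TYPE('n) * M"
proof -
  define c where "c = 2 * real CARD('n) + 16"
  define w where "w = pderiv_at i h"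
  define \<eta> where "\<eta> = (\<lambda>x::real^'n. 1 - x \<bullet> x)"
  define G where "G = (\<lambda>x. (\<eta> x * w x) * (\<eta> x * w x) + c * (h x * h x))"
  have hp: "real_polynomial_function h" and wp: "real_polynomial_function w" 
    and lh: "\<And>x. laplacian h x = 0" and lw: "\<And>x. laplacian w x = 0"
    using h harmonic_polynomial_pderiv_at[OF h] by (auto simp: harmonic_polynomial_def w_def)
  have \<eta>p: "real_polynomial_function \<eta>" unfolding \<eta>_def by auto
  have pe: "pderiv_at j \<eta> x = - 2 * x $ j" for j x unfolding \<eta>_def
    by (subst pderiv_at_diff) (auto intro: real_polynomial_function_differentiable simp: pderiv_at_inner_self)
  have le: "laplacian \<eta> x = - (2 * real CARD('n))" for x unfolding \<eta>_def
    by (subst laplacian_diff[of UNIV]) (auto intro!: Ck_on_polynomial simp: laplacian_inner_self)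
  have sub: "laplacian G x \<ge> 0" if "norm x < 1" for x
  proof -
    define W where "W = (\<lambda>j. pderiv_at j w x)"
    define H where "H = (\<lambda>j. pderiv_at j h x)"
    have \<eta>1: "0 \<le> \<eta> x" "\<eta> x \<le> 1" using that by (auto simp: \<eta>_def dot_square_norm power_le_one)
    define f where "f = (\<lambda>x. \<eta> x * w x)"
    have fp: "real_polynomial_function f" using \<eta>p wp by (auto simp: f_def)
    have pf: "pderiv_at j f x = \<eta> x * W j - 2 * x $ j * w x" for j
      unfolding f_def by (subst pderiv_at_mult) (auto simp: \<eta>p wp real_polynomial_function_differentiable pe W_def)
    have lf: "laplacian f x = 2 * (\<Sum>j\<in>UNIV. (- 2 * x $ j) * W j) - 2 * real CARD('n) * w x"
      unfolding f_def laplacian_mult_polynomial[OF \<eta>p wp] by (simp add: pe le lw W_def)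
    have "laplacian G x = 2 * (f x * laplacian f x + (\<Sum>j\<in>UNIV. (pderiv_at j f x)\<^sup>2)) + 2 * c * (\<Sum>j\<in>UNIV. (H j)\<^sup>2)"
    proof -
      have "laplacian (\<lambda>x. f x * f x) x = 2 * (f x * laplacian f x + (\<Sum>j\<in>UNIV. (pderiv_at j f x)\<^sup>2))"
        by (simp add: laplacian_mult_polynomial fp power2_eq_square)
      moreover have "laplacian (\<lambda>x. c * (h x * h x)) x = 2 * c * (\<Sum>j\<in>UNIV. (H j)\<^sup>2)"
        using hp by (simp add: laplacian_cmult_polynomial laplacian_mult_polynomial real_polynomial_function.intros(4) lh power2_eq_square H_def)
      ultimately show ?thesis unfolding G_def f_def[symmetric]
        using fp hp by (subst laplacian_add_polynomial) (auto simp: f_def)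
    qed
    moreover have "(\<Sum>j\<in>UNIV. (H j)\<^sup>2) \<ge> (w x)\<^sup>2"
      using member_le_sum[of i UNIV "\<lambda>j. (H j)\<^sup>2"] by (simp add: H_def w_def)
    moreover have "f x * laplacian f x + (\<Sum>j\<in>UNIV. (pderiv_at j f x)\<^sup>2) \<ge> - c * (w x)\<^sup>2"
    proof -
      have "f x * laplacian f x + (\<Sum>j\<in>UNIV. (pderiv_at j f x)\<^sup>2)
        = (\<Sum>j\<in>UNIV. (\<eta> x * W j - 2 * x $ j * w x)\<^sup>2 - 4 * (\<eta> x * W j) * (x $ j * w x)) - 2 * real CARD('n) * \<eta> x * (w x)\<^sup>2"
        unfolding pf lf
        by (simp add: f_def sum_subtractf sum.distrib sum_distrib_left power2_eq_square algebra_simps sum_negf)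
      also have "\<dots> \<ge> (\<Sum>j\<in>UNIV. - 12 * (x $ j * x $ j) * (w x)\<^sup>2) - 2 * real CARD('n) * (w x)\<^sup>2"
      proof (rule diff_mono)
        show "(\<Sum>j\<in>UNIV. - 12 * (x $ j * x $ j) * (w x)\<^sup>2) \<le> (\<Sum>j\<in>UNIV. (\<eta> x * W j - 2 * x $ j * w x)\<^sup>2 - 4 * (\<eta> x * W j) * (x $ j * w x))"
        proof (rule sum_mono)
          fix j
          \<comment> \<open>Completing the square absorbs the mixed term at the price of \<open>12 (x $ j)\<^sup>2 (w x)\<^sup>2\<close>.\<close>
          have "0 \<le> (\<eta> x * W j - 4 * (x $ j * w x))\<^sup>2" by simp
          then show "- 12 * (x $ j * x $ j) * (w x)\<^sup>2 \<le> (\<eta> x * W j - 2 * x $ j * w x)\<^sup>2 - 4 * (\<eta> x * W j) * (x $ j * w x)"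
            by (simp add: power2_eq_square algebra_simps)
        qed
        show "2 * real CARD('n) * \<eta> x * (w x)\<^sup>2 \<le> 2 * real CARD('n) * (w x)\<^sup>2"
          using \<eta>1 by (simp add: mult_left_le_one_le mult_right_le_one_le mult_right_mono)
      qed
      also have "(\<Sum>j\<in>UNIV. - 12 * (x $ j * x $ j) * (w x)\<^sup>2) = - 12 * (x \<bullet> x) * (w x)\<^sup>2"
        by (simp add: inner_self_sum sum_distrib_left sum_distrib_right sum_negf)
      finally have "f x * laplacian f x + (\<Sum>j\<in>UNIV. (pderiv_at j f x)\<^sup>2)
         \<ge> - 12 * (x \<bullet> x) * (w x)\<^sup>2 - 2 * real CARD('n) * (w x)\<^sup>2" .
      moreover have "12 * (x \<bullet> x) * (w x)\<^sup>2 \<le> 16 * (w x)\<^sup>2"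
        using \<eta>1 by (intro mult_right_mono) (auto simp: \<eta>_def)
      ultimately show ?thesis by (simp add: c_def algebra_simps)
    qed
    moreover have "c \<ge> 0" by (simp add: c_def)
    ultimately show ?thesis using mult_left_mono[of "(w x)\<^sup>2" "\<Sum>j\<in>UNIV. (H j)\<^sup>2" "2 * c"] by simp
  qed
  have Gp: "real_polynomial_function G" unfolding G_def by (intro polynomial_intros \<eta>p wp hp)
  have "0 \<le> M" using M[of "axis i 1"] by (simp add: norm_axis_1)
  have Gle: "0 \<le> c * M\<^sup>2 - G y" if "y \<noteq> 0" "norm y \<le> 1" for y
  proof (rule punctured_ball_comparison[of "\<lambda>_. 0" 0 "\<lambda>y. c * M\<^sup>2 - G y" y, OF n viscosity_subharmonic_const])
    show "Ck_on 2 UNIV (\<lambda>y. c * M\<^sup>2 - G y)" using Gp by (intro Ck_on_polynomial) auto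
    show "laplacian (\<lambda>y. c * M\<^sup>2 - G y) x \<le> 0" if "norm x < 1" for x
      using sub[OF that] Gp by (subst laplacian_diff[of UNIV]) (auto intro!: Ck_on_polynomial)
    show "0 \<le> c * M\<^sup>2 - G x" if "norm x = 1" for x
    proof -
      have "(h x)\<^sup>2 \<le> M\<^sup>2" using M[OF that] \<open>0 \<le> M\<close> by (metis abs_of_nonneg abs_le_square_iff)
      then have "c * (h x)\<^sup>2 \<le> c * M\<^sup>2" by (intro mult_left_mono) (auto simp: c_def)
      then show ?thesis using that by (simp add: G_def \<eta>_def dot_square_norm power2_eq_square)
    qed
  qed (use that in auto)
  have fin: "\<bar>w y\<bar> \<le> 2 * sqrt c * M" if "y \<noteq> 0" "norm y \<le> 1/2" for y
  proof -
    have "(norm y)\<^sup>2 \<le> (1/2)\<^sup>2" using that by (intro power_mono) auto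
    then have "\<eta> y \<ge> 1/2" by (simp add: \<eta>_def dot_square_norm power2_eq_square)
    then have "\<bar>1/2 * w y\<bar> \<le> \<bar>\<eta> y * w y\<bar>" unfolding abs_mult by (intro mult_right_mono) auto
    then have "(1/2 * w y)\<^sup>2 \<le> (\<eta> y * w y)\<^sup>2" by (simp only: abs_le_square_iff)
    also have "\<dots> \<le> G y" by (simp add: G_def c_def power2_eq_square)
    also have "\<dots> \<le> c * M\<^sup>2" using Gle[of y] that by simp
    also have "\<dots> = (sqrt c * M)\<^sup>2" by (simp add: power_mult_distrib c_def)
    finally have "\<bar>1/2 * w y\<bar> \<le> \<bar>sqrt c * M\<bar>" by (simp only: abs_le_square_iff)
    then show ?thesis using \<open>0 \<le> M\<close> by (simp add: abs_mult c_def)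
  qed
  have "\<bar>w x\<bar> \<le> 2 * sqrt c * M"
  proof (cases "x = 0")
    case True
    then show ?thesis using polynomial_bound_at_0[OF wp, of "1/2"] fin by simp
  qed (use fin x in blast)
  then show ?thesis by (simp add: w_def c_def gradient_constant_def)
qed

section \<open>Taylor expansions of harmonic polynomials\<close>

lemma real_polynomial_function_scale:
  fixes h :: "real^'n \<Rightarrow> real"
  assumes "real_polynomial_function h"
  shows "real_polynomial_function (\<lambda>x. h (r *\<^sub>R x))"
proof -
  have "polynomial_function (\<lambda>x::real^'n. r *\<^sub>R x)"
    by (rule polynomial_function_bounded_linear) (rule bounded_linear_scaleR_right)
  then show ?thesis using real_polynomial_function_compose[OF _ assms] by (simp add: o_def)
qed

lemma harmonic_polynomial_scale:
  fixes h :: "real^'n \<Rightarrow> real"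
  assumes "harmonic_polynomial h"
  shows "harmonic_polynomial (\<lambda>x. h (r *\<^sub>R x))"
proof -
  have h: "real_polynomial_function h" "\<And>x. laplacian h x = 0" using assms by (auto simp: harmonic_polynomial_def)
  have d: "p differentiable (at x)" if "real_polynomial_function p" for p and x :: "real^'n"
    using that by (rule real_polynomial_function_differentiable)
  have 1: "pderiv_at i (\<lambda>x. h (r *\<^sub>R x)) = (\<lambda>x. r * pderiv_at i h (r *\<^sub>R x))" for i
    by (rule ext) (rule pderiv_at_scale[OF d[OF h(1)]])
  have "laplacian (\<lambda>x. h (r *\<^sub>R x)) x = r * r * laplacian h (r *\<^sub>R x)" for x
    unfolding laplacian_def 1
    by (simp add: pderiv_at_cmult pderiv_at_scale d h real_polynomial_function_scale real_polynomial_function_pderiv_at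
      sum_distrib_left mult.assoc)
  then show ?thesis using h by (auto simp: harmonic_polynomial_def real_polynomial_function_scale)
qed

lemma harmonic_polynomial_gradient_bound_scaled:
  fixes h :: "real^'n \<Rightarrow> real"
  assumes n: "CARD('n) \<ge> 2" and h: "harmonic_polynomial h" and "r > 0"
    and M: "\<And>x. norm x = r \<Longrightarrow> \<bar>h x\<bar> \<le> M" and x: "norm x \<le> r / 2"
  shows "\<bar>pderiv_at i h x\<bar> \<le> gradient_constant TYPE('n) * M / r"
proof -
  have "\<bar>pderiv_at i (\<lambda>x. h (r *\<^sub>R x)) ((1/r) *\<^sub>R x)\<bar> \<le> gradient_constant TYPE('n) * M"
    using \<open>r > 0\<close> M x
    by (intro harmonic_polynomial_gradient_bound[OF n harmonic_polynomial_scale[OF h]]) auto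
  moreover have "pderiv_at i (\<lambda>x. h (r *\<^sub>R x)) ((1/r) *\<^sub>R x) = r * pderiv_at i h (r *\<^sub>R ((1/r) *\<^sub>R x))"
    using h by (intro pderiv_at_scale real_polynomial_function_differentiable) (auto simp: harmonic_polynomial_def)
  ultimately show ?thesis using \<open>r > 0\<close> by (simp add: abs_mult field_simps)
qed

definition iterated_pderiv :: "'n list \<Rightarrow> (real^'n \<Rightarrow> real) \<Rightarrow> real^'n \<Rightarrow> real" where
  "iterated_pderiv l f = foldr pderiv_at l f"

lemma iterated_pderiv_simps [simp]:
  "iterated_pderiv [] f = f"
  "iterated_pderiv (i # l) f = pderiv_at i (iterated_pderiv l f)"
  by (auto simp: iterated_pderiv_def)

lemma harmonic_polynomial_iterated_pderiv:
  "harmonic_polynomial h \<Longrightarrow> harmonic_polynomial (iterated_pderiv l h)"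
  by (induction l) (auto intro: harmonic_polynomial_pderiv_at)

lemma iterated_pderiv_diff:
  assumes "harmonic_polynomial f" "harmonic_polynomial g"
  shows "iterated_pderiv l (\<lambda>x. f x - g x) = (\<lambda>x. iterated_pderiv l f x - iterated_pderiv l g x)"
proof (induction l)
  case (Cons i l)
  have "iterated_pderiv l f differentiable (at x)" "iterated_pderiv l g differentiable (at x)" for x
    using harmonic_polynomial_iterated_pderiv assms real_polynomial_function_differentiable
    unfolding harmonic_polynomial_def by blast+
  then show ?case by (simp add: Cons pderiv_at_diff fun_eq_iff)
qed simp

text \<open>Iterates the gradient estimate, halving the radius for each derivative.  What matters is that \<open>C\<close> does not
  depend on \<open>h\<close>, in particular not on its degree.\<close>
lemma harmonic_polynomial_iterated_pderiv_bound:
  assumes n: "CARD('n) \<ge> 2"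
  shows "\<exists>C\<ge>0. \<forall>(h::real^'n \<Rightarrow> real) M l x. harmonic_polynomial h \<longrightarrow> (\<forall>x. norm x = 1 \<longrightarrow> \<bar>h x\<bar> \<le> M) \<longrightarrow>
     length l = j \<longrightarrow> norm x \<le> (1/2) ^ j \<longrightarrow> \<bar>iterated_pderiv l h x\<bar> \<le> C * M"
proof (induction j)
  case 0
  then show ?case using harmonic_polynomial_max_principle[OF n] by (intro exI[of _ 1]) auto
next
  case (Suc j)
  then obtain C where C: "C \<ge> 0" and IH: "\<And>(h::real^'n \<Rightarrow> real) M l x. harmonic_polynomial h \<Longrightarrow> (\<And>x. norm x = 1 \<Longrightarrow> \<bar>h x\<bar> \<le> M) \<Longrightarrow>
     length l = j \<Longrightarrow> norm x \<le> (1/2) ^ j \<Longrightarrow> \<bar>iterated_pderiv l h x\<bar> \<le> C * M" by blast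
  define C' where "C' = gradient_constant TYPE('n) * C / (1/2) ^ j"
  have "C' \<ge> 0" using C by (auto simp: C'_def gradient_constant_def)
  moreover have "\<bar>iterated_pderiv l h x\<bar> \<le> C' * M"
    if prems: "harmonic_polynomial h" "\<And>x. norm x = 1 \<Longrightarrow> \<bar>h x\<bar> \<le> M" "length l = Suc j" "norm x \<le> (1/2) ^ Suc j"
    for h :: "real^'n \<Rightarrow> real" and M l x
  proof -
    obtain i l' where l: "l = i # l'" "length l' = j" using prems(3) by (metis length_Suc_conv)
    have "\<bar>pderiv_at i (iterated_pderiv l' h) x\<bar> \<le> gradient_constant TYPE('n) * (C * M) / (1/2) ^ j"
      using prems(4) l(2) 
      by (intro harmonic_polynomial_gradient_bound_scaled[OF n harmonic_polynomial_iterated_pderiv] prems(1) IH prems(2)) auto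
    then show ?thesis by (simp add: l C'_def)
  qed
  ultimately show ?case by blast
qed

definition monomial_of :: "'n list \<Rightarrow> real^'n \<Rightarrow> real" where
  "monomial_of l x = prod_list (map (\<lambda>i. x $ i) l)"

lemma finite_lists_of_length: "finite {l::'n::finite list. length l = j}"
  using finite_lists_length_eq[of "UNIV::'n set" j] by simp

lemma sum_lists_of_length_Suc:
  fixes F :: "'n::finite list \<Rightarrow> real"
  shows "(\<Sum>l | length l = Suc j. F l) = (\<Sum>l | length l = j. \<Sum>i\<in>UNIV. F (i # l))"
proof -
  have "(\<Sum>l | length l = j. \<Sum>i\<in>UNIV. F (i # l)) = (\<Sum>(l,i)\<in>{l. length l = j} \<times> UNIV. F (i # l))"
    by (simp add: sum.cartesian_product)
  also have "\<dots> = (\<Sum>l | length l = Suc j. F l)"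
    by (rule sum.reindex_bij_witness[of _ "\<lambda>l. (tl l, hd l)" "\<lambda>(l,i). i # l"]) (auto simp: length_Suc_conv)
  finally show ?thesis by simp
qed

lemma homogeneous_polynomial_monomial_of: "homogeneous_polynomial (length l) (monomial_of l)"
  unfolding homogeneous_polynomial_def
proof
  show "real_polynomial_function (monomial_of l)" unfolding monomial_of_def
    by (induction l) (auto intro!: polynomial_intros)
  show "\<forall>t x. monomial_of l (t *\<^sub>R x) = t ^ length l * monomial_of l x" unfolding monomial_of_def
    by (induction l) auto
qed

lemma abs_monomial_of_le: "norm x = 1 \<Longrightarrow> \<bar>monomial_of l x\<bar> \<le> 1"
proof (induction l)
  case (Cons i l)
  have "\<bar>x $ i\<bar> \<le> 1" using component_le_norm_cart[of x i] Cons by simp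
  then show ?case using Cons by (simp add: monomial_of_def abs_mult mult_le_one)
qed (simp add: monomial_of_def)

text \<open>The \<open>j\<close>-th derivative of \<open>t \<mapsto> h (t e)\<close>, written as a sum over lists of directions.  This form shows
  that at \<open>t = 0\<close> it is a homogeneous polynomial of degree \<open>j\<close> in \<open>e\<close>, with coefficients that the
  derivative estimates control.\<close>
definition taylor_term :: "(real^'n \<Rightarrow> real) \<Rightarrow> real^'n \<Rightarrow> nat \<Rightarrow> real \<Rightarrow> real" where
  "taylor_term h e j t = (\<Sum>l | length l = j. monomial_of l e * iterated_pderiv l h (t *\<^sub>R e))"

lemma taylor_term_0: "taylor_term h e 0 t = h (t *\<^sub>R e)"
proof -
  have "{l::'n list. length l = 0} = {[]}" by auto
  then show ?thesis by (simp add: taylor_term_def monomial_of_def)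
qed

lemma taylor_term_deriv:
  fixes h :: "real^'n \<Rightarrow> real"
  assumes "harmonic_polynomial h"
  shows "(taylor_term h e j has_real_derivative taylor_term h e (Suc j) t) (at t)"
proof -
  have 1: "((\<lambda>t. iterated_pderiv l h (t *\<^sub>R e)) has_real_derivative (\<Sum>i\<in>UNIV. e $ i * iterated_pderiv (i # l) h (t *\<^sub>R e))) (at t)"
    for l
  proof -
    have "real_polynomial_function (iterated_pderiv l h)"
      using harmonic_polynomial_iterated_pderiv[OF assms] by (auto simp: harmonic_polynomial_def)
    from has_real_derivative_along_line[of "iterated_pderiv l h" 0 t e] real_polynomial_function_differentiable[OF this]
    show ?thesis by simp
  qed
  have "(taylor_term h e j has_real_derivative
      (\<Sum>l | length l = j. monomial_of l e * (\<Sum>i\<in>UNIV. e $ i * iterated_pderiv (i # l) h (t *\<^sub>R e)))) (at t)"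
    unfolding taylor_term_def[abs_def] by (intro DERIV_sum DERIV_cmult 1)
  then show ?thesis unfolding taylor_term_def sum_lists_of_length_Suc
    by (simp add: sum_distrib_left monomial_of_def mult_ac)
qed

lemma harmonic_polynomial_taylor_bound:
  assumes n: "CARD('n) \<ge> 2" and m: "m > 0"
  shows "\<exists>C\<ge>0. \<forall>(h::real^'n \<Rightarrow> real) M e t. harmonic_polynomial h \<longrightarrow> (\<forall>x. norm x = 1 \<longrightarrow> \<bar>h x\<bar> \<le> M) \<longrightarrow>
     norm e = 1 \<longrightarrow> 0 < t \<longrightarrow> t \<le> (1/2) ^ m \<longrightarrow>
     \<bar>h (t *\<^sub>R e) - (\<Sum>j<m. taylor_term h e j 0 / fact j * t ^ j)\<bar> \<le> C * M * t ^ m"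
proof -
  obtain C where C: "C \<ge> 0" and bound: "\<And>(h::real^'n \<Rightarrow> real) M l x. harmonic_polynomial h \<Longrightarrow> (\<And>x. norm x = 1 \<Longrightarrow> \<bar>h x\<bar> \<le> M) \<Longrightarrow>
     length l = m \<Longrightarrow> norm x \<le> (1/2) ^ m \<Longrightarrow> \<bar>iterated_pderiv l h x\<bar> \<le> C * M"
    using harmonic_polynomial_iterated_pderiv_bound[OF n, of m] by blast
  define N where "N = real (card {l::'n list. length l = m})"
  have "\<bar>h (t *\<^sub>R e) - (\<Sum>j<m. taylor_term h e j 0 / fact j * t ^ j)\<bar> \<le> N * C * M * t ^ m"
    if h: "harmonic_polynomial h" and M: "\<And>x. norm x = 1 \<Longrightarrow> \<bar>h x\<bar> \<le> M"
      and e: "norm e = 1" and t: "0 < t" "t \<le> (1/2) ^ m"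
    for h :: "real^'n \<Rightarrow> real" and M e t
  proof -
    obtain s where s: "0 < s" "s < t"
      "h (t *\<^sub>R e) = (\<Sum>j<m. taylor_term h e j 0 / fact j * t ^ j) + taylor_term h e m s / fact m * t ^ m"
      using Maclaurin[OF t(1) m, of "taylor_term h e" "\<lambda>t. h (t *\<^sub>R e)"] taylor_term_deriv[OF h]
      by (auto simp: taylor_term_0 fun_eq_iff)
    have "0 \<le> M" using M[OF e] by linarith
    have "\<bar>taylor_term h e m s\<bar> \<le> (\<Sum>l | length l = m. \<bar>monomial_of l e * iterated_pderiv l h (s *\<^sub>R e)\<bar>)"
      unfolding taylor_term_def by (rule sum_abs)
    also have "\<dots> \<le> (\<Sum>l::'n list | length l = m. 1 * (C * M))"
      unfolding abs_mult using e s t M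
      by (intro sum_mono mult_mono abs_monomial_of_le bound[OF h]) auto
    also have "\<dots> = N * C * M" by (simp add: N_def)
    finally have T: "\<bar>taylor_term h e m s\<bar> \<le> N * C * M" .
    have "\<bar>taylor_term h e m s / fact m * t ^ m\<bar> = \<bar>taylor_term h e m s\<bar> / fact m * t ^ m"
      using t by (simp add: abs_mult)
    also have "\<dots> \<le> N * C * M / 1 * t ^ m"
      using T t \<open>0 \<le> M\<close> C by (intro mult_right_mono frac_le) (auto simp: N_def fact_ge_1)
    finally show ?thesis using s(3) by simp
  qed
  moreover have "N * C \<ge> 0" using C by (simp add: N_def)
  ultimately show ?thesis by blast
qed

text \<open>Otherwise divide by the power of \<open>t\<close> with the least exponent whose coefficient is nonzero, and let \<open>t\<close> tend to 0.\<close>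
lemma powr_combination_small_imp_zero:
  fixes c :: "real \<Rightarrow> real"
  assumes "finite E" "\<And>a. a \<in> E \<Longrightarrow> a < m" "t0 > 0"
    and small: "\<And>t. 0 < t \<Longrightarrow> t \<le> t0 \<Longrightarrow> \<bar>\<Sum>a\<in>E. c a * t powr a\<bar> \<le> B * t powr m"
    and "a \<in> E"
  shows "c a = 0"
proof (rule ccontr)
  assume "c a \<noteq> 0"
  define E' where "E' = {a \<in> E. c a \<noteq> 0}"
  define b where "b = Min E'"
  have E': "finite E'" "a \<in> E'" using assms(1,5) \<open>c a \<noteq> 0\<close> by (auto simp: E'_def)
  then have b: "b \<in> E'" "\<And>a. a \<in> E' \<Longrightarrow> b \<le> a" by (auto simp: b_def intro: Min_in)
  have lim0: "((\<lambda>t::real. t powr s) \<longlongrightarrow> 0) (at_right 0)" if "s > 0" for s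
    using tendsto_powr'[of "\<lambda>t::real. t" 0 "at_right 0" "\<lambda>_. s" s] that by (auto simp: eventually_at_right_less less_imp_le eventually_mono[OF eventually_at_right_less])
  have lim: "((\<lambda>t. \<Sum>a\<in>E. c a * t powr (a - b)) \<longlongrightarrow> (\<Sum>a\<in>E. if a = b then c b else 0)) (at_right 0)"
  proof (rule tendsto_sum)
    fix a assume a: "a \<in> E"
    consider "c a = 0" "a \<noteq> b" | "a = b" | "a > b" using b a by (force simp: E'_def)
    then show "((\<lambda>t. c a * t powr (a - b)) \<longlongrightarrow> (if a = b then c b else 0)) (at_right 0)"
    proof cases
      case 2
      have "\<forall>\<^sub>F t in at_right 0. c a * t powr (a - b) = c b"
        using eventually_at_right_less[of "0::real"] by eventually_elim (simp add: 2)
      then show ?thesis using 2 by (simp add: tendsto_eventually)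
    next
      case 3
      then show ?thesis using tendsto_mult_right_zero[OF lim0[of "a - b"], of "c a"] by simp
    qed simp
  qed
  have "((\<lambda>t. \<Sum>a\<in>E. c a * t powr (a - b)) \<longlongrightarrow> 0) (at_right 0)"
  proof (rule Lim_null_comparison)
    show "((\<lambda>t. B * t powr (m - b)) \<longlongrightarrow> 0) (at_right 0)"
      by (rule tendsto_mult_right_zero[OF lim0]) (use assms(2) b(1) in \<open>auto simp: E'_def\<close>)
    have "\<forall>\<^sub>F t in at_right 0. t < t0 \<and> 0 < t" 
      using eventually_at_right_real[OF assms(3)] by eventually_elim simp
    then show "\<forall>\<^sub>F t in at_right 0. norm (\<Sum>a\<in>E. c a * t powr (a - b)) \<le> B * t powr (m - b)"
    proof eventually_elim
      case (elim t)
      have "norm (\<Sum>a\<in>E. c a * t powr (a - b)) = \<bar>(\<Sum>a\<in>E. c a * t powr a) / t powr b\<bar>"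
        by (simp add: sum_divide_distrib powr_diff)
      also have "\<dots> \<le> B * t powr m / t powr b"
        using small[of t] elim by (simp add: divide_right_mono)
      finally show ?case by (simp add: powr_diff)
    qed
  qed
  from tendsto_unique[OF _ lim this] have "(\<Sum>a\<in>E. if a = b then c b else 0) = 0" by simp
  then show False using b(1) assms(1) by (simp add: E'_def)
qed

lemma powr_vs_power_series:
  fixes b :: "nat \<Rightarrow> real"
  assumes d: "0 \<le> d" "d < real m" and "t0 > 0"
    and small: "\<And>t. 0 < t \<Longrightarrow> t \<le> t0 \<Longrightarrow> \<bar>t powr d * a - (\<Sum>j<m. b j * t ^ j)\<bar> \<le> B * t ^ m"
  shows "a = (if d \<in> \<int> then b (nat \<lfloor>d\<rfloor>) else 0)"
proof -
  define J where "J = real ` {..<m}"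
  define c where "c = (\<lambda>e. (if e = d then a else 0) - (if e \<in> J then b (nat \<lfloor>e\<rfloor>) else 0))"
  have fin: "finite (insert d J)" by (simp add: J_def)
  have "c d = 0"
  proof (rule powr_combination_small_imp_zero[where c = c and a = d and m = "real m", OF fin _ \<open>t0 > 0\<close>])
    show "e < real m" if "e \<in> insert d J" for e using that d by (auto simp: J_def)
    fix t :: real assume t: "0 < t" "t \<le> t0"
    have "(\<Sum>e\<in>insert d J. c e * t powr e)
      = (\<Sum>e\<in>insert d J. if e = d then t powr d * a else 0) - (\<Sum>e\<in>insert d J. if e \<in> J then b (nat \<lfloor>e\<rfloor>) * t powr e else 0)"
      unfolding sum_subtractf[symmetric] by (rule sum.cong) (auto simp: c_def algebra_simps)
    also have "(\<Sum>e\<in>insert d J. if e \<in> J then b (nat \<lfloor>e\<rfloor>) * t powr e else 0) = (\<Sum>e\<in>J. b (nat \<lfloor>e\<rfloor>) * t powr e)"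
      by (rule sum.mono_neutral_cong_right) (use fin in auto)
    also have "\<dots> = (\<Sum>j<m. b j * t ^ j)"
      unfolding J_def by (subst sum.reindex) (use t in \<open>auto simp: powr_realpow inj_on_def\<close>)
    also have "(\<Sum>e\<in>insert d J. if e = d then t powr d * a else 0) = t powr d * a"
      using fin by simp
    finally show "\<bar>\<Sum>e\<in>insert d J. c e * t powr e\<bar> \<le> B * t powr real m"
      using small[OF t] t by (simp add: powr_realpow)
  qed simp
  moreover have "d \<in> J \<longleftrightarrow> d \<in> \<int>"
  proof
    assume "d \<in> \<int>"
    then obtain k where k: "d = of_int k" by (auto elim: Ints_cases)
    then have "d = real (nat k)" "nat k < m" using d by auto
    then show "d \<in> J" by (auto simp: J_def)
  qed (auto simp: J_def)
  ultimately show ?thesis by (auto simp: c_def split: if_splits)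
qed

section \<open>Homogeneous viscosity harmonic functions of nonnegative degree\<close>

lemma laplacian_minus:
  assumes "open S" "x \<in> S" "Ck_on 2 S f"
  shows "laplacian (\<lambda>y. - f y) x = - laplacian f x"
  using laplacian_cmult[OF assms, of "-1"] by simp

text \<open>A twice continuously differentiable function touches itself from both sides.\<close>
lemma viscosity_harmonic_imp_laplacian:
  fixes v :: "real^'n \<Rightarrow> real"
  assumes "viscosity_subharmonic v" "viscosity_subharmonic (\<lambda>x. - v x)" "Ck_on 2 (- {0}) v" "x \<noteq> 0"
  shows "laplacian v x = 0"
proof -
  have o: "open (- {0::real^'n})" "x \<in> - {0}" using assms by auto
  have "laplacian v x \<ge> 0"
    by (rule viscosity_subharmonic_touch[OF assms(1,4,3) o]) simp
  moreover have "laplacian (\<lambda>x. - v x) x \<ge> 0"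
    by (rule viscosity_subharmonic_touch[OF assms(2,4) Ck_on_minus[OF o(1) assms(3)] o]) simp
  ultimately show ?thesis using laplacian_minus[OF o assms(3)] by simp
qed

lemma homogeneous_sphere:
  assumes "homogeneous d v" "x \<noteq> 0"
  shows "v x = norm x powr d * v ((1 / norm x) *\<^sub>R x)"
proof -
  have "v (norm x *\<^sub>R ((1 / norm x) *\<^sub>R x)) = norm x powr d * v ((1 / norm x) *\<^sub>R x)"
    using assms unfolding homogeneous_def by (metis divide_eq_0_iff scaleR_eq_0_iff zero_less_norm_iff zero_neq_one norm_eq_zero)
  then show ?thesis using assms(2) by simp
qed

lemma sphere_bound:
  fixes v :: "real^'n \<Rightarrow> real"
  assumes "continuous_on (- {0}) v"
  obtains K where "\<And>x. norm x = 1 \<Longrightarrow> \<bar>v x\<bar> \<le> K" "K \<ge> 0"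
proof -
  have "bounded (v ` sphere 0 1)"
    by (intro compact_imp_bounded compact_continuous_image continuous_on_subset[OF assms]) auto
  then obtain K where K: "\<forall>y\<in>v ` sphere 0 1. norm y \<le> K" unfolding bounded_iff by blast
  have "\<bar>v x\<bar> \<le> max K 0" if "norm x = 1" for x using K that by (simp add: le_max_iff_disj)
  then show ?thesis by (intro that[of "max K 0"]) auto
qed

text \<open>Stone--Weierstrass on the sphere and harmonic extension give \<open>h\<close> near \<open>v\<close> on the sphere; the comparison
  principle for \<open>v\<close> and for \<open>- v\<close> carries the estimate inside.  It applies because \<open>d \<ge> 0\<close> keeps \<open>v\<close> bounded.\<close>
lemma harmonic_polynomial_approximation:
  fixes v :: "real^'n \<Rightarrow> real"
  assumes n: "CARD('n) \<ge> 2" and d: "d \<ge> 0"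
    and v: "homogeneous d v" "continuous_on (- {0}) v"
    and visc: "viscosity_subharmonic v" "viscosity_subharmonic (\<lambda>x. - v x)"
    and e: "e > 0"
  shows "\<exists>h. harmonic_polynomial h \<and> (\<forall>x. x \<noteq> 0 \<longrightarrow> norm x \<le> 1 \<longrightarrow> \<bar>v x - h x\<bar> \<le> e)"
proof -
  obtain K where K: "\<And>x. norm x = 1 \<Longrightarrow> \<bar>v x\<bar> \<le> K" and "K \<ge> 0" using sphere_bound[OF v(2)] by blast
  have bdd: "\<bar>v x\<bar> \<le> K" if "x \<noteq> 0" "norm x \<le> 1" for x
  proof -
    have "norm x powr d \<le> 1" using powr_mono2[of d "norm x" 1] that d by simp
    moreover have "\<bar>v ((1 / norm x) *\<^sub>R x)\<bar> \<le> K" using that by (intro K) simp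
    ultimately have "norm x powr d * \<bar>v ((1 / norm x) *\<^sub>R x)\<bar> \<le> 1 * K" by (intro mult_mono) auto
    then show ?thesis using homogeneous_sphere[OF v(1) that(1)] by (simp add: abs_mult)
  qed
  have "continuous_on (sphere 0 1) v" by (rule continuous_on_subset[OF v(2)]) auto
  then obtain g where g: "real_polynomial_function g" "\<And>x. x \<in> sphere 0 1 \<Longrightarrow> \<bar>v x - g x\<bar> < e"
    using Stone_Weierstrass_real_polynomial_function[of "sphere 0 1" v e] e by auto
  obtain h where h: "harmonic_polynomial h" "\<And>x. norm x = 1 \<Longrightarrow> h x = g x"
    using polynomial_harmonic_extension[OF g(1)] by blast
  have hp: "real_polynomial_function h" "\<And>x. laplacian h x = 0" using h(1) by (auto simp: harmonic_polynomial_def)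
  have hC: "Ck_on 2 UNIV h" by (rule Ck_on_polynomial) (auto intro: hp)
  have one: "s * v x \<le> s * h x + e" if x: "x \<noteq> 0" "norm x \<le> 1" and s: "s = 1 \<or> s = -1" for x s
  proof (rule punctured_ball_comparison[OF n _ _ _ _ _ _ x, of "\<lambda>x. s * v x" K "\<lambda>x. s * h x + e"])
    show "viscosity_subharmonic (\<lambda>x. s * v x)" using visc s by auto
    show "continuous_on (- {0}) (\<lambda>x. s * v x)" by (intro continuous_intros v(2))
    show "s * v y \<le> K" if "y \<noteq> 0" "norm y \<le> 1" for y using bdd[OF that] s by auto
    show "Ck_on 2 UNIV (\<lambda>x. s * h x + e)" by (intro Ck_on_add Ck_on_mult Ck_on_const hC) auto
    show "laplacian (\<lambda>x. s * h x + e) y \<le> 0" for y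
      by (subst laplacian_add[of UNIV]) (auto intro!: Ck_on_mult hC simp: laplacian_cmult_polynomial hp)
    show "s * v y \<le> s * h y + e" if "norm y = 1" for y
      using g(2)[of y] h(2)[of y] that s by auto
  qed
  have "\<bar>v x - h x\<bar> \<le> e" if "x \<noteq> 0" "norm x \<le> 1" for x
    using one[OF that, of 1] one[OF that, of "-1"] by auto
  then show ?thesis using h(1) by blast
qed

text \<open>The derivatives at the origin of approximating harmonic polynomials form Cauchy sequences by the derivative
  estimates; their limits are the coefficients of the polynomials \<open>H j\<close>.  Passing to the limit in
  Taylor's formula along the ray through \<open>e\<close> gives an expansion of \<open>t powr d * v e\<close> in powers of \<open>t\<close> whose
  remainder is \<open>O(t ^ m)\<close> with \<open>m > d\<close>, and this determines \<open>v e\<close>.\<close>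
lemma homogeneous_viscosity_harmonic_on_sphere:
  fixes v :: "real^'n \<Rightarrow> real"
  assumes n: "CARD('n) \<ge> 2" and d: "d \<ge> 0"
    and v: "homogeneous d v" "continuous_on (- {0}) v"
    and visc: "viscosity_subharmonic v" "viscosity_subharmonic (\<lambda>x. - v x)"
  shows "\<exists>p. homogeneous_polynomial (nat \<lfloor>d\<rfloor>) p \<and> (\<forall>e. norm e = 1 \<longrightarrow> v e = (if d \<in> \<int> then p e else 0))"
proof -
  have "\<forall>k::nat. \<exists>h. harmonic_polynomial h \<and> (\<forall>x. x \<noteq> 0 \<longrightarrow> norm x \<le> 1 \<longrightarrow> \<bar>v x - h x\<bar> \<le> 1 / real (Suc k))"
    using harmonic_polynomial_approximation[OF n d v visc] by simp
  then obtain h where h: "\<And>k. harmonic_polynomial (h k)"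
    and close: "\<And>k x. x \<noteq> 0 \<Longrightarrow> norm x \<le> 1 \<Longrightarrow> \<bar>v x - h k x\<bar> \<le> 1 / real (Suc k)" by metis
  obtain K where K: "\<And>x. norm x = 1 \<Longrightarrow> \<bar>v x\<bar> \<le> K" and "K \<ge> 0" using sphere_bound[OF v(2)] by blast
  have hK: "\<bar>h k x\<bar> \<le> K + 1" if "norm x = 1" for k x
  proof -
    have "x \<noteq> 0" using that by auto
    moreover have "1 / real (Suc k) \<le> 1" by simp
    ultimately show ?thesis using close[of x k] K[OF that] that by linarith
  qed
  have conv: "convergent (\<lambda>k. iterated_pderiv l (h k) 0)" for l
  proof -
    obtain C where C: "C \<ge> 0" "\<And>(g::real^'n \<Rightarrow> real) M x. harmonic_polynomial g \<Longrightarrow> (\<And>x. norm x = 1 \<Longrightarrow> \<bar>g x\<bar> \<le> M) \<Longrightarrow>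
        norm x \<le> (1/2) ^ length l \<Longrightarrow> \<bar>iterated_pderiv l g x\<bar> \<le> C * M"
      using harmonic_polynomial_iterated_pderiv_bound[OF n, of "length l"] by blast
    have diff: "\<bar>iterated_pderiv l (h k) 0 - iterated_pderiv l (h j) 0\<bar> \<le> C * (1 / real (Suc k) + 1 / real (Suc j))" for k j
    proof -
      have "\<bar>iterated_pderiv l (\<lambda>x. h k x - h j x) 0\<bar> \<le> C * (1 / real (Suc k) + 1 / real (Suc j))"
      proof (rule C(2))
        fix x :: "real^'n" assume "norm x = 1"
        then have "x \<noteq> 0" "norm x \<le> 1" by auto
        from close[OF this, of k] close[OF this, of j]
        show "\<bar>h k x - h j x\<bar> \<le> 1 / real (Suc k) + 1 / real (Suc j)" by linarith
      qed (auto intro: harmonic_polynomial_diff h)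
      then show ?thesis by (simp add: iterated_pderiv_diff h)
    qed
    have "Cauchy (\<lambda>k. iterated_pderiv l (h k) 0)"
    proof (rule metric_CauchyI)
      fix e :: real assume "e > 0"
      define M where "M = nat \<lceil>2 * C / e\<rceil>"
      have M: "2 * C < e * real (Suc k)" if "k \<ge> M" for k
      proof -
        have "2 * C / e \<le> real M" unfolding M_def by (rule real_nat_ceiling_ge)
        then have "2 * C / e < real (Suc k)" using that by linarith
        then show ?thesis using \<open>e > 0\<close> by (simp add: field_simps)
      qed
      have half: "C * (1 / real (Suc k)) < e / 2" if "k \<ge> M" for k
        using M[OF that] by (simp add: field_simps)
      show "\<exists>M. \<forall>m\<ge>M. \<forall>n\<ge>M. dist (iterated_pderiv l (h m) 0) (iterated_pderiv l (h n) 0) < e"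
      proof (intro exI allI impI)
        fix m n assume "M \<le> m" "M \<le> n"
        then show "dist (iterated_pderiv l (h m) 0) (iterated_pderiv l (h n) 0) < e"
          using half[of m] half[of n] diff[of m n] unfolding dist_real_def distrib_left by linarith
      qed
    qed
    then show ?thesis by (rule real_Cauchy_convergent)
  qed
  define L where "L = (\<lambda>l. lim (\<lambda>k. iterated_pderiv l (h k) 0))"
  have L: "(\<lambda>k. iterated_pderiv l (h k) 0) \<longlonglongrightarrow> L l" for l
    using conv[of l] by (simp add: L_def convergent_LIMSEQ_iff)
  define H where "H = (\<lambda>j x. (\<Sum>l | length l = j. L l / fact j * monomial_of l x))"
  have Hlim: "(\<lambda>k. taylor_term (h k) e j 0 / fact j) \<longlonglongrightarrow> H j e" for j e
  proof -
    have "(\<lambda>k. (\<Sum>l | length l = j. monomial_of l e * iterated_pderiv l (h k) (0 *\<^sub>R e)) / fact j)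
        \<longlonglongrightarrow> (\<Sum>l | length l = j. monomial_of l e * L l) / fact j"
      by (intro tendsto_intros) (use L in auto)
    then show ?thesis by (simp add: taylor_term_def H_def sum_divide_distrib mult.commute)
  qed
  have "homogeneous_polynomial j (H j)" for j
    unfolding homogeneous_polynomial_def
  proof (intro conjI allI)
    show "real_polynomial_function (H j)" unfolding H_def
      using homogeneous_polynomial_monomial_of
      by (intro real_polynomial_function_sum finite_lists_of_length polynomial_intros)
         (auto simp: homogeneous_polynomial_def)
    show "H j (t *\<^sub>R x) = t ^ j * H j x" for t x
    proof -
      have "monomial_of l (t *\<^sub>R x) = t ^ length l * monomial_of l x" for l
        using homogeneous_polynomial_monomial_of[of l] unfolding homogeneous_polynomial_def by blast
      then show ?thesis unfolding H_def sum_distrib_left by (intro sum.cong) auto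
    qed
  qed
  moreover have "v e = (if d \<in> \<int> then H (nat \<lfloor>d\<rfloor>) e else 0)" if e: "norm e = 1" for e
  proof -
    \<comment> \<open>The expansion must reach beyond the power \<open>t powr d\<close>.\<close>
    define m where "m = Suc (nat \<lfloor>d\<rfloor>)"
    have m: "m > 0" "d < real m" using d by (auto simp: m_def) linarith
    obtain C where C: "C \<ge> 0" "\<And>(g::real^'n \<Rightarrow> real) M e t. harmonic_polynomial g \<Longrightarrow> (\<And>x. norm x = 1 \<Longrightarrow> \<bar>g x\<bar> \<le> M) \<Longrightarrow>
     norm e = 1 \<Longrightarrow> 0 < t \<Longrightarrow> t \<le> (1/2) ^ m \<Longrightarrow>
     \<bar>g (t *\<^sub>R e) - (\<Sum>j<m. taylor_term g e j 0 / fact j * t ^ j)\<bar> \<le> C * M * t ^ m"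
      using harmonic_polynomial_taylor_bound[OF n m(1)] by blast
    show ?thesis
    proof (rule powr_vs_power_series[OF d m(2)])
      show "(1/2::real) ^ m > 0" by simp
      fix t :: real assume t: "0 < t" "t \<le> (1/2) ^ m"
      have t1: "t \<le> 1" using t(2) power_le_one[of "1/2::real" m] by simp
      have "e \<noteq> 0" using e by auto
      have vt: "v (t *\<^sub>R e) = t powr d * v e" using v(1) t(1) \<open>e \<noteq> 0\<close> by (simp add: homogeneous_def)
      have near: "\<bar>t powr d * v e - (\<Sum>j<m. taylor_term (h k) e j 0 / fact j * t ^ j)\<bar> \<le> 1 / real (Suc k) + C * (K + 1) * t ^ m" for k
      proof -
        have "\<bar>h k (t *\<^sub>R e) - (\<Sum>j<m. taylor_term (h k) e j 0 / fact j * t ^ j)\<bar> \<le> C * (K + 1) * t ^ m"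
          by (rule C(2)[OF h hK e t])
        moreover have "\<bar>v (t *\<^sub>R e) - h k (t *\<^sub>R e)\<bar> \<le> 1 / real (Suc k)"
          using t t1 e \<open>e \<noteq> 0\<close> by (intro close) auto
        ultimately show ?thesis unfolding vt by linarith
      qed
      have lim1: "(\<lambda>k. \<bar>t powr d * v e - (\<Sum>j<m. taylor_term (h k) e j 0 / fact j * t ^ j)\<bar>)
          \<longlonglongrightarrow> \<bar>t powr d * v e - (\<Sum>j<m. H j e * t ^ j)\<bar>"
        by (intro tendsto_intros Hlim)
      have lim2: "(\<lambda>k. 1 / real (Suc k) + C * (K + 1) * t ^ m) \<longlonglongrightarrow> 0 + C * (K + 1) * t ^ m"
        by (intro tendsto_intros LIMSEQ_Suc[OF lim_1_over_n])
      show "\<bar>t powr d * v e - (\<Sum>j<m. H j e * t ^ j)\<bar> \<le> C * (K + 1) * t ^ m"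
        using LIMSEQ_le[OF lim1 lim2] near by simp
    qed
  qed
  ultimately show ?thesis by blast
qed

lemma homogeneous_viscosity_harmonic_nonneg_degree:
  fixes v :: "real^'n \<Rightarrow> real"
  assumes n: "CARD('n) \<ge> 2" and d: "d \<ge> 0"
    and v: "homogeneous d v" "continuous_on (- {0}) v"
    and visc: "viscosity_subharmonic v" "viscosity_subharmonic (\<lambda>x. - v x)"
  shows "\<exists>p. homogeneous_harmonic_polynomial (nat \<lfloor>d\<rfloor>) p \<and> (\<forall>x. x \<noteq> 0 \<longrightarrow> v x = p x)"
    and "d \<notin> \<int> \<Longrightarrow> x \<noteq> 0 \<Longrightarrow> v x = 0"
proof -
  obtain q where q: "homogeneous_polynomial (nat \<lfloor>d\<rfloor>) q"
     "\<And>e. norm e = 1 \<Longrightarrow> v e = (if d \<in> \<int> then q e else 0)"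
    using homogeneous_viscosity_harmonic_on_sphere[OF assms] by blast
  have e: "norm ((1 / norm x) *\<^sub>R x) = 1" if "x \<noteq> 0" for x :: "real^'n" using that by simp
  show nonint: "v x = 0" if "d \<notin> \<int>" "x \<noteq> 0" for x
    using homogeneous_sphere[OF v(1) that(2)] q(2)[OF e[OF that(2)]] that by simp
  define p where "p = (if d \<in> \<int> then q else (\<lambda>x. 0))"
  have p: "homogeneous_polynomial (nat \<lfloor>d\<rfloor>) p" 
    using q(1) by (auto simp: p_def homogeneous_polynomial_def)
  have vp: "v x = p x" if "x \<noteq> 0" for x
  proof (cases "d \<in> \<int>")
    case True
    then have k: "d = real (nat \<lfloor>d\<rfloor>)" using d by (auto elim!: Ints_cases)
    have "q (norm x *\<^sub>R ((1 / norm x) *\<^sub>R x)) = norm x ^ nat \<lfloor>d\<rfloor> * q ((1 / norm x) *\<^sub>R x)"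
      using q(1) unfolding homogeneous_polynomial_def by blast
    then show ?thesis using homogeneous_sphere[OF v(1) that] q(2)[OF e[OF that]] True that
      by (subst (asm) k) (simp add: p_def powr_realpow)
  qed (use nonint that in \<open>simp add: p_def\<close>)
  have pp: "real_polynomial_function p" using p by (simp add: homogeneous_polynomial_def)
  have C: "Ck_on 2 S p" if "open S" for S using Ck_on_polynomial[OF that pp] .
  have "Ck_on 2 (- {0}) v" by (rule Ck_on_cong[THEN iffD2, OF _ _ C[of "- {0}"]]) (auto simp: vp)
  from viscosity_harmonic_imp_laplacian[OF visc this]
  have lap: "laplacian p x = 0" if "x \<noteq> 0" for x
    using laplacian_cong_open[of "- {0}" x v p] vp that by auto
  then have "laplacian p 0 = 0"
    using polynomial_bound_at_0[OF real_polynomial_function_laplacian[OF pp], of 1 0] by simp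
  then have "laplacian p x = 0" for x using lap by (cases "x = 0") auto
  then have "homogeneous_harmonic_polynomial (nat \<lfloor>d\<rfloor>) p"
    using p C by (simp add: homogeneous_harmonic_polynomial_def harmonic_on_def homogeneous_polynomial_def trace_hessian)
  then show "\<exists>p. homogeneous_harmonic_polynomial (nat \<lfloor>d\<rfloor>) p \<and> (\<forall>x. x \<noteq> 0 \<longrightarrow> v x = p x)"
    using vp by blast
qed

section \<open>Negative degrees and dimension one\<close>

text \<open>The test functions that suffice for second-order equations.\<close>
definition quadratic :: "real \<Rightarrow> real^'n \<Rightarrow> real^'n^'n \<Rightarrow> real^'n \<Rightarrow> real^'n \<Rightarrow> real" where
  "quadratic c p A x0 z = c + p \<bullet> (z - x0) + (1/2) * ((z - x0) \<bullet> (A *v (z - x0)))"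

lemma quadratic_center [simp]: "quadratic c p A x0 x0 = c"
  by (simp add: quadratic_def)

lemma quadratic_add_square:
  fixes p :: "real^'n"
  shows "quadratic c p A x0 z + e * (norm (z - x0))\<^sup>2 = quadratic c p (A + mat (2 * e)) x0 z"
proof -
  have "mat (2 * e) *v w = (2 * e) *\<^sub>R w" for w :: "real^'n"
    by (simp add: vec_eq_iff matrix_vector_mult_def mat_def if_distrib[of "\<lambda>t. t * _"] cong: if_cong)
  then show ?thesis
    by (simp add: quadratic_def matrix_vector_mult_add_rdistrib inner_add_right dot_square_norm)
qed

lemma real_polynomial_function_quadratic: "real_polynomial_function (quadratic c p A x0)"
proof -
  have "quadratic c p A x0 = (\<lambda>z. c + (\<Sum>i\<in>UNIV. p $ i * (z $ i - x0 $ i))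
      + (1/2) * (\<Sum>i\<in>UNIV. (z $ i - x0 $ i) * (\<Sum>j\<in>UNIV. A $ i $ j * (z $ j - x0 $ j))))"
    by (simp add: fun_eq_iff quadratic_def inner_vec_def matrix_vector_mult_def)
  then show ?thesis
    by (simp only:) (intro polynomial_intros real_polynomial_function_sum finite)
qed

lemma has_derivative_matrix_shift:
  fixes A :: "real^'n^'m"
  shows "((\<lambda>z. A *v (z - x0)) has_derivative (\<lambda>h. A *v h)) (at z)"
proof -
  have "((\<lambda>z. z - x0) has_derivative (\<lambda>h. h)) (at z)"
    by (auto intro!: derivative_eq_intros)
  from has_derivative_compose[OF this bounded_linear_imp_has_derivative[OF matrix_vector_mul_bounded_linear[of A]]]
  show ?thesis .
qed

lemma has_derivative_quadratic:
  "(quadratic c p A x0 has_derivative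
     (\<lambda>h. p \<bullet> h + (1/2) * (h \<bullet> (A *v (z - x0)) + (z - x0) \<bullet> (A *v h)))) (at z)"
proof -
  have A: "((\<lambda>z. A *v (z - x0)) has_derivative (\<lambda>h. A *v h)) (at z)"
    by (rule has_derivative_matrix_shift)
  have S: "((\<lambda>z. z - x0) has_derivative (\<lambda>h. h)) (at z)"
    by (auto intro!: derivative_eq_intros)
  have I: "((\<lambda>z. (z - x0) \<bullet> (A *v (z - x0))) has_derivative
      (\<lambda>h. (z - x0) \<bullet> (A *v h) + h \<bullet> (A *v (z - x0)))) (at z)"
    by (rule has_derivative_inner[OF S A])
  have "((\<lambda>z. c + p \<bullet> (z - x0) + (1/2) * ((z - x0) \<bullet> (A *v (z - x0)))) has_derivative
      (\<lambda>h. 0 + p \<bullet> h + (1/2) * ((z - x0) \<bullet> (A *v h) + h \<bullet> (A *v (z - x0))))) (at z)"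
    by (intro has_derivative_add has_derivative_const has_derivative_inner_right has_derivative_mult_right S I)
  then show ?thesis unfolding quadratic_def[abs_def] by (simp add: add.commute)
qed

lemma pderiv_at_quadratic:
  "pderiv_at i (quadratic c p A x0) z = p $ i + (1/2) * ((A *v (z - x0)) $ i + (z - x0) \<bullet> column i A)"
  by (subst pderiv_at_eq[OF has_derivative_quadratic])
    (simp add: inner_axis inner_axis' matrix_vector_mult_basis)

lemma hessian_quadratic: "hessian (quadratic c p A x0) z = sym_part A"
proof -
  have "pderiv_at i (pderiv_at j (quadratic c p A x0)) z = (1/2) * (A $ i $ j + A $ j $ i)" for i j
  proof -
    have "((\<lambda>z. A *v (z - x0)) has_derivative (\<lambda>h. A *v h)) (at z)"
      by (rule has_derivative_matrix_shift)
    then have "((\<lambda>z. (A *v (z - x0)) $ j) has_derivative (\<lambda>h. (A *v h) $ j)) (at z)"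
      by (rule bounded_linear.has_derivative[OF bounded_linear_vec_nth])
    then have "((\<lambda>z. p $ j + (1/2) * ((A *v (z - x0)) $ j + (z - x0) \<bullet> column j A)) has_derivative
      (\<lambda>h. (1/2) * ((A *v h) $ j + h \<bullet> column j A))) (at z)"
      by (auto intro!: derivative_eq_intros)
    from pderiv_at_eq[OF this, of i] show ?thesis
      unfolding pderiv_at_quadratic[abs_def]
      by (simp add: matrix_vector_mult_basis column_def inner_axis' add.commute)
  qed
  then show ?thesis by (simp add: hessian_def sym_part_def vec_eq_iff transpose_def)
qed

lemma trace_sym_part: "trace (sym_part A) = trace A"
  by (simp add: trace_def sym_part_def transpose_def)

lemma laplacian_quadratic: "laplacian (quadratic c p A x0) z = trace A"
  using trace_hessian[of "quadratic c p A x0" z] trace_sym_part[of A]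
  by (simp add: hessian_quadratic trace_def)

lemma trace_add_mat: "trace (A + mat c) = trace A + real CARD('n) * c" for A :: "real^'n^'n"
  by (simp add: trace_def mat_def sum.distrib)

lemma viscosity_subharmonic_quadratic:
  "viscosity_subharmonic v \<longleftrightarrow>
     (\<forall>x0 p A. x0 \<noteq> 0 \<longrightarrow>
        (\<forall>e>0. \<forall>\<^sub>F z in nhds x0. v z \<le> quadratic (v x0) p (A + mat (2 * e)) x0 z) \<longrightarrow> trace A \<ge> 0)"
  unfolding viscosity_subharmonic_def quadratic_add_square[symmetric] unfolding quadratic_def ..

lemma nonneg_if_all_perturbations_nonneg:
  fixes a b :: real
  assumes "\<And>e. e > 0 \<Longrightarrow> a + b * e \<ge> 0"
  shows "a \<ge> 0"
proof -
  have "((\<lambda>e. a + b * e) \<longlongrightarrow> a + b * 0) (at_right 0)"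
    by (intro tendsto_intros)
  moreover have "\<forall>\<^sub>F e in at_right 0. 0 \<le> a + b * e"
    using eventually_at_right_less[of "0::real"] by eventually_elim (rule assms)
  ultimately have "0 \<le> a + b * 0" by (intro tendsto_lowerbound) auto
  then show ?thesis by simp
qed

text \<open>By homogeneity a maximum on the sphere is the contact point of a multiple of \<open>norm z powr d\<close> with \<open>v\<close> from
  above, globally.\<close>
lemma sphere_maximum:
  fixes v :: "real^'n \<Rightarrow> real"
  assumes "homogeneous d v" "continuous_on (- {0}) v"
  obtains e where "norm e = 1" "\<And>z. z \<noteq> 0 \<Longrightarrow> v z \<le> v e * norm z powr d"
proof -
  have "axis undefined 1 \<in> sphere (0::real^'n) 1" by (simp add: norm_axis_1)
  then obtain e where e: "e \<in> sphere 0 1" "\<And>z. z \<in> sphere 0 1 \<Longrightarrow> v z \<le> v e"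
    using continuous_attains_sup[of "sphere 0 1" v] continuous_on_subset[OF assms(2), of "sphere 0 1"] by fastforce
  have "v z \<le> v e * norm z powr d" if "z \<noteq> 0" for z
  proof -
    have "v ((1 / norm z) *\<^sub>R z) \<le> v e" using that by (intro e) simp
    then have "norm z powr d * v ((1 / norm z) *\<^sub>R z) \<le> norm z powr d * v e" by (intro mult_left_mono) auto
    then show ?thesis using homogeneous_sphere[OF assms(1) that] by (simp add: mult.commute)
  qed
  then show ?thesis using e that by auto
qed

lemma homogeneous_superjet_exists:
  fixes v :: "real^'n \<Rightarrow> real"
  assumes "homogeneous d v" "continuous_on (- {0}) v"
  obtains x0 p A where "x0 \<noteq> 0" "\<forall>\<^sub>F z in nhds x0. v z \<le> quadratic (v x0) p A x0 z"
proof -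
  obtain e where e: "norm e = 1" "\<And>z. z \<noteq> 0 \<Longrightarrow> v z \<le> v e * norm z powr d"
    using sphere_maximum[OF assms] by blast
  define f where "f = (\<lambda>z::real^'n. v e * norm z powr d)"
  have o: "open (- {0::real^'n})" "e \<in> - {0}" using e by auto
  have C: "Ck_on 2 (- {0}) f" unfolding f_def by (intro Ck_on_mult Ck_on_norm_powr Ck_on_const) auto
  have "\<forall>\<^sub>F z in nhds e. z \<in> - {0}" using o by (intro eventually_nhds_in_open)
  with second_order_expansion[OF C o zero_less_one]
  have "\<forall>\<^sub>F z in nhds e. v z \<le> quadratic (v e) (\<chi> i. pderiv_at i f e) (hessian f e + mat (2 * 1)) e z"
  proof eventually_elim
    case (elim z)
    have "v z \<le> f z" using e(2)[of z] elim by (simp add: f_def)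
    moreover have "f e = v e" using e by (simp add: f_def)
    ultimately show ?case
      using elim quadratic_add_square[of "v e" "\<chi> i. pderiv_at i f e" "hessian f e" e z 1]
      unfolding quadratic_def by linarith
  qed
  then show ?thesis using that o by blast
qed

text \<open>Under the condition on \<open>d\<close> the power \<open>norm z powr d\<close> is strictly superharmonic, so a positive multiple of
  it cannot touch \<open>v\<close> from above.\<close>
lemma homogeneous_viscosity_subharmonic_nonpos:
  fixes v :: "real^'n \<Rightarrow> real"
  assumes v: "homogeneous d v" "continuous_on (- {0}) v" "viscosity_subharmonic v"
    and d: "d * (d + real CARD('n) - 2) < 0" and x: "x \<noteq> 0"
  shows "v x \<le> 0"
proof -
  obtain e where e: "norm e = 1" "\<And>z. z \<noteq> 0 \<Longrightarrow> v z \<le> v e * norm z powr d"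
    using sphere_maximum[OF v(1,2)] by blast
  define f where "f = (\<lambda>z::real^'n. v e * norm z powr d)"
  have o: "open (- {0::real^'n})" "e \<in> - {0}" using e by auto
  have C: "Ck_on 2 (- {0}) f" unfolding f_def by (intro Ck_on_mult Ck_on_norm_powr Ck_on_const) auto
  have "\<forall>\<^sub>F z in nhds e. z \<in> - {0}" using o by (intro eventually_nhds_in_open)
  then have "\<forall>\<^sub>F z in nhds e. v z - v e \<le> f z - f e"
    by eventually_elim (use e in \<open>simp add: f_def\<close>)
  then have "laplacian f e \<ge> 0" using viscosity_subharmonic_touch[OF v(3) _ C o] o by blast
  moreover have "laplacian f e = v e * (d * (d + real CARD('n) - 2))"
    unfolding f_def using o e(1) laplacian_norm_powr[of e d]
    by (subst laplacian_cmult[OF o Ck_on_norm_powr]) auto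
  ultimately have "v e \<le> 0" using mult_pos_neg[OF _ d, of "v e"] by linarith
  then have "v e * norm x powr d \<le> 0" by (simp add: mult_nonpos_nonneg)
  then show ?thesis using e(2)[OF x] by simp
qed

lemma homogeneous_kelvin:
  assumes "homogeneous d v"
  shows "homogeneous (d + s) (\<lambda>x. norm x powr s * v x)"
  using assms unfolding homogeneous_def by (auto simp: powr_mult powr_add)

text \<open>The exponent \<open>s\<close> makes this the Kelvin transform of a function of degree \<open>d\<close>.  If \<open>Q\<close> touches the
  transformed function at \<open>x0\<close>, then \<open>norm x powr (- s) * Q x\<close> touches \<open>v\<close>.  Its Laplacian contains first derivatives of
  \<open>Q\<close> only in the radial direction, and these are known: along the ray through \<open>x0\<close> homogeneity determines
  the function that \<open>Q\<close> touches, so \<open>Q\<close> satisfies Euler's identity at the contact point.\<close>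
lemma viscosity_subharmonic_kelvin:
  fixes v :: "real^'n \<Rightarrow> real"
  assumes v: "homogeneous d v" "viscosity_subharmonic v"
    and s: "s = 2 - real CARD('n) - 2 * d"
  shows "viscosity_subharmonic (\<lambda>x. norm x powr s * v x)"
  unfolding viscosity_subharmonic_quadratic
proof (intro allI impI)
  fix x0 p :: "real^'n" and A :: "real^'n^'n"
  define w where "w = (\<lambda>x. norm x powr s * v x)"
  assume x0: "x0 \<noteq> 0" and "\<forall>e>0. \<forall>\<^sub>F z in nhds x0. norm z powr s * v z \<le> quadratic (norm x0 powr s * v x0) p (A + mat (2 * e)) x0 z"
  then have jet: "\<forall>\<^sub>F z in nhds x0. w z \<le> quadratic (w x0) p (A + mat (2 * e)) x0 z" if "e > 0" for e
    using that by (simp add: w_def)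
  have o: "open (- {0::real^'n})" "x0 \<in> - {0}" using x0 by auto
  have "trace A + (2 * real CARD('n)) * e \<ge> 0" if "e > 0" for e
  proof -
    define Q where "Q = quadratic (w x0) p (A + mat (2 * e)) x0"
    have Qp: "real_polynomial_function Q" unfolding Q_def by (rule real_polynomial_function_quadratic)
    have QC: "Ck_on 2 (- {0}) Q" by (rule Ck_on_polynomial[OF o(1) Qp])
    have Q0: "Q x0 = w x0" by (simp add: Q_def)
    have euler: "(\<Sum>i\<in>UNIV. x0 $ i * pderiv_at i Q x0) = (d + s) * Q x0"
    proof -
      define f where "f = (\<lambda>t. Q (t *\<^sub>R x0) - t powr (d + s) * w x0)"
      have "((\<lambda>t. Q (t *\<^sub>R x0)) has_real_derivative (\<Sum>i\<in>UNIV. x0 $ i * pderiv_at i Q x0)) (at 1)"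
        using has_real_derivative_along_line[of Q 0 1 x0] real_polynomial_function_differentiable[OF Qp] by simp
      then have D: "(f has_real_derivative (\<Sum>i\<in>UNIV. x0 $ i * pderiv_at i Q x0) - (d + s) * w x0) (at 1)"
        unfolding f_def by (auto intro!: derivative_eq_intros)
      have "((\<lambda>t. t *\<^sub>R x0) \<longlongrightarrow> 1 *\<^sub>R x0) (nhds 1)" by (intro tendsto_intros filterlim_ident)
      then have "\<forall>\<^sub>F t in nhds 1. w (t *\<^sub>R x0) \<le> Q (t *\<^sub>R x0)"
        using eventually_compose_filterlim[OF jet[OF that]] by (simp add: Q_def)
      moreover have "\<forall>\<^sub>F t in nhds 1. t \<in> {0::real<..}" by (intro eventually_nhds_in_open) auto
      ultimately have "\<forall>\<^sub>F t in nhds 1. f 1 \<le> f t"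
      proof eventually_elim
        case (elim t)
        then have "w (t *\<^sub>R x0) = t powr (d + s) * w x0"
          using homogeneous_kelvin[OF v(1), of s] x0 by (simp add: homogeneous_def w_def)
        then show ?case using elim by (simp add: f_def Q0)
      qed
      then obtain \<delta> where "\<delta> > 0" "\<forall>t. \<bar>1 - t\<bar> < \<delta> \<longrightarrow> f 1 \<le> f t"
        unfolding eventually_nhds_metric by (auto simp: dist_real_def abs_minus_commute)
      from DERIV_local_min[OF D this] show ?thesis by (simp add: Q0)
    qed
    define \<psi> where "\<psi> = (\<lambda>x. norm x powr (- s) * Q x)"
    have C: "Ck_on 2 (- {0}) \<psi>" unfolding \<psi>_def by (intro Ck_on_mult Ck_on_norm_powr QC) auto
    have vw: "v z = norm z powr (- s) * w z" if "z \<noteq> 0" for z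
      using that by (simp add: w_def powr_minus)
    have "\<forall>\<^sub>F z in nhds x0. z \<in> - {0}" using o by (intro eventually_nhds_in_open)
    with jet[OF that] have "\<forall>\<^sub>F z in nhds x0. v z - v x0 \<le> \<psi> z - \<psi> x0"
    proof eventually_elim
      case (elim z)
      then have "v z \<le> \<psi> z" using vw[of z] by (simp add: \<psi>_def Q_def mult_left_mono)
      then show ?case using vw[OF x0] by (simp add: \<psi>_def Q0)
    qed
    from viscosity_subharmonic_touch[OF v(2) x0 C o this] have "laplacian \<psi> x0 \<ge> 0" .
    moreover have "laplacian \<psi> x0 = norm x0 powr (- s) * laplacian Q x0"
    proof -
      \<comment> \<open>This cancellation is the reason for the choice of \<open>s\<close>.\<close>
      have "2 * ((d + s) * Q x0) + (- s + real CARD('n) - 2) * Q x0 = 0" unfolding s by (simp add: algebra_simps)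
      then show ?thesis unfolding \<psi>_def laplacian_mult_norm_powr[OF x0 QC] euler by simp
    qed
    ultimately have "laplacian Q x0 \<ge> 0" using x0 by (simp add: zero_le_mult_iff)
    then show ?thesis unfolding Q_def laplacian_quadratic trace_add_mat by (simp add: algebra_simps)
  qed
  then show "trace A \<ge> 0" by (rule nonneg_if_all_perturbations_nonneg)
qed

text \<open>The two half-lines are independent; the even and odd parts give \<open>a\<close> and \<open>b\<close>.  Writing \<open>v\<close> in this way makes its
  smoothness away from 0 obvious.\<close>
lemma homogeneous_dimension_one:
  fixes v :: "real^'n \<Rightarrow> real"
  assumes n: "CARD('n) = 1" and v: "homogeneous d v"
  shows "\<exists>a b i. (\<forall>x::real^'n. norm x = \<bar>x $ i\<bar>) \<and> (\<forall>x. x \<noteq> 0 \<longrightarrow> v x = a * norm x powr d + b * (norm x powr (d - 1) * x $ i))"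
proof -
  obtain i :: 'n where i: "UNIV = {i}" using n card_1_singletonE by blast
  define e :: "real^'n" where "e = axis i 1"
  have x: "x = x $ i *\<^sub>R e" for x
    using i by (auto simp: vec_eq_iff e_def axis_def)
  have nx: "norm x = \<bar>x $ i\<bar>" for x :: "real^'n" by (simp add: norm_eq_sqrt_inner inner_vec_def i)
  define a where "a = (v e + v (- e)) / 2"
  define b where "b = (v e - v (- e)) / 2"
  have "v x = a * norm x powr d + b * (norm x powr (d - 1) * x $ i)" if "x \<noteq> 0" for x
  proof -
    have "e \<noteq> 0" by (simp add: e_def axis_eq_0_iff)
    have xi: "x $ i \<noteq> 0" using x[of x] that by auto
    have *: "norm x powr (d - 1) * x $ i = sgn (x $ i) * norm x powr d"
      using xi by (simp add: nx powr_diff sgn_if)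
    consider "x $ i > 0" | "x $ i < 0" using xi by linarith
    then show ?thesis
    proof cases
      case 1
      then have "v (x $ i *\<^sub>R e) = (x $ i) powr d * v e" using v \<open>e \<noteq> 0\<close> by (simp add: homogeneous_def)
      then show ?thesis using x[of x] 1 unfolding * by (simp add: nx a_def b_def algebra_simps add_divide_distrib diff_divide_distrib)
    next
      case 2
      then have "v ((- x $ i) *\<^sub>R (- e)) = (- x $ i) powr d * v (- e)" using v \<open>e \<noteq> 0\<close> unfolding homogeneous_def
        by (metis neg_0_less_iff_less neg_equal_0_iff_equal)
      then show ?thesis using x[of x] 2 unfolding * by (simp add: nx a_def b_def algebra_simps add_divide_distrib diff_divide_distrib)
    qed
  qed
  then show ?thesis using nx by blast
qed

lemma homogeneous_dimension_one_zero:
  fixes v :: "real^'n \<Rightarrow> real"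
  assumes n: "CARD('n) = 1" and v: "homogeneous d v"
    and visc: "viscosity_subharmonic v" "viscosity_subharmonic (\<lambda>x. - v x)"
    and C: "Ck_on 2 (- {0}) v" and d: "d \<noteq> 0" "d \<noteq> 1" and x: "x \<noteq> 0"
  shows "v x = 0"
proof -
  obtain a b i where nx: "\<And>x::real^'n. norm x = \<bar>x $ i\<bar>" and
    eq: "\<And>x. x \<noteq> 0 \<Longrightarrow> v x = a * norm x powr d + b * (norm x powr (d - 1) * x $ i)"
    using homogeneous_dimension_one[OF n v] by blast
  define S where "S = {z::real^'n. sgn (x $ i) * z $ i > 0}"
  have xi: "x $ i \<noteq> 0" using nx[of x] x by auto
  have S: "open S" "x \<in> S" unfolding S_def using xi by (auto intro!: open_Collect_less continuous_intros simp: sgn_if)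
  have S0: "z \<noteq> 0" if "z \<in> S" for z using that by (auto simp: S_def)
  define c where "c = a + b * sgn (x $ i)"
  have vS: "v z = c * norm z powr d" if "z \<in> S" for z
  proof -
    have "sgn (x $ i) * z $ i = \<bar>z $ i\<bar>" using that by (auto simp: S_def sgn_if split: if_splits)
    then have "z $ i = sgn (x $ i) * norm z" using xi nx[of z] by (auto simp: sgn_if split: if_splits)
    moreover have "norm z powr (d - 1) * norm z = norm z powr d" using S0[OF that] by (simp add: powr_diff)
    ultimately show ?thesis using eq[OF S0[OF that]] by (simp add: c_def algebra_simps)
  qed
  have "Ck_on 2 S (\<lambda>z. norm z powr d)" by (rule Ck_on_subset[OF Ck_on_norm_powr]) (use S0 in auto)
  then have "laplacian v x = c * (d * (d + real CARD('n) - 2) * norm x powr (d - 2))"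
    using laplacian_cong_open[OF S vS] laplacian_cmult[OF S, of "\<lambda>z. norm z powr d" c] laplacian_norm_powr[OF x, of d] by simp
  moreover have "laplacian v x = 0" by (rule viscosity_harmonic_imp_laplacian[OF visc C x])
  ultimately have "c = 0" using d n x by simp
  then show ?thesis using vS[OF S(2)] by simp
qed

lemma Ck_on_dimension_one:
  fixes v :: "real^'n \<Rightarrow> real"
  assumes n: "CARD('n) = 1" and v: "homogeneous d v"
  shows "Ck_on k (- {0}) v"
proof -
  obtain a b i where 
    eq: "\<And>x. x \<noteq> 0 \<Longrightarrow> v x = a * norm x powr d + b * (norm x powr (d - 1) * x $ i)"
    using homogeneous_dimension_one[OF n v] by blast
  have "Ck_on k (- {0}) (\<lambda>x. a * norm x powr d + b * (norm x powr (d - 1) * x $ i))"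
    by (intro Ck_on_add Ck_on_mult Ck_on_const Ck_on_norm_powr) (auto intro: Ck_on_polynomial)
  then show ?thesis by (rule Ck_on_cong[THEN iffD2, rotated -1]) (auto simp: eq)
qed

section \<open>From the nonlinear equation to the Laplace equation\<close>

lemma sym_part_in_sym [simp]: "sym_part A \<in> sym_matrices"
  by (simp add: sym_part_def sym_matrices_def transpose_def vec_eq_iff)

lemma sym_part_scaleR: "sym_part (s *\<^sub>R A) = s *\<^sub>R sym_part A"
  by (simp add: sym_part_def transpose_def vec_eq_iff algebra_simps)

lemma sym_part_ident: "A \<in> sym_matrices \<Longrightarrow> sym_part A = A"
  by (simp add: sym_part_def sym_matrices_def vec_eq_iff)

text \<open>The Frobenius inner product.\<close>
definition matrix_inner :: "real^'n^'n \<Rightarrow> real^'n^'n \<Rightarrow> real" where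
  "matrix_inner A B = (\<Sum>i\<in>UNIV. \<Sum>j\<in>UNIV. A $ i $ j * B $ i $ j)"

lemma matrix_inner_trace: "matrix_inner A B = trace (transpose A ** B)"
  unfolding matrix_inner_def trace_def matrix_matrix_mult_def transpose_def
  by simp (rule sum.swap)

lemma matrix_inner_sym_part:
  assumes "A \<in> sym_matrices"
  shows "matrix_inner A (sym_part B) = matrix_inner A B"
proof -
  have A: "A $ i $ j = A $ j $ i" for i j
    using assms by (auto simp: sym_matrices_def transpose_def vec_eq_iff)
  have "matrix_inner A (transpose B) = matrix_inner A B"
    unfolding matrix_inner_def transpose_def by (subst sum.swap) (simp add: A)
  moreover have "matrix_inner A (sym_part B) = (matrix_inner A B + matrix_inner A (transpose B)) / 2"
    by (simp add: matrix_inner_def sym_part_def sum.distrib algebra_simps sum_divide_distrib add_divide_distrib)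
  ultimately show ?thesis by simp
qed

text \<open>The entries of \<open>F_partial F 0\<close> are derivatives in the directions of the symmetrised matrix units, and these span the
  symmetric matrices.\<close>
lemma C1_on_sym_directional_derivative:
  fixes F :: "real^'n^'n \<Rightarrow> real"
  assumes "C1_on_sym F" "H \<in> sym_matrices"
  shows "((\<lambda>s. F (s *\<^sub>R H)) has_real_derivative matrix_inner (F_partial F 0) H) (at 0)"
    and "F_partial F 0 \<in> sym_matrices"
proof -
  have z: "0 \<in> (sym_matrices :: (real^'n^'n) set)" by (simp add: sym_matrices_def transpose_def vec_eq_iff)
  obtain D :: "real^'n^'n \<Rightarrow> (real^'n^'n) \<Rightarrow>\<^sub>L real"
    where D: "(F has_derivative blinfun_apply (D 0)) (at 0 within sym_matrices)"
    using assms(1) z unfolding C1_on_sym_def by blast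
  define L where "L = blinfun_apply (D 0)"
  have L: "linear L" unfolding L_def by (rule bounded_linear.linear) (rule blinfun.bounded_linear_right)
  have ray: "((\<lambda>s. F (s *\<^sub>R H)) has_real_derivative L H) (at 0)" if "H \<in> sym_matrices" for H
  proof -
    have 1: "((\<lambda>s. s *\<^sub>R H) has_derivative (\<lambda>s. s *\<^sub>R H)) (at (0::real))"
      by (auto intro!: derivative_eq_intros)
    have im: "range (\<lambda>s. s *\<^sub>R H) \<subseteq> sym_matrices"
      using that by (auto simp: sym_matrices_def transpose_def vec_eq_iff)
    have "(F has_derivative L) (at (0 *\<^sub>R H) within range (\<lambda>s. s *\<^sub>R H))"
      using has_derivative_subset[OF D im] by (simp add: L_def)
    from has_derivative_in_compose[OF 1 this]
    show ?thesis by (simp add: has_field_derivative_def linear_cmul[OF L] mult_commute_abs)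
  qed
  have entry: "F_partial F 0 $ i $ j = L (sym_part (matrix_unit i j))" for i j
    using DERIV_imp_deriv[OF ray[OF sym_part_in_sym]] by (simp add: F_partial_def sym_part_scaleR)
  have "transpose (matrix_unit i j) = (matrix_unit j i :: real^'n^'n)" for i j
    by (simp add: vec_eq_iff transpose_def matrix_unit_def conj_commute)
  then have swap: "sym_part (matrix_unit i j) = sym_part (matrix_unit j i :: real^'n^'n)" for i j
    by (simp add: sym_part_def add.commute)
  have "F_partial F 0 $ i $ j = F_partial F 0 $ j $ i" for i j
    unfolding entry by (rule arg_cong[OF swap])
  then show "F_partial F 0 \<in> sym_matrices"
    by (simp add: sym_matrices_def vec_eq_iff transpose_def)
  have lin: "linear (\<lambda>B. L (sym_part B))"
  proof (rule linearI)
    show "L (sym_part (B + C)) = L (sym_part B) + L (sym_part C)" for B C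
      unfolding linear_add[OF L, symmetric]
      by (rule arg_cong[of _ _ L]) (simp add: sym_part_def transpose_def vec_eq_iff algebra_simps)
    show "L (sym_part (c *\<^sub>R B)) = c *\<^sub>R L (sym_part B)" for c B
      by (simp add: sym_part_scaleR linear_cmul[OF L])
  qed
  have "H = (\<Sum>i\<in>UNIV. \<Sum>j\<in>UNIV. H $ i $ j *\<^sub>R matrix_unit i j)"
  proof -
    have inner: "(\<Sum>j\<in>UNIV. H $ i $ j * (if k = i \<and> l = j then 1 else 0)) = (if k = i then H $ i $ l else 0)" for i k l
      by (cases "k = i") (simp_all add: if_distrib[of "\<lambda>t. _ * t"] cong: if_cong)
    have "(\<Sum>i\<in>UNIV. \<Sum>j\<in>UNIV. H $ i $ j *\<^sub>R matrix_unit i j) $ k $ l = H $ k $ l" for k l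
      by (simp add: matrix_unit_def inner)
    then show ?thesis by (simp add: vec_eq_iff)
  qed
  then have "L (sym_part H) = L (sym_part (\<Sum>i\<in>UNIV. \<Sum>j\<in>UNIV. H $ i $ j *\<^sub>R matrix_unit i j))" by simp
  also have "\<dots> = matrix_inner (F_partial F 0) H"
    by (simp add: linear_sum[OF lin] linear_cmul[OF lin] entry matrix_inner_def mult.commute)
  finally show "((\<lambda>s. F (s *\<^sub>R H)) has_real_derivative matrix_inner (F_partial F 0) H) (at 0)"
    using ray[OF assms(2)] sym_part_ident[OF assms(2)] by simp
qed

lemma right_derivative_nonneg:
  fixes f :: "real \<Rightarrow> real"
  assumes "(f has_real_derivative D) (at 0)" "f 0 = 0" "\<And>s. s > 0 \<Longrightarrow> f s \<ge> 0"
  shows "D \<ge> 0"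
proof (rule ccontr)
  assume "\<not> D \<ge> 0"
  then obtain d where "d > 0" "\<forall>h>0. h < d \<longrightarrow> f (0 + h) < f 0"
    using DERIV_neg_dec_right[OF assms(1)] by auto
  then have "f (d/2) < 0" using assms(2) by auto
  then show False using assms(3)[of "d/2"] \<open>d > 0\<close> by simp
qed

lemma right_limit_nonneg:
  fixes f :: "real \<Rightarrow> real"
  assumes "(f has_real_derivative D) (at 0)" "\<And>s. s > 0 \<Longrightarrow> f s \<ge> 0"
  shows "f 0 \<ge> 0"
proof -
  have "(f \<longlongrightarrow> f 0) (at_right 0)"
    using DERIV_isCont[OF assms(1)] by (simp add: isCont_def filterlim_at_split)
  moreover have "\<forall>\<^sub>F s in at_right 0. 0 \<le> f s"
    using eventually_at_right_less[of "0::real"] by eventually_elim (rule assms(2))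
  ultimately show ?thesis by (intro tendsto_lowerbound) auto
qed

lemma viscosity_subsolution_quadratic:
  assumes "viscosity_subsolution \<Omega> F u" "x0 \<in> \<Omega>" "\<forall>\<^sub>F z in nhds x0. u z \<le> quadratic (u x0) p B x0 z"
  shows "F (sym_part B) \<ge> 0"
  using assms smooth_polynomial[OF real_polynomial_function_quadratic, of "u x0" p B x0]
  unfolding viscosity_subsolution_def by (metis hessian_quadratic quadratic_center)

text \<open>The dilation of the touching paraboloid by the factor \<open>t\<close> touches \<open>u\<close> at \<open>t *\<^sub>R x0\<close>, and its Hessian is multiplied by
  \<open>t powr (d - 2)\<close>.  This is where \<open>d \<noteq> 2\<close> enters.\<close>
lemma viscosity_subsolution_quadratic_rays:
  fixes u :: "real^'n \<Rightarrow> real"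
  assumes sub: "viscosity_subsolution \<Omega> F u" and \<Omega>: "- {0} \<subseteq> \<Omega>" and u: "homogeneous d u" and d: "d \<noteq> 2"
    and x0: "x0 \<noteq> 0" and above: "\<forall>\<^sub>F z in nhds x0. u z \<le> quadratic (u x0) p B x0 z"
    and s: "s > 0"
  shows "F (s *\<^sub>R sym_part B) \<ge> 0"
proof -
  \<comment> \<open>The dilation whose effect on Hessians is multiplication by \<open>s\<close>.\<close>
  define t where "t = s powr (1 / (d - 2))"
  have t: "t > 0" using s by (simp add: t_def)
  have ts: "t powr d = s * t\<^sup>2"
  proof -
    have "t powr (d - 2) = s" using s d by (simp add: t_def powr_powr)
    then show ?thesis using t by (simp add: powr_diff powr_numeral field_simps)
  qed
  have "((\<lambda>z. (1/t) *\<^sub>R z) \<longlongrightarrow> (1/t) *\<^sub>R (t *\<^sub>R x0)) (nhds (t *\<^sub>R x0))"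
    by (intro tendsto_intros filterlim_ident)
  then have "\<forall>\<^sub>F z in nhds (t *\<^sub>R x0). u ((1/t) *\<^sub>R z) \<le> quadratic (u x0) p B x0 ((1/t) *\<^sub>R z)"
    using eventually_compose_filterlim[OF above] t by simp
  moreover have "\<forall>\<^sub>F z in nhds (t *\<^sub>R x0). z \<in> - {0}" using t x0 by (intro eventually_nhds_in_open) auto
  ultimately have "\<forall>\<^sub>F z in nhds (t *\<^sub>R x0). u z \<le> quadratic (u (t *\<^sub>R x0)) ((t powr d / t) *\<^sub>R p) (s *\<^sub>R B) (t *\<^sub>R x0) z"
  proof eventually_elim
    case (elim z)
    have "u (t *\<^sub>R ((1/t) *\<^sub>R z)) = t powr d * u ((1/t) *\<^sub>R z)"
      using u t elim(2) unfolding homogeneous_def by (metis ComplD divide_eq_0_iff insertI1 not_less_iff_gr_or_eq scaleR_eq_0_iff zero_neq_one)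
    then have "u z = t powr d * u ((1/t) *\<^sub>R z)" using t by simp
    also have "\<dots> \<le> t powr d * quadratic (u x0) p B x0 ((1/t) *\<^sub>R z)"
      using elim(1) by (intro mult_left_mono) auto
    also have "\<dots> = quadratic (u (t *\<^sub>R x0)) ((t powr d / t) *\<^sub>R p) (s *\<^sub>R B) (t *\<^sub>R x0) z"
    proof -
      define w where "w = (1/t) *\<^sub>R z - x0"
      have w: "z - t *\<^sub>R x0 = t *\<^sub>R w" using t by (simp add: w_def algebra_simps)
      have "u (t *\<^sub>R x0) = t powr d * u x0" using u t x0 by (simp add: homogeneous_def)
      then show ?thesis unfolding quadratic_def w w_def[symmetric]
        using t by (simp add: ts matrix_vector_mult_scaleR scaleR_matrix_vector_assoc[symmetric] power2_eq_square algebra_simps)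
    qed
    finally show ?case .
  qed
  moreover have "t *\<^sub>R x0 \<in> \<Omega>" using \<Omega> t x0 by auto
  ultimately have "F (sym_part (s *\<^sub>R B)) \<ge> 0"
    using viscosity_subsolution_quadratic[OF sub] by blast
  then show ?thesis by (simp add: sym_part_scaleR)
qed

text \<open>A homogeneous function has a touching paraboloid somewhere, and \<open>F\<close> is continuous along rays at 0.\<close>
lemma viscosity_subsolution_F0:
  fixes u :: "real^'n \<Rightarrow> real"
  assumes sub: "viscosity_subsolution \<Omega> F u" and \<Omega>: "- {0} \<subseteq> \<Omega>" and u: "homogeneous d u" "continuous_on (- {0}) u" and d: "d \<noteq> 2"
    and F: "\<And>H. H \<in> sym_matrices \<Longrightarrow> ((\<lambda>s. F (s *\<^sub>R H)) has_real_derivative matrix_inner A H) (at 0)"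
  shows "F 0 \<ge> 0"
proof -
  obtain x0 p B where "x0 \<noteq> 0" "\<forall>\<^sub>F z in nhds x0. u z \<le> quadratic (u x0) p B x0 z"
    using homogeneous_superjet_exists[OF u] by blast
  then have "F (s *\<^sub>R sym_part B) \<ge> 0" if "s > 0" for s
    using viscosity_subsolution_quadratic_rays[OF sub \<Omega> u(1) d _ _ that] by blast
  from right_limit_nonneg[OF F[OF sym_part_in_sym] this] show ?thesis by simp
qed

lemma inner_transpose_mult: "(transpose P *v p) \<bullet> w = p \<bullet> (P *v w)" for P :: "real^'n^'m"
  by (simp only: transpose_matrix_vector dot_lmul_matrix)

text \<open>Second derivatives of \<open>v (P x)\<close> have the form \<open>transpose P ** E ** P\<close>: in the new coordinates the operator is the trace.\<close>
lemma matrix_inner_congruence: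
  fixes A P E :: "real^'n^'n"
  assumes A: "A \<in> sym_matrices" and P: "P ** A ** transpose P = mat 1"
  shows "matrix_inner A (transpose P ** E ** P) = trace E"
proof -
  have "matrix_inner A (transpose P ** E ** P) = trace (A ** (transpose P ** (E ** P)))"
    using A by (simp add: matrix_inner_trace sym_matrices_def matrix_mul_assoc)
  also have "\<dots> = trace ((A ** transpose P ** E) ** P)" by (simp add: matrix_mul_assoc)
  also have "\<dots> = trace (P ** (A ** transpose P ** E))" by (rule trace_mul_sym)
  also have "\<dots> = trace ((P ** A ** transpose P) ** E)" by (simp add: matrix_mul_assoc)
  finally show ?thesis by (simp add: P)
qed

lemma matrix_inv_cancel:
  fixes P :: "real^'n^'n"
  assumes "invertible P"
  shows "matrix_inv P *v (P *v x) = x" "P *v (matrix_inv P *v x) = x"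
proof -
  have "P ** matrix_inv P = mat 1 \<and> matrix_inv P ** P = mat 1"
    using assms unfolding invertible_def matrix_inv_def by (rule someI_ex)
  then show "matrix_inv P *v (P *v x) = x" "P *v (matrix_inv P *v x) = x"
    by (simp_all add: matrix_vector_mul_assoc)
qed

text \<open>Here the nonlinear equation disappears: \<open>F\<close> is nonnegative on the whole ray through a touching Hessian
  and vanishes at its end point, so its derivative in that direction is nonnegative.\<close>
lemma viscosity_subsolution_imp_subharmonic:
  fixes u :: "real^'n \<Rightarrow> real" and P :: "real^'n^'n"
  assumes sub: "viscosity_subsolution \<Omega> F u" and \<Omega>: "- {0} \<subseteq> \<Omega>" and u: "homogeneous d u" and d: "d \<noteq> 2"
    and F: "\<And>H. H \<in> sym_matrices \<Longrightarrow> ((\<lambda>s. F (s *\<^sub>R H)) has_real_derivative matrix_inner A H) (at 0)"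
    and F0: "F 0 = 0" and A: "A \<in> sym_matrices" and P: "invertible P" "P ** A ** transpose P = mat 1"
  shows "viscosity_subharmonic (\<lambda>y. u (matrix_inv P *v y))"
  unfolding viscosity_subharmonic_quadratic
proof (intro allI impI)
  fix y0 p :: "real^'n" and B :: "real^'n^'n"
  assume y0: "y0 \<noteq> 0" and jet: "\<forall>e>0. \<forall>\<^sub>F y in nhds y0. u (matrix_inv P *v y) \<le> quadratic (u (matrix_inv P *v y0)) p (B + mat (2 * e)) y0 y"
  define x0 where "x0 = matrix_inv P *v y0"
  have inv: "matrix_inv P *v (P *v x) = x" "P *v (matrix_inv P *v x) = x" for x
    using matrix_inv_cancel[OF P(1)] by simp_all
  have y0x0: "y0 = P *v x0" by (simp add: x0_def inv)
  have x0: "x0 \<noteq> 0" using y0 y0x0 by auto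
  have "trace B + (2 * real CARD('n)) * e \<ge> 0" if "e > 0" for e
  proof -
    define E where "E = B + mat (2 * e)"
    define G where "G = transpose P ** E ** P"
    have "((\<lambda>x. P *v x) \<longlongrightarrow> P *v x0) (nhds x0)"
      using matrix_vector_mul_bounded_linear[of P] by (intro bounded_linear.tendsto[of "(*v) P"] filterlim_ident)
    then have "\<forall>\<^sub>F x in nhds x0. u (matrix_inv P *v (P *v x)) \<le> quadratic (u (matrix_inv P *v y0)) p E y0 (P *v x)"
      using eventually_compose_filterlim[OF jet[rule_format, OF that]] y0x0 unfolding E_def by simp
    moreover have "quadratic (u (matrix_inv P *v y0)) p E y0 (P *v x) = quadratic (u x0) (transpose P *v p) G x0 x" for x
    proof -
      have w: "P *v x - y0 = P *v (x - x0)" by (simp add: y0x0 matrix_vector_mult_diff_distrib)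
      have "(P *v w) \<bullet> (E *v (P *v w)) = w \<bullet> (G *v w)" for w
      proof -
        have "w \<bullet> (G *v w) = (transpose P *v (E *v (P *v w))) \<bullet> w"
          by (simp only: G_def matrix_vector_mul_assoc[symmetric] inner_commute[of w])
        then show ?thesis by (simp only: inner_transpose_mult inner_commute[of "E *v (P *v w)"])
      qed
      moreover have "p \<bullet> (P *v w) = (transpose P *v p) \<bullet> w" for w
        by (simp only: inner_transpose_mult)
      ultimately show ?thesis unfolding quadratic_def w by (simp add: x0_def)
    qed
    ultimately have "\<forall>\<^sub>F x in nhds x0. u x \<le> quadratic (u x0) (transpose P *v p) G x0 x"
      by (simp add: inv)
    from viscosity_subsolution_quadratic_rays[OF sub \<Omega> u d x0 this]
    have "matrix_inner A (sym_part G) \<ge> 0"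
      by (intro right_derivative_nonneg[OF F[OF sym_part_in_sym]]) (auto simp: F0)
    then have "matrix_inner A G \<ge> 0" using matrix_inner_sym_part[OF A] by simp
    moreover have "matrix_inner A G = trace E"
      unfolding G_def by (rule matrix_inner_congruence[OF A P(2)])
    ultimately show ?thesis by (simp add: E_def trace_add_mat algebra_simps)
  qed
  then show "trace B \<ge> 0" by (rule nonneg_if_all_perturbations_nonneg)
qed

text \<open>Statements about supersolutions follow from those about subsolutions; the new \<open>F\<close> has the same derivative at 0.\<close>
lemma viscosity_supersolution_negate:
  assumes "viscosity_supersolution \<Omega> F u"
  shows "viscosity_subsolution \<Omega> (\<lambda>M. - F (- M)) (\<lambda>x. - u x)"
  unfolding viscosity_subsolution_def
proof (intro ballI allI impI)
  fix x0 \<phi> assume x0: "x0 \<in> \<Omega>" and \<phi>: "smooth \<phi>" "\<phi> x0 = - u x0" "\<forall>\<^sub>F x in nhds x0. - u x \<le> \<phi> x"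
  have "smooth (\<lambda>x. - \<phi> x)" using \<phi>(1) Ck_on_minus[OF open_UNIV] unfolding smooth_def by blast
  moreover have "\<forall>\<^sub>F x in nhds x0. - \<phi> x \<le> u x" using \<phi>(3) by eventually_elim simp
  ultimately have "F (hessian (\<lambda>x. - \<phi> x) x0) \<le> 0"
    using assms x0 \<phi>(2) unfolding viscosity_supersolution_def by simp
  moreover have "hessian (\<lambda>x. - \<phi> x) x0 = - hessian \<phi> x0"
  proof -
    have C: "Ck_on 2 UNIV \<phi>" using \<phi>(1) by (simp add: smooth_def)
    have "pderiv_at j (\<lambda>x. - \<phi> x) = (\<lambda>x. - pderiv_at j \<phi> x)" for j
      using pderiv_at_minus Ck_on_2D(1)[OF C] by (auto simp: fun_eq_iff)
    then show ?thesis using Ck_on_2D(2)[OF C]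
      by (simp add: hessian_def vec_eq_iff pderiv_at_minus)
  qed
  ultimately show "0 \<le> - F (- hessian \<phi> x0)" by simp
qed

text \<open>Touching paraboloids with Hessian \<open>- 2 s I\<close> for all \<open>s > 0\<close> would make the derivative of \<open>F\<close> at 0 in the
  direction \<open>- I\<close> nonnegative, which contradicts ellipticity.\<close>
lemma viscosity_subsolution_no_concave_touch:
  fixes u :: "real^'n \<Rightarrow> real"
  assumes sub: "viscosity_subsolution \<Omega> F u" and x0: "x0 \<in> \<Omega>"
    and F: "\<And>H. H \<in> sym_matrices \<Longrightarrow> ((\<lambda>s. F (s *\<^sub>R H)) has_real_derivative matrix_inner A H) (at 0)"
    and F0: "F 0 = 0" and A: "trace A > 0"
    and touch: "\<And>s. s > 0 \<Longrightarrow> \<forall>\<^sub>F z in nhds x0. u z \<le> u x0 + p \<bullet> (z - x0) - s * (norm (z - x0))\<^sup>2"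
  shows False
proof -
  have sym: "mat c \<in> (sym_matrices :: (real^'n^'n) set)" for c by (simp add: sym_matrices_def transpose_mat)
  have "F (s *\<^sub>R mat (-2)) \<ge> 0" if "s > 0" for s
  proof -
    have "\<forall>\<^sub>F z in nhds x0. u z \<le> quadratic (u x0) p (0 + mat (2 * (- s))) x0 z"
      using touch[OF that] unfolding quadratic_add_square[symmetric] by (simp add: quadratic_def)
    from viscosity_subsolution_quadratic[OF sub x0 this]
    have "F (mat (2 * (- s))) \<ge> 0" by (simp add: sym_part_ident sym)
    moreover have "mat (2 * (- s)) = s *\<^sub>R (mat (-2) :: real^'n^'n)" by (simp add: mat_def vec_eq_iff)
    ultimately show ?thesis by simp
  qed
  from right_derivative_nonneg[OF F[OF sym] _ this] have "matrix_inner A (mat (-2)) \<ge> 0" by (simp add: F0)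
  moreover have "matrix_inner A (mat (-2)) = -2 * trace A"
    by (simp add: matrix_inner_def mat_def trace_def if_distrib[of "\<lambda>t. _ * t"] sum_distrib_left sum_negf mult.commute cong: if_cong)
  ultimately show False using A by simp
qed

text \<open>The rows of \<open>P\<close> are an orthonormal basis for the inner product \<open>x \<bullet> (A *v y)\<close>, built one vector at a time: a new
  vector has to be orthogonal, in the usual sense, to the images under \<open>A\<close> of those already chosen.\<close>
lemma positive_definite_normal_form:
  fixes A :: "real^'n^'n"
  assumes A: "A \<in> sym_matrices" and pos: "\<And>x. x \<noteq> 0 \<Longrightarrow> x \<bullet> (A *v x) > 0"
  shows "\<exists>P::real^'n^'n. invertible P \<and> P ** A ** transpose P = mat 1"
proof -
  have symA: "x \<bullet> (A *v y) = y \<bullet> (A *v x)" for x y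
    using A inner_transpose_mult[of A x y] by (simp add: sym_matrices_def inner_commute)
  have "\<exists>p :: 'n \<Rightarrow> real^'n. \<forall>i\<in>I. \<forall>j\<in>I. p i \<bullet> (A *v p j) = (if i = j then 1 else 0)" if "finite I" for I
    using that
  proof induction
    case (insert k I)
    then obtain p where p: "\<And>i j. i \<in> I \<Longrightarrow> j \<in> I \<Longrightarrow> p i \<bullet> (A *v p j) = (if i = j then 1 else 0)" by blast
    define S where "S = (\<lambda>i. A *v p i) ` I"
    have "dim S \<le> card S" unfolding S_def using insert by (intro dim_le_card') auto
    also have "\<dots> \<le> card I" unfolding S_def using insert by (intro card_image_le) auto
    also have "\<dots> < CARD('n)" using insert by (intro psubset_card_mono) auto
    finally have "dim S < DIM(real^'n)" by simp
    then obtain w where w: "w \<noteq> 0" "\<And>y. y \<in> span S \<Longrightarrow> orthogonal w y"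
      using orthogonal_to_subspace_exists by metis
    define w' where "w' = (1 / sqrt (w \<bullet> (A *v w))) *\<^sub>R w"
    have w'1: "w' \<bullet> (A *v w') = 1" using pos[OF w(1)]
      by (simp add: w'_def matrix_vector_mult_scaleR real_div_sqrt)
    have w'0: "w' \<bullet> (A *v p i) = 0" if "i \<in> I" for i
      using w(2)[of "A *v p i"] that by (simp add: w'_def S_def orthogonal_def span_base)
    have "\<forall>i\<in>insert k I. \<forall>j\<in>insert k I. (p(k := w')) i \<bullet> (A *v (p(k := w')) j) = (if i = j then 1 else 0)"
      using p w'1 w'0 symA insert by auto
    then show ?case by blast
  qed simp
  from this[of UNIV] obtain p :: "'n \<Rightarrow> real^'n" where p: "\<And>i j. p i \<bullet> (A *v p j) = (if i = j then 1 else 0)" by auto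
  define P where "P = (\<chi> i. p i)"
  have "(P ** (A ** transpose P)) $ i $ j = p i \<bullet> (A *v p j)" for i j
    by (simp add: P_def matrix_matrix_mult_def matrix_vector_mult_def inner_vec_def transpose_def)
  then have 1: "P ** (A ** transpose P) = mat 1" by (simp add: p mat_def vec_eq_iff)
  then have "invertible P" using matrix_left_right_inverse[of P "A ** transpose P"] unfolding invertible_def by blast
  then show ?thesis using 1 by (auto simp: matrix_mul_assoc)
qed

section \<open>The classification, and the value at the origin\<close>

lemma homogeneous_kelvin_transform:
  fixes v :: "real^'n \<Rightarrow> real"
  assumes n: "CARD('n) \<ge> 2" and d: "d \<le> 2 - real CARD('n)"
    and v: "homogeneous d v" "continuous_on (- {0}) v"
    and visc: "viscosity_subharmonic v" "viscosity_subharmonic (\<lambda>x. - v x)"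
  shows "\<exists>h. homogeneous_harmonic_polynomial (nat \<lfloor>2 - real CARD('n) - d\<rfloor>) h \<and>
           (\<forall>x. x \<noteq> 0 \<longrightarrow> v x = norm x powr (real CARD('n) - 2 + 2 * d) * h x)"
    and "d \<notin> \<int> \<Longrightarrow> x \<noteq> 0 \<Longrightarrow> v x = 0"
proof -
  define s where "s = 2 - real CARD('n) - 2 * d"
  define w where "w = (\<lambda>x. norm x powr s * v x)"
  have ds: "d + s = 2 - real CARD('n) - d" by (simp add: s_def)
  have vw: "v x = norm x powr (real CARD('n) - 2 + 2 * d) * w x" if "x \<noteq> 0" for x
    using that by (simp add: w_def s_def flip: powr_add mult.assoc)
  have hw: "homogeneous (d + s) w" unfolding w_def by (rule homogeneous_kelvin[OF v(1)])
  have "continuous_on (- {0}) (\<lambda>x::real^'n. norm x powr s)"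
    using Ck_on_norm_powr[of 0 s] by simp
  then have cw: "continuous_on (- {0}) w" unfolding w_def by (rule continuous_on_mult[OF _ v(2)])
  have sw: "viscosity_subharmonic w" unfolding w_def by (rule viscosity_subharmonic_kelvin[OF v(1) visc(1) s_def])
  have "homogeneous d (\<lambda>x. - v x)" using v(1) by (simp add: homogeneous_def)
  from viscosity_subharmonic_kelvin[OF this visc(2) s_def] have sw': "viscosity_subharmonic (\<lambda>x. - w x)"
    by (simp add: w_def)
  have "d + s \<ge> 0" using d ds by simp
  note K = homogeneous_viscosity_harmonic_nonneg_degree[OF n this hw cw sw sw']
  show "\<exists>h. homogeneous_harmonic_polynomial (nat \<lfloor>2 - real CARD('n) - d\<rfloor>) h \<and>
           (\<forall>x. x \<noteq> 0 \<longrightarrow> v x = norm x powr (real CARD('n) - 2 + 2 * d) * h x)"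
    using K(1) vw unfolding ds by metis
  assume "d \<notin> \<int>" "x \<noteq> 0"
  have "d + s \<notin> \<int>"
  proof
    assume "d + s \<in> \<int>"
    then have "2 - real CARD('n) - (d + s) \<in> \<int>" by (intro Ints_diff) auto
    then show False using \<open>d \<notin> \<int>\<close> ds by simp
  qed
  then show "v x = 0" using K(2) vw[OF \<open>x \<noteq> 0\<close>] \<open>x \<noteq> 0\<close> by simp
qed

text \<open>Connects the weight \<open>norm y powr s\<close> used so far with the Kelvin transform in its usual form.\<close>
lemma kelvin_transform_homogeneous:
  fixes h :: "real^'n \<Rightarrow> real"
  assumes "homogeneous_harmonic_polynomial k h" "y \<noteq> 0"
  shows "kelvin_transform h y = norm y powr (2 - real CARD('n) - 2 * real k) * h y"
proof -
  have "h ((1 / (norm y)\<^sup>2) *\<^sub>R y) = (1 / (norm y)\<^sup>2) ^ k * h y"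
    using assms(1) unfolding homogeneous_harmonic_polynomial_def by blast
  moreover have "(1 / (norm y)\<^sup>2) ^ k = norm y powr (- (2 * real k))"
  proof -
    have "norm y powr (- (2 * real k)) = inverse (norm y powr real (2 * k))"
      by (simp only: powr_minus of_nat_mult of_nat_numeral)
    also have "norm y powr real (2 * k) = norm y ^ (2 * k)" using assms(2) by (intro powr_realpow) simp
    also have "inverse \<dots> = (1 / (norm y)\<^sup>2) ^ k" by (simp add: power_one_over power_mult inverse_eq_divide)
    finally show ?thesis by simp
  qed
  ultimately show ?thesis unfolding kelvin_transform_def
    using powr_add[of "norm y" "2 - real CARD('n)" "- (2 * real k)"] by simp
qed

lemma zero_homogeneous_harmonic_polynomial: "homogeneous_harmonic_polynomial k (\<lambda>x::real^'n. 0)"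
  by (auto simp: homogeneous_harmonic_polynomial_def harmonic_on_def trace_hessian)

lemma homogeneous_viscosity_harmonic_vanishes:
  fixes v :: "real^'n \<Rightarrow> real"
  assumes v: "homogeneous d v" "continuous_on (- {0}) v"
    and visc: "viscosity_subharmonic v" "viscosity_subharmonic (\<lambda>x. - v x)"
    and d: "(- (real CARD('n) - 2) < d \<and> d < 0) \<or> d \<notin> \<int> \<or> (CARD('n) = 1 \<and> d \<noteq> 0 \<and> d \<noteq> 1)"
    and x: "x \<noteq> 0"
  shows "v x = 0"
proof -
  have n: "CARD('n) = 1 \<or> CARD('n) \<ge> 2" using zero_less_card_finite[where 'a = 'n] by linarith
  consider "CARD('n) = 1" | "- (real CARD('n) - 2) < d \<and> d < 0" | "CARD('n) \<ge> 2" "d \<ge> 0" "d \<notin> \<int>"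
    | "CARD('n) \<ge> 2" "d \<le> 2 - real CARD('n)" "d \<notin> \<int>"
    using n d by fastforce
  then show ?thesis
  proof cases
    case 1
    then have "d \<noteq> 0" "d \<noteq> 1" using d by auto
    then show ?thesis
      using homogeneous_dimension_one_zero[OF 1 v(1) visc Ck_on_dimension_one[OF 1 v(1)] _ _ x] by blast
  next
    case 2
    then have neg: "d * (d + real CARD('n) - 2) < 0" by (intro mult_neg_pos) auto
    have hc: "homogeneous d (\<lambda>x. - v x)" "continuous_on (- {0}) (\<lambda>x. - v x)"
      using v by (auto simp: homogeneous_def intro: continuous_on_minus)
    show ?thesis
      using homogeneous_viscosity_subharmonic_nonpos[OF v visc(1) neg x]
        homogeneous_viscosity_subharmonic_nonpos[OF hc visc(2) neg x] by simp
  next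
    case 3
    then show ?thesis using homogeneous_viscosity_harmonic_nonneg_degree(2)[OF 3(1,2) v visc 3(3) x] by simp
  next
    case 4
    then show ?thesis using homogeneous_kelvin_transform(2)[OF 4(1,2) v visc 4(3) x] by simp
  qed
qed

lemma homogeneous_viscosity_harmonic_C2:
  fixes v :: "real^'n \<Rightarrow> real"
  assumes v: "homogeneous d v" "continuous_on (- {0}) v"
    and visc: "viscosity_subharmonic v" "viscosity_subharmonic (\<lambda>x. - v x)"
  shows "Ck_on 2 (- {0}) v"
proof -
  have n: "CARD('n) = 1 \<or> CARD('n) \<ge> 2" using zero_less_card_finite[where 'a = 'n] by linarith
  have cong: "Ck_on 2 (- {0}) v" if "Ck_on 2 (- {0}) g" "\<And>x. x \<noteq> 0 \<Longrightarrow> v x = g x" for g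
    by (rule Ck_on_cong[THEN iffD2, OF _ _ that(1)]) (auto intro: that(2))
  have pC: "Ck_on 2 (- {0}) p" if "homogeneous_harmonic_polynomial k p" for k and p :: "real^'n \<Rightarrow> real"
    using that by (intro Ck_on_polynomial) (auto simp: homogeneous_harmonic_polynomial_def)
  consider "CARD('n) = 1" | "- (real CARD('n) - 2) < d \<and> d < 0" | "CARD('n) \<ge> 2" "d \<ge> 0"
    | "CARD('n) \<ge> 2" "d \<le> 2 - real CARD('n)"
    using n by fastforce
  then show ?thesis
  proof cases
    case 1
    then show ?thesis using Ck_on_dimension_one v(1) by blast
  next
    case 2
    then show ?thesis using homogeneous_viscosity_harmonic_vanishes[OF v visc]
      by (intro cong[of "\<lambda>x. 0"]) auto
  next
    case 3
    then show ?thesis using homogeneous_viscosity_harmonic_nonneg_degree(1)[OF 3 v visc] cong pC by metis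
  next
    case 4
    then obtain k h where h: "homogeneous_harmonic_polynomial k h"
      "\<And>x. x \<noteq> 0 \<Longrightarrow> v x = norm x powr (real CARD('n) - 2 + 2 * d) * h x"
      using homogeneous_kelvin_transform(1)[OF 4 v visc] by blast
    then show ?thesis
      by (intro cong[of "\<lambda>x. norm x powr (real CARD('n) - 2 + 2 * d) * h x"] Ck_on_mult Ck_on_norm_powr pC[OF h(1)]) auto
  qed
qed

text \<open>A value above the limit is the top of an isolated spike, and every concave paraboloid with its vertex there touches it from above.\<close>
lemma viscosity_subsolution_limit_at_origin:
  fixes u :: "real^'n \<Rightarrow> real"
  assumes sub: "viscosity_subsolution \<Omega> F u" and 0: "0 \<in> \<Omega>"
    and F: "\<And>H. H \<in> sym_matrices \<Longrightarrow> ((\<lambda>s. F (s *\<^sub>R H)) has_real_derivative matrix_inner A H) (at 0)"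
    and F0: "F 0 = 0" and A: "trace A > 0"
    and lim: "(u \<longlongrightarrow> l) (at 0)"
  shows "u 0 \<le> l"
proof (rule ccontr)
  assume "\<not> u 0 \<le> l"
  have "\<forall>\<^sub>F z in nhds 0. u z \<le> u 0 + 0 \<bullet> (z - 0) - s * (norm (z - 0))\<^sup>2" if "s > 0" for s
  proof -
    have "((\<lambda>z. u z + s * (norm z)\<^sup>2) \<longlongrightarrow> l + s * (norm (0::real^'n))\<^sup>2) (at 0)"
      by (intro tendsto_intros lim)
    moreover have "l + s * (norm (0::real^'n))\<^sup>2 < u 0" using \<open>\<not> u 0 \<le> l\<close> by simp
    ultimately have "\<forall>\<^sub>F z in at 0. u z + s * (norm z)\<^sup>2 < u 0" by (rule order_tendstoD(2))
    then have "\<forall>\<^sub>F z in at 0. u z \<le> u 0 + 0 \<bullet> (z - 0) - s * (norm (z - 0))\<^sup>2"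
      by eventually_elim simp
    then show ?thesis by (simp add: eventually_nhds_conv_at)
  qed
  then show False using viscosity_subsolution_no_concave_touch[OF sub 0 F F0 A, of 0] by blast
qed

text \<open>Near its vertex a cone opening downwards lies below every concave paraboloid with gradient \<open>p\<close> there.  This serves
  dimension one, where a function with a kink at the origin can be harmonic on both sides.\<close>
lemma viscosity_subsolution_no_concave_kink:
  fixes u :: "real^'n \<Rightarrow> real" and P :: "real^'n^'n"
  assumes sub: "viscosity_subsolution \<Omega> F u" and 0: "0 \<in> \<Omega>" "u 0 = 0"
    and F: "\<And>H. H \<in> sym_matrices \<Longrightarrow> ((\<lambda>s. F (s *\<^sub>R H)) has_real_derivative matrix_inner A H) (at 0)"
    and F0: "F 0 = 0" and A: "trace A > 0" and P: "invertible P"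
    and u: "\<And>z. z \<noteq> 0 \<Longrightarrow> u z = a * norm (P *v z) + p \<bullet> z"
  shows "a \<ge> 0"
proof (rule ccontr)
  assume a: "\<not> a \<ge> 0"
  obtain B where B: "B > 0" "\<And>y. norm (matrix_inv P *v y) \<le> norm y * B"
    using bounded_linear.pos_bounded[OF matrix_vector_mul_bounded_linear[of "matrix_inv P"]] by blast
  have "\<forall>\<^sub>F z in nhds 0. u z \<le> u 0 + p \<bullet> (z - 0) - s * (norm (z - 0))\<^sup>2" if s: "s > 0" for s
    unfolding eventually_nhds_metric
  proof (intro exI[of _ "- a / (s * B)"] conjI allI impI)
    show "- a / (s * B) > 0" using a s B by (intro divide_pos_pos) auto
    fix z :: "real^'n" assume "dist z 0 < - a / (s * B)"
    then have small: "s * B * norm z \<le> - a" using s B by (simp add: field_simps)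
    have "norm z \<le> norm (P *v z) * B" using B(2)[of "P *v z"] by (simp add: matrix_inv_cancel[OF P])
    then have "s * norm z * norm z \<le> s * norm z * (norm (P *v z) * B)" using s by (intro mult_left_mono) auto
    also have "\<dots> = s * B * norm z * norm (P *v z)" by simp
    also have "\<dots> \<le> - a * norm (P *v z)" using small by (intro mult_right_mono) auto
    finally have "a * norm (P *v z) \<le> - (s * (norm z)\<^sup>2)" by (simp add: power2_eq_square)
    then show "u z \<le> u 0 + p \<bullet> (z - 0) - s * (norm (z - 0))\<^sup>2"
      using u[of z] 0(2) by (cases "z = 0") auto
  qed
  then show False using viscosity_subsolution_no_concave_touch[OF sub 0(1) F F0 A, of p] by blast
qed

lemma hessian_compose_matrix:
  fixes v :: "real^'n \<Rightarrow> real" and P :: "real^'n^'n"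
  assumes "open S" "open T" "\<And>x. x \<in> T \<Longrightarrow> P *v x \<in> S" "Ck_on 2 S v" "x \<in> T"
  shows "hessian (\<lambda>x. v (P *v x)) x = transpose P ** hessian v (P *v x) ** P"
proof -
  have "pderiv_at i (pderiv_at j (\<lambda>x. v (P *v x))) x
      = (\<Sum>l\<in>UNIV. P $ l $ j * (\<Sum>k\<in>UNIV. P $ k $ i * pderiv_at k (pderiv_at l v) (P *v x)))" for i j
  proof -
    have "pderiv_at i (pderiv_at j (\<lambda>x. v (P *v x))) x
        = pderiv_at i (\<lambda>y. \<Sum>l\<in>UNIV. P $ l $ j * pderiv_at l v (P *v y)) x"
      by (rule pderiv_at_cong_open[OF assms(2,5)])
        (use pderiv_at_compose_matrix Ck_on_2D(1)[OF assms(4,1)] assms(3) in blast)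
    also have "\<dots> = (\<Sum>l\<in>UNIV. P $ l $ j * pderiv_at i (\<lambda>y. pderiv_at l v (P *v y)) x)"
    proof -
      have d: "(\<lambda>y. pderiv_at l v (P *v y)) differentiable (at x)" for l
      proof -
        have "(\<lambda>x. P *v x) differentiable (at x)"
          by (rule bounded_linear_imp_differentiable) (rule matrix_vector_mul_bounded_linear)
        then show ?thesis
          using differentiable_chain_at[of "\<lambda>x. P *v x" x "pderiv_at l v"] Ck_on_2D(2)[OF assms(4,1) assms(3)[OF assms(5)]]
          by (simp add: o_def)
      qed
      show ?thesis by (subst pderiv_at_sum) (auto simp: pderiv_at_cmult d)
    qed
    also have "\<dots> = (\<Sum>l\<in>UNIV. P $ l $ j * (\<Sum>k\<in>UNIV. P $ k $ i * pderiv_at k (pderiv_at l v) (P *v x)))"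
      by (intro sum.cong refl arg_cong2[of _ _ _ _ "(*)"] pderiv_at_compose_matrix Ck_on_2D(2)[OF assms(4,1)] assms(3,5))
    finally show ?thesis .
  qed
  then show ?thesis
    by (simp add: vec_eq_iff hessian_def matrix_matrix_mult_def transpose_def mult.commute)
qed

section \<open>Homogeneous solutions of the nonlinear equation\<close>

theorem theorem0p1:
  fixes F :: "real^'n^'n \<Rightarrow> real" and u :: "real^'n \<Rightarrow> real" and d \<mu> :: real
    and \<Omega> :: "(real^'n) set"
  assumes "d \<noteq> 2"
    and "homogeneous d u"
    and "continuous_on (- {0}) u"
    and "C1_on_sym F"
    and "\<mu> > 0"
    and "\<And>M. M \<in> sym_matrices \<Longrightarrow>
           loewner_le (\<mu> *\<^sub>R mat 1) (F_partial F M) \<and>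
           loewner_le (F_partial F M) (inverse \<mu> *\<^sub>R mat 1)"
    \<comment> \<open>so \<open>\<Omega>\<close> is the whole space or the whole space without the origin\<close>
    and "- {0} \<subseteq> \<Omega>"
    and "viscosity_solution \<Omega> F u"
  shows "Ck_on 2 (- {0}) u \<and>
    (\<forall>x. x \<noteq> 0 \<longrightarrow> (\<Sum>i\<in>UNIV. \<Sum>j\<in>UNIV. F_partial F 0 $ i $ j * hessian u x $ i $ j) = 0) \<and>
    ((- (real CARD('n) - 2) < d \<and> d < 0) \<or> d \<notin> \<int> \<longrightarrow> (\<forall>x\<in>\<Omega>. u x = 0)) \<and>
    (\<exists>P :: real^'n^'n. invertible P \<and> P ** F_partial F 0 ** transpose P = mat 1 \<and>
       harmonic_on (- {0}) (\<lambda>y. u (matrix_inv P *v y)) \<and>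
       (d \<in> \<int> \<and> d \<ge> 0 \<and> (CARD('n) = 1 \<longrightarrow> d \<noteq> 0 \<and> (d = 1 \<longrightarrow> 0 \<in> \<Omega>)) \<longrightarrow>
          (\<exists>p. homogeneous_harmonic_polynomial (nat \<lfloor>d\<rfloor>) p \<and>
               (\<forall>x\<in>\<Omega>. u x = p (P *v x)))) \<and>
       (d \<in> \<int> \<and> d < 0 \<and> d \<le> - (real CARD('n) - 2) \<longrightarrow>
          (\<exists>h. homogeneous_harmonic_polynomial (nat \<lfloor>2 - real CARD('n) - d\<rfloor>) h \<and>
               (\<forall>x. x \<noteq> 0 \<longrightarrow> u x = kelvin_transform h (P *v x)))))"
proof -
  define A where "A = F_partial F 0"
  have sym0: "0 \<in> (sym_matrices :: (real^'n^'n) set)" by (simp add: sym_matrices_def transpose_def vec_eq_iff)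
  have symA: "A \<in> sym_matrices" unfolding A_def by (rule C1_on_sym_directional_derivative(2)[OF \<open>C1_on_sym F\<close> sym0])
  have F: "((\<lambda>s. F (s *\<^sub>R H)) has_real_derivative matrix_inner A H) (at 0)" if "H \<in> sym_matrices" for H
    unfolding A_def by (rule C1_on_sym_directional_derivative(1)[OF \<open>C1_on_sym F\<close> that])
  have pos: "x \<bullet> (A *v x) > 0" if "x \<noteq> 0" for x
  proof -
    have "x \<bullet> ((\<mu> *\<^sub>R mat 1) *v x) \<le> x \<bullet> (A *v x)"
      using assms(6)[OF sym0] by (simp add: loewner_le_def A_def)
    moreover have "x \<bullet> ((\<mu> *\<^sub>R mat 1) *v x) = \<mu> * (x \<bullet> x)"
      by (simp add: scaleR_matrix_vector_assoc[symmetric])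
    moreover have "\<mu> * (x \<bullet> x) > 0" using \<open>\<mu> > 0\<close> that by simp
    ultimately show ?thesis by linarith
  qed
  have "A $ i $ i > 0" for i
  proof -
    have "axis i 1 \<noteq> (0::real^'n)" by (simp add: axis_eq_0_iff)
    from pos[OF this] show ?thesis by (simp add: matrix_vector_mult_basis column_def inner_axis')
  qed
  then have trA: "trace A > 0" unfolding trace_def by (intro sum_pos) auto
  obtain P :: "real^'n^'n" where P: "invertible P" "P ** A ** transpose P = mat 1"
    using positive_definite_normal_form[OF symA pos] by blast
  note inv = matrix_inv_cancel[OF P(1)]

  \<comment> \<open>The supersolution property is used for \<open>- u\<close>, which is a subsolution for \<open>F'\<close>.\<close>
  define F' where "F' = (\<lambda>M. - F (- M))"
  define u' where "u' = (\<lambda>x. - u x)"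
  have sub: "viscosity_subsolution \<Omega> F u" and sub': "viscosity_subsolution \<Omega> F' u'"
    using \<open>viscosity_solution \<Omega> F u\<close> viscosity_supersolution_negate[of \<Omega> F u]
    by (simp_all add: viscosity_solution_def F'_def u'_def)
  have F': "((\<lambda>s. F' (s *\<^sub>R H)) has_real_derivative matrix_inner A H) (at 0)" if "H \<in> sym_matrices" for H
  proof -
    have "- H \<in> sym_matrices" using that by (auto simp: sym_matrices_def transpose_def vec_eq_iff)
    from DERIV_minus[OF F[OF this]] show ?thesis
      by (simp add: F'_def matrix_inner_def sum_negf)
  qed
  have hu: "homogeneous d u" "continuous_on (- {0}) u" and hu': "homogeneous d u'" "continuous_on (- {0}) u'"
    using \<open>homogeneous d u\<close> \<open>continuous_on (- {0}) u\<close>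
    by (auto simp: u'_def homogeneous_def intro: continuous_on_minus)
  have \<Omega>: "- {0} \<subseteq> \<Omega>" and d2: "d \<noteq> 2" using assms by auto
  have "F 0 \<ge> 0" using viscosity_subsolution_F0[OF sub \<Omega> hu d2 F] .
  moreover have "F' 0 \<ge> 0" using viscosity_subsolution_F0[OF sub' \<Omega> hu' d2 F'] .
  ultimately have F0: "F 0 = 0" "F' 0 = 0" by (auto simp: F'_def)

  define v where "v = (\<lambda>y. u (matrix_inv P *v y))"
  have uv: "u x = v (P *v x)" for x by (simp add: v_def inv)
  have P0: "P *v x \<noteq> 0" "matrix_inv P *v x \<noteq> 0" if "x \<noteq> 0" for x
    using that inv[of x] by (metis matrix_vector_mult_0_right)+
  have hv: "homogeneous d v"
    using hu(1) P0(2) by (simp add: homogeneous_def v_def matrix_vector_mult_scaleR)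
  have cont: "continuous_on S (\<lambda>x. Q *v x)" for S and Q :: "real^'n^'n"
    by (rule linear_continuous_on) (rule matrix_vector_mul_bounded_linear)
  have "(\<lambda>y. matrix_inv P *v y) ` (- {0}) \<subseteq> - {0}"
  proof
    fix z assume "z \<in> (\<lambda>y. matrix_inv P *v y) ` (- {0})"
    then obtain y where "y \<noteq> 0" "z = matrix_inv P *v y" by blast
    then show "z \<in> - {0}" using P0(2)[of y] by simp
  qed
  from continuous_on_compose2[OF hu(2) cont this]
  have cv: "continuous_on (- {0}) v" by (simp add: v_def)
  have visc: "viscosity_subharmonic v" "viscosity_subharmonic (\<lambda>y. - v y)"
    using viscosity_subsolution_imp_subharmonic[OF sub \<Omega> hu(1) d2 F F0(1) symA P]
      viscosity_subsolution_imp_subharmonic[OF sub' \<Omega> hu'(1) d2 F' F0(2) symA P]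
    by (simp_all add: v_def u'_def)
  note v = hv cv visc
  have Cv: "Ck_on 2 (- {0}) v" by (rule homogeneous_viscosity_harmonic_C2[OF v])
  have lap: "laplacian v y = 0" if "y \<noteq> 0" for y
    by (rule viscosity_harmonic_imp_laplacian[OF visc Cv that])
  have opn: "open (- {0::real^'n})" by auto

  \<comment> \<open>The equation at the origin rules out any value other than the limit.\<close>
  have origin: "u 0 = l" if "0 \<in> \<Omega>" "(u \<longlongrightarrow> l) (at 0)" for l
  proof -
    have "u 0 \<le> l" by (rule viscosity_subsolution_limit_at_origin[OF sub that(1) F F0(1) trA that(2)])
    moreover have "u' 0 \<le> - l"
      by (rule viscosity_subsolution_limit_at_origin[OF sub' that(1) F' F0(2) trA])
        (use that(2) in \<open>auto simp: u'_def intro: tendsto_minus\<close>)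
    ultimately show ?thesis by (simp add: u'_def)
  qed
  have extend: "\<forall>x\<in>\<Omega>. u x = p (P *v x)" if "real_polynomial_function p" "\<And>y. y \<noteq> 0 \<Longrightarrow> v y = p y" for p
  proof
    fix x assume "x \<in> \<Omega>"
    show "u x = p (P *v x)"
    proof (cases "x = 0")
      case True
      have "continuous_on UNIV p" using Ck_on_polynomial[OF open_UNIV that(1), of 0] by simp
      from continuous_on_compose2[OF this cont[of UNIV P]]
      have "continuous_on UNIV (\<lambda>x. p (P *v x))" by simp
      then have "((\<lambda>x. p (P *v x)) \<longlongrightarrow> p (P *v 0)) (at 0)" unfolding continuous_on_def by blast
      then have "(u \<longlongrightarrow> p (P *v 0)) (at 0)"
        by (rule Lim_transform_eventually)
          (use uv that(2) P0(1) in \<open>auto simp: eventually_at_filter\<close>)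
      then show ?thesis using origin True \<open>x \<in> \<Omega>\<close> by blast
    qed (use uv that(2) P0(1) in simp)
  qed

  have "Ck_on 2 (- {0}) (\<lambda>x. v (P *v x))"
    by (rule Ck_on_compose_matrix[OF opn opn _ Cv]) (use P0 in auto)
  then have C2: "Ck_on 2 (- {0}) u" by (simp add: uv[symmetric])

  have pde: "(\<Sum>i\<in>UNIV. \<Sum>j\<in>UNIV. F_partial F 0 $ i $ j * hessian u x $ i $ j) = 0" if x: "x \<noteq> 0" for x
  proof -
    have "hessian u x = transpose P ** hessian v (P *v x) ** P"
      using hessian_compose_matrix[OF opn opn _ Cv, of P x] P0(1) x by (simp add: uv[symmetric])
    then have "matrix_inner A (hessian u x) = trace (hessian v (P *v x))"
      using matrix_inner_congruence[OF symA P(2)] by simp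
    also have "\<dots> = 0" using lap[OF P0(1)[OF x]] by (simp add: trace_def trace_hessian)
    finally show ?thesis by (simp add: matrix_inner_def A_def)
  qed

  have zero: "\<forall>x\<in>\<Omega>. u x = 0" if "(- (real CARD('n) - 2) < d \<and> d < 0) \<or> d \<notin> \<int>"
    using extend[of "\<lambda>y. 0"] homogeneous_viscosity_harmonic_vanishes[OF v] that by auto

  have harm: "harmonic_on (- {0}) (\<lambda>y. u (matrix_inv P *v y))"
    using Cv lap unfolding v_def[symmetric] by (simp add: harmonic_on_def trace_hessian)

  have n: "CARD('n) = 1 \<or> CARD('n) \<ge> 2" using zero_less_card_finite[where 'a = 'n] by linarith

  have nonneg: "\<exists>p. homogeneous_harmonic_polynomial (nat \<lfloor>d\<rfloor>) p \<and> (\<forall>x\<in>\<Omega>. u x = p (P *v x))"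
    if d: "d \<in> \<int>" "d \<ge> 0" "CARD('n) = 1 \<longrightarrow> d \<noteq> 0 \<and> (d = 1 \<longrightarrow> 0 \<in> \<Omega>)"
  proof -
    consider "CARD('n) \<ge> 2" | "CARD('n) = 1" "d \<noteq> 0" "d \<noteq> 1" | "CARD('n) = 1" "d = 1" "0 \<in> \<Omega>"
      using n d by auto
    then show ?thesis
    proof cases
      case 1
      obtain p where p: "homogeneous_harmonic_polynomial (nat \<lfloor>d\<rfloor>) p" "\<And>y. y \<noteq> 0 \<Longrightarrow> v y = p y"
        using homogeneous_viscosity_harmonic_nonneg_degree(1)[OF 1 d(2) v] by blast
      then show ?thesis using extend[of p] by (auto simp: homogeneous_harmonic_polynomial_def)
    next
      case 2
      then have "v y = 0" if "y \<noteq> 0" for y using homogeneous_viscosity_harmonic_vanishes[OF v _ that] by blast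
      then show ?thesis using extend[of "\<lambda>y. 0"] zero_homogeneous_harmonic_polynomial by blast
    next
      case 3
      obtain a b i where nx: "\<And>x::real^'n. norm x = \<bar>x $ i\<bar>"
        and ab: "\<And>y. y \<noteq> 0 \<Longrightarrow> v y = a * norm y powr d + b * (norm y powr (d - 1) * y $ i)"
        using homogeneous_dimension_one[OF 3(1) hv] by blast
      have vab: "v y = a * norm y + b * y $ i" if "y \<noteq> 0" for y using ab[OF that] 3(2) that by simp
      have row: "(P *v x) $ i = (P $ i) \<bullet> x" for x by (simp add: matrix_vector_mult_def inner_vec_def)
      have kink: "u z = a * norm (P *v z) + (b *\<^sub>R (P $ i)) \<bullet> z" "u' z = - a * norm (P *v z) + (- b *\<^sub>R (P $ i)) \<bullet> z"
        if "z \<noteq> 0" for z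
        using uv[of z] vab[OF P0(1)[OF that]] by (simp_all add: u'_def row)
      have "continuous_on UNIV (\<lambda>z. a * norm (P *v z) + (b *\<^sub>R (P $ i)) \<bullet> z)"
        by (intro continuous_intros cont)
      then have "((\<lambda>z. a * norm (P *v z) + (b *\<^sub>R (P $ i)) \<bullet> z) \<longlongrightarrow> a * norm (P *v 0) + (b *\<^sub>R (P $ i)) \<bullet> 0) (at 0)"
        unfolding continuous_on_def by blast
      then have "((\<lambda>z. a * norm (P *v z) + (b *\<^sub>R (P $ i)) \<bullet> z) \<longlongrightarrow> 0) (at 0)" by simp
      then have "(u \<longlongrightarrow> 0) (at 0)"
        by (rule Lim_transform_eventually) (use kink(1) in \<open>auto simp: eventually_at_filter\<close>)
      then have u0: "u 0 = 0" "u' 0 = 0" using origin 3(3) by (auto simp: u'_def)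
      have "a \<ge> 0" by (rule viscosity_subsolution_no_concave_kink[OF sub 3(3) u0(1) F F0(1) trA P(1) kink(1)])
      moreover have "- a \<ge> 0" by (rule viscosity_subsolution_no_concave_kink[OF sub' 3(3) u0(2) F' F0(2) trA P(1) kink(2)])
      ultimately have "a = 0" by simp
      define p where "p = (\<lambda>y::real^'n. b * y $ i)"
      have pp: "real_polynomial_function p" unfolding p_def by (intro polynomial_intros)
      have vp: "v y = p y" if "y \<noteq> 0" for y using vab[OF that] \<open>a = 0\<close> by (simp add: p_def)
      have "homogeneous_polynomial 1 p" using pp by (simp add: homogeneous_polynomial_def p_def)
      then have "homogeneous_harmonic_polynomial 1 p"
        using laplacian_homogeneous_polynomial_small[of 1 p] pp Ck_on_polynomial[OF open_UNIV pp]
        by (simp add: homogeneous_harmonic_polynomial_def homogeneous_polynomial_def harmonic_on_def trace_hessian)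
      then show ?thesis using extend[OF pp vp] 3(2) by auto
    qed
  qed

  have neg: "\<exists>h. homogeneous_harmonic_polynomial (nat \<lfloor>2 - real CARD('n) - d\<rfloor>) h \<and>
               (\<forall>x. x \<noteq> 0 \<longrightarrow> u x = kelvin_transform h (P *v x))"
    if d: "d \<in> \<int>" "d < 0" "d \<le> - (real CARD('n) - 2)"
  proof (cases "CARD('n) = 1")
    case True
    have "v y = 0" if "y \<noteq> 0" for y using homogeneous_viscosity_harmonic_vanishes[OF v _ that] True d(2) by simp
    then have "u x = kelvin_transform (\<lambda>x. 0) (P *v x)" if "x \<noteq> 0" for x
      using uv[of x] P0(1)[OF that] by (simp add: kelvin_transform_def)
    then show ?thesis using zero_homogeneous_harmonic_polynomial by blast
  next
    case False
    then have n2: "CARD('n) \<ge> 2" using n by simp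
    \<comment> \<open>\<open>k\<close> is the degree after the Kelvin transform.\<close>
    define k where "k = nat \<lfloor>2 - real CARD('n) - d\<rfloor>"
    have "2 - real CARD('n) - d \<in> \<int>" using d(1) by (intro Ints_diff) auto
    then have k: "real k = 2 - real CARD('n) - d" using d(3) unfolding k_def by (auto elim!: Ints_cases)
    obtain h where h: "homogeneous_harmonic_polynomial k h"
      "\<And>x. x \<noteq> 0 \<Longrightarrow> v x = norm x powr (real CARD('n) - 2 + 2 * d) * h x"
      using homogeneous_kelvin_transform(1)[OF n2 _ v] d(3) unfolding k_def by auto
    have "u x = kelvin_transform h (P *v x)" if "x \<noteq> 0" for x
      using uv[of x] h(2)[OF P0(1)[OF that]] kelvin_transform_homogeneous[OF h(1) P0(1)[OF that]]
      by (simp add: k algebra_simps)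
    then show ?thesis using h(1) unfolding k_def by blast
  qed

  show ?thesis
    using C2 pde zero harm nonneg neg P unfolding A_def by blast
qed

end
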